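(* Let $I$ be a monomial ideal of $S=K[x_1,\ldots,x_n]$ over a field $K$ with $\mathrm{char}(K)=0$. If $d=\dim(S/I)=2$ and $f_1,f_2$ are the linear polynomials $$f_1=\sum_{i=1}^n i\,x_i\quad\text{and}\quad f_2=\sum_{i=2}^n(i-1)x_i,$$ then $\{f_1,f_2\}$ is a system of parameters for $S/I$. Furthermore, $S/I$ is a Cohen--Macaulay ring if and only if $\{f_1,f_2\}$ is a regular sequence on $S/I$.
   Context: With $\mathfrak m=(x_1,\ldots,x_n)$, homogeneous polynomials $f_1,\ldots,f_d\in S$ form a system of parameters for $S/I$ if $d=\dim(S/I)$ and $\mathrm{rad}(I,f_1,\ldots,f_d)=\mathfrak m$. A sequence $f_1,\ldots,f_d$ of forms is a regular sequence on $S/I$ if $((I,f_1,\ldots,f_i):f_{i+1})=(I,f_1,\ldots,f_i)$ for $i=0,\ldots,d-1$ (for $i=0$ this means $(I:f_1)=I$). *)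

theory Defs
  imports "HOL-Algebra.QuotRing" "HOL-Algebra.Ring_Divisibility"
    "HOL-Library.Poly_Mapping" "HOL-Library.Extended_Nat"
begin

section \<open>Commutative algebra over an arbitrary ring record\<close>

definition colon_ideal :: "('a, 'b) ring_scheme \<Rightarrow> 'a set \<Rightarrow> 'a \<Rightarrow> 'a set" where
  "colon_ideal R I f = {r \<in> carrier R. r \<otimes>\<^bsub>R\<^esub> f \<in> I}"

definition radical_ideal :: "('a, 'b) ring_scheme \<Rightarrow> 'a set \<Rightarrow> 'a set" where
  "radical_ideal R I = {r \<in> carrier R. \<exists>k::nat. r [^]\<^bsub>R\<^esub> k \<in> I}"

text \<open>The sequence \<open>fs = [f\<^sub>1, \<dots>, f\<^sub>d]\<close> of elements of \<open>R\<close> is regular on \<open>R/I\<close>: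
  \<open>((I, f\<^sub>1, \<dots>, f\<^sub>i) : f\<^sub>i\<^sub>+\<^sub>1) = (I, f\<^sub>1, \<dots>, f\<^sub>i)\<close> for all \<open>i < d\<close>. As list
  positions start at 0, \<open>fs ! i\<close> is \<open>f\<^sub>i\<^sub>+\<^sub>1\<close>. Note that \<open>(I, f\<^sub>1, \<dots>, f\<^sub>d)\<close> is not
  required to be a proper ideal.\<close>
definition regular_sequence :: "('a, 'b) ring_scheme \<Rightarrow> 'a set \<Rightarrow> 'a list \<Rightarrow> bool" where
  "regular_sequence R I fs \<longleftrightarrow> set fs \<subseteq> carrier R \<and>
     (\<forall>i < length fs.
        colon_ideal R (Idl\<^bsub>R\<^esub> (I \<union> set (take i fs))) (fs ! i) = Idl\<^bsub>R\<^esub> (I \<union> set (take i fs)))"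

text \<open>A strictly increasing chain \<open>P 0 \<subset> \<dots> \<subset> P k\<close> of prime ideals has length \<open>k\<close>;
  values of \<open>P\<close> beyond \<open>k\<close> are irrelevant.\<close>
definition prime_chain :: "('a, 'b) ring_scheme \<Rightarrow> nat \<Rightarrow> (nat \<Rightarrow> 'a set) \<Rightarrow> bool" where
  "prime_chain R k P \<longleftrightarrow> (\<forall>i\<le>k. primeideal (P i) R) \<and> (\<forall>i<k. P i \<subset> P (Suc i))"

text \<open>The zero ring gets Krull dimension 0, the least element of \<^typ>\<open>enat\<close>.\<close>
definition krull_dim :: "('a, 'b) ring_scheme \<Rightarrow> enat" where
  "krull_dim R = Sup {enat k | k. \<exists>P. prime_chain R k P}"

definition prime_height :: "('a, 'b) ring_scheme \<Rightarrow> 'a set \<Rightarrow> enat" where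
  "prime_height R Q = Sup {enat k | k. \<exists>P. prime_chain R k P \<and> P k = Q}"

text \<open>The length of the longest \<open>R\<close>-regular sequence contained in the ideal \<open>Q\<close>. It is used
  for proper ideals only, where the condition that the sequence should not generate the unit
  ideal holds automatically.\<close>
definition ideal_depth :: "('a, 'b) ring_scheme \<Rightarrow> 'a set \<Rightarrow> enat" where
  "ideal_depth R Q = Sup {enat (length xs) | xs. set xs \<subseteq> Q \<and> regular_sequence R {\<zero>\<^bsub>R\<^esub>} xs}"

text \<open>A Noetherian ring all of whose localizations at maximal ideals are Cohen--Macaulay local
  rings, in the form that avoids localizations (Eisenbud, Commutative Algebra, Chapter 18):
  the depth of \<open>Q\<close> on \<open>R\<close> and the height of \<open>Q\<close> are the depth and the dimension of the
  localization of \<open>R\<close> at \<open>Q\<close>.\<close>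
definition cohen_macaulay_ring :: "('a, 'b) ring_scheme \<Rightarrow> bool" where
  "cohen_macaulay_ring R \<longleftrightarrow> cring R \<and> noetherian_ring R \<and>
     (\<forall>Q. maximalideal Q R \<longrightarrow> ideal_depth R Q = prime_height R Q)"


section \<open>The polynomial ring in the variables with indices \<open>1, \<dots>, n\<close>\<close>

text \<open>A monomial is the finitely supported function mapping the index of each variable to its
  exponent, and a polynomial is a finitely supported function from monomials to coefficients
  (\<^const>\<open>Poly_Mapping.keys\<close> is the support).\<close>
type_synonym 'k mpoly = "(nat \<Rightarrow>\<^sub>0 nat) \<Rightarrow>\<^sub>0 'k"

definition mpoly_ring :: "nat \<Rightarrow> 'k::comm_ring_1 mpoly ring" where
  "mpoly_ring n = \<lparr>carrier = {p. \<forall>t \<in> Poly_Mapping.keys p. Poly_Mapping.keys t \<subseteq> {1..n}},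
     mult = (*), one = 1, zero = 0, add = (+)\<rparr>"

definition Var :: "nat \<Rightarrow> 'k::comm_ring_1 mpoly" where
  "Var i = Poly_Mapping.single (Poly_Mapping.single i 1) 1"

definition homogeneous :: "'k::comm_ring_1 mpoly \<Rightarrow> bool" where
  "homogeneous p \<longleftrightarrow> (\<exists>d. \<forall>t \<in> Poly_Mapping.keys p.
     (\<Sum>i\<in>Poly_Mapping.keys t. Poly_Mapping.lookup t i) = d)"

definition irrelevant_ideal :: "nat \<Rightarrow> 'k::comm_ring_1 mpoly set" where
  "irrelevant_ideal n = Idl\<^bsub>mpoly_ring n\<^esub> (Var ` {1..n})"

definition monomial_ideal :: "nat \<Rightarrow> 'k::comm_ring_1 mpoly set \<Rightarrow> bool" where
  "monomial_ideal n I \<longleftrightarrow>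
     (\<exists>M. (\<forall>t\<in>M. Poly_Mapping.keys t \<subseteq> {1..n}) \<and>
          I = Idl\<^bsub>mpoly_ring n\<^esub> ((\<lambda>t. Poly_Mapping.single t 1) ` M))"

definition system_of_parameters :: "nat \<Rightarrow> 'k::comm_ring_1 mpoly set \<Rightarrow> 'k mpoly list \<Rightarrow> bool" where
  "system_of_parameters n I fs \<longleftrightarrow>
     set fs \<subseteq> carrier (mpoly_ring n) \<and> (\<forall>f \<in> set fs. homogeneous f) \<and>
     krull_dim (mpoly_ring n Quot I) = enat (length fs) \<and>
     radical_ideal (mpoly_ring n) (Idl\<^bsub>mpoly_ring n\<^esub> (I \<union> set fs)) = irrelevant_ideal n"

lemma cring_mpoly_ring: "cring (mpoly_ring n :: 'k::comm_ring_1 mpoly ring)"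
proof -
  let ?S = "mpoly_ring n :: 'k mpoly ring"
  have add: "p + q \<in> carrier ?S" if "p \<in> carrier ?S" "q \<in> carrier ?S" for p q
    using that keys_add[of p q] unfolding mpoly_ring_def by auto
  have mult: "p * q \<in> carrier ?S" if pq: "p \<in> carrier ?S" "q \<in> carrier ?S" for p q
  proof -
    have "Poly_Mapping.keys t \<subseteq> {1..n}" if t: "t \<in> Poly_Mapping.keys (p * q)" for t
    proof -
      from t obtain a b
        where ab: "a \<in> Poly_Mapping.keys p" "b \<in> Poly_Mapping.keys q" "t = a + b"
        using keys_mult[of p q] by blast
      then have "Poly_Mapping.keys a \<subseteq> {1..n}" "Poly_Mapping.keys b \<subseteq> {1..n}"
        using pq by (simp_all add: mpoly_ring_def)
      then show ?thesis using keys_add[of a b] ab(3) by blast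
    qed
    then show ?thesis by (simp add: mpoly_ring_def)
  qed
  have uminus: "- p \<in> carrier ?S" if "p \<in> carrier ?S" for p
    using that by (simp add: mpoly_ring_def)
  have closed: "0 \<in> carrier ?S" "1 \<in> carrier ?S"
    by (simp_all add: mpoly_ring_def)
  have ops: "mult ?S = (*)" "one ?S = 1" "zero ?S = 0" "add ?S = (+)"
    by (simp_all add: mpoly_ring_def)
  show ?thesis
  proof (rule cringI)
    show "abelian_group ?S"
    proof (rule abelian_groupI, unfold ops)
      fix p assume "p \<in> carrier ?S"
      then show "\<exists>q\<in>carrier ?S. q + p = 0"
        using uminus[of p] by (intro bexI[of _ "- p"]) simp_all
    qed (simp_all add: add closed ac_simps)
    show "comm_monoid ?S"
      by (rule comm_monoidI, unfold ops) (simp_all add: mult closed ac_simps)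
  qed (simp add: ops distrib_right)
qed

end

theory Submission
  imports Defs "HOL-Computational_Algebra.Polynomial"
begin

text \<open>
  Since \<open>S/I\<close> has dimension two, every product of three distinct variables is nilpotent modulo \<open>I\<close>,
  and elimination with \<open>f\<^sub>1\<close> and \<open>f\<^sub>2\<close> (their \<open>2 \<times> 2\<close> minors are the differences \<open>j - i\<close>) makes
  first all products of two variables and then all variables nilpotent modulo \<open>(I, f\<^sub>1, f\<^sub>2)\<close>.

  If \<open>S/I\<close> is Cohen--Macaulay, there is a regular sequence \<open>y, z\<close> in \<open>m\<close>. After inverting \<open>x\<^sub>i\<close>
  the monomial ideal does not involve \<open>x\<^sub>i\<close>, and \<open>f\<^sub>1\<close> is monic in it up to a unit; so \<open>f\<^sub>1 s \<in> I\<close>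
  forces a power of \<open>m\<close>, hence of \<open>y\<close>, to multiply \<open>s\<close> into \<open>I\<close>, and \<open>s \<in> I\<close>. Inverting two variables
  gives the same statement for \<open>f\<^sub>2\<close> modulo \<open>(I, f\<^sub>1)\<close>.

  Conversely, let \<open>f\<^sub>1, f\<^sub>2\<close> be regular and \<open>Q \<supseteq> I\<close> maximal. At most two variables are outside \<open>Q\<close>,
  so \<open>K[f\<^sub>1, f\<^sub>2]\<close> maps onto \<open>S/Q\<close>, and \<open>Q\<close> contains nonzero \<open>p(f\<^sub>1)\<close> and \<open>q(f\<^sub>2)\<close>. Comparing
  leading forms shows that these form a regular sequence modulo \<open>I\<close>, so the depth at \<open>Q\<close> is at least
  two, whereas it is at most the height, which is at most the dimension.
\<close>

section \<open>Prime ideals, regular sequences and quotients\<close>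

text \<open>Cohen-Macaulayness quantifies over all maximal ideals, whereas the two forms lie in m
  and in general not in the others. In the direction from Cohen-Macaulay to regular, m alone is
  used: its height is two because the dimension is attained by a chain of ideals generated by
  variables that ends in m. In the converse direction a maximal ideal \<open>Q\<close> need not be
  homogeneous or contain a form, and K need not be algebraically closed, so \<open>Q\<close> has no
  coordinates in K. The polynomials \<open>p(f1)\<close> and \<open>q(f2)\<close> stand in for the
  translates \<open>f1 - a\<close> and \<open>f2 - b\<close> that an algebraically closed field
  would offer. Membership in a monomial ideal is a condition on the support; therefore every
  cancellation argument watches monomials outside the ideal that are extremal, either in the
  exponent of the inverted variable or in total degree. Characteristic zero makes the coefficients
  \<open>i\<close> and \<open>j - i\<close> invertible. Localizations never appear: depth is bounded
  by height through primes constructed directly in the ring.\<close>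

lemma (in cring) idl_insert_iff:
  assumes "ideal J R" "a \<in> carrier R"
  shows "x \<in> Idl (J \<union> {a}) \<longleftrightarrow> (\<exists>j\<in>J. \<exists>r\<in>carrier R. x = j \<oplus> a \<otimes> r)"
proof -
  have J: "J \<subseteq> carrier R" using assms(1) by (meson ideal.Icarr subsetI)
  have sub: "ideal (PIdl a) R" using assms(2) cgenideal_ideal by simp
  have "Idl (J \<union> {a}) = Idl (J \<union> PIdl a)"
  proof (intro equalityI genideal_minimal)
    have c: "J \<union> PIdl a \<subseteq> carrier R" "J \<union> {a} \<subseteq> carrier R"
      using sub J assms by (auto dest: ideal.Icarr)
    show i: "ideal (Idl (J \<union> PIdl a)) R" "ideal (Idl (J \<union> {a})) R"
      using c by (auto intro!: genideal_ideal)
    show "J \<union> {a} \<subseteq> Idl (J \<union> PIdl a)"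
      using genideal_self[OF c(1)] cgenideal_self[OF assms(2)] by auto
    show "J \<union> PIdl a \<subseteq> Idl (J \<union> {a})"
      using genideal_self[OF c(2)] cgenideal_minimal[OF i(2), of a] by auto
  qed
  also have "\<dots> = J <+> PIdl a" by (rule union_genideal[OF assms(1) sub])
  finally show ?thesis
    using assms by (auto simp: set_add_defs cgenideal_def m_comm)
qed

lemma (in ring) idl_idl_Un:
  assumes "A \<subseteq> carrier R" "B \<subseteq> carrier R"
  shows "Idl (Idl A \<union> B) = Idl (A \<union> B)"
proof -
  have A: "ideal (Idl A) R" "A \<subseteq> Idl A" using assms genideal_ideal genideal_self by auto
  have AB: "ideal (Idl (A \<union> B)) R" "A \<union> B \<subseteq> Idl (A \<union> B)"
    using assms genideal_ideal[of "A \<union> B"] genideal_self[of "A \<union> B"] by auto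
  have c: "Idl A \<union> B \<subseteq> carrier R" using A(1) assms by (meson ideal.Icarr subsetI Un_least)
  have AB': "ideal (Idl (Idl A \<union> B)) R" "Idl A \<union> B \<subseteq> Idl (Idl A \<union> B)"
    using c by (rule genideal_ideal, rule genideal_self)
  show ?thesis
  proof
    show "Idl (Idl A \<union> B) \<subseteq> Idl (A \<union> B)"
      using AB genideal_minimal[OF AB(1), of A] by (intro genideal_minimal) auto
    show "Idl (A \<union> B) \<subseteq> Idl (Idl A \<union> B)"
      using AB' A(2) by (intro genideal_minimal) auto
  qed
qed

lemma (in ring) idl_ideal:
  assumes "ideal J R"
  shows "Idl J = J"
proof
  show "Idl J \<subseteq> J" by (rule genideal_minimal[OF assms order_refl])
  show "J \<subseteq> Idl J" by (rule genideal_self) (use assms in \<open>auto dest: ideal.Icarr\<close>)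
qed

text \<open>Krull's argument: among the ideals over \<open>J\<close> that miss the multiplicative
  set \<open>T\<close>, a maximal one exists by Zorn and is prime, because enlarging it by either
  factor of a product makes it meet \<open>T\<close>.\<close>

lemma (in cring) exists_prime_avoiding:
  assumes J: "ideal J R" and T: "T \<subseteq> carrier R" "\<one> \<in> T" "\<And>s t. s \<in> T \<Longrightarrow> t \<in> T \<Longrightarrow> s \<otimes> t \<in> T"
    and disj: "J \<inter> T = {}"
  obtains P where "primeideal P R" "J \<subseteq> P" "P \<inter> T = {}"
proof -
  let ?A = "{K. ideal K R \<and> J \<subseteq> K \<and> K \<inter> T = {}}"
  have "\<exists>M\<in>?A. \<forall>X\<in>?A. M \<subseteq> X \<longrightarrow> X = M"
  proof (rule subset_Zorn_nonempty)
    show "?A \<noteq> {}" using J disj by auto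
    fix C assume C: "C \<noteq> {}" "subset.chain ?A C"
    then have "subset.chain {I. ideal I R} C" by (auto simp: pred_on.chain_def)
    then have "ideal (\<Union>C) R" using chain_Union_is_ideal[of C] C(1) by auto
    then show "\<Union>C \<in> ?A" using C by (auto simp: pred_on.chain_def)
  qed
  then obtain P where "P \<in> ?A" and "\<forall>X\<in>?A. P \<subseteq> X \<longrightarrow> X = P" by (rule bexE)
  then have P: "ideal P R" "J \<subseteq> P" "P \<inter> T = {}"
    and max: "\<And>X. ideal X R \<Longrightarrow> J \<subseteq> X \<Longrightarrow> X \<inter> T = {} \<Longrightarrow> P \<subseteq> X \<Longrightarrow> X = P"
    by simp_all
  interpret P: ideal P R by fact
  have Pc: "P \<subseteq> carrier R" by (rule P.a_subset)
  have meets: "\<exists>t\<in>T. \<exists>p\<in>P. \<exists>r\<in>carrier R. t = p \<oplus> a \<otimes> r" if a: "a \<in> carrier R" "a \<notin> P" for a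
  proof -
    have i: "ideal (Idl (P \<union> {a})) R" "P \<union> {a} \<subseteq> Idl (P \<union> {a})"
      using a(1) Pc genideal_ideal[of "P \<union> {a}"] genideal_self[of "P \<union> {a}"] by auto
    then have "Idl (P \<union> {a}) \<inter> T \<noteq> {}"
      using max[OF i(1)] P(2) a by blast
    then show ?thesis using idl_insert_iff[OF P(1) a(1)] by blast
  qed
  have "primeideal P R"
  proof (rule primeidealI[OF P(1) is_cring])
    show "carrier R \<noteq> P" using P(3) T by auto
    fix a b assume ab: "a \<in> carrier R" "b \<in> carrier R" "a \<otimes> b \<in> P"
    show "a \<in> P \<or> b \<in> P"
    proof (rule ccontr)
      assume "\<not> ?thesis"
      then obtain t p r t' p' r' where *: "t \<in> T" "p \<in> P" "r \<in> carrier R" "t = p \<oplus> a \<otimes> r"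
        "t' \<in> T" "p' \<in> P" "r' \<in> carrier R" "t' = p' \<oplus> b \<otimes> r'"
        using meets[of a] meets[of b] ab by blast
      have c: "p \<in> carrier R" "p' \<in> carrier R" using * Pc by auto
      \<comment> \<open>Each summand has a factor \<open>p\<close>, \<open>p'\<close> or
        \<open>a \<otimes> b\<close>, so an element of \<open>T\<close> falls into
        \<open>P\<close>.\<close>
      have "t \<otimes> t' = p \<otimes> (p' \<oplus> b \<otimes> r') \<oplus> (p' \<otimes> (a \<otimes> r) \<oplus> (a \<otimes> b) \<otimes> (r \<otimes> r'))"
        using * c ab by (simp add: l_distr r_distr m_ac a_ac)
      also have "\<dots> \<in> P"
        using * c ab by (simp add: P.a_closed P.I_r_closed)
      finally show False using T(3)[of t t'] * P(3) by auto
    qed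
  qed
  then show ?thesis using that P by blast
qed

text \<open>The elements \<open>s x\<^sup>k\<close> with \<open>s\<close> outside \<open>Q\<close> form a multiplicative set that misses \<open>J\<close>.\<close>
lemma (in cring) smaller_prime_avoiding_regular:
  assumes J: "ideal J R" and Q: "primeideal Q R" "J \<subseteq> Q" and x: "x \<in> Q"
    and reg: "colon_ideal R J x = J"
  obtains P where "primeideal P R" "J \<subseteq> P" "P \<subset> Q"
proof -
  interpret Q: primeideal Q R by fact
  have xc: "x \<in> carrier R" using x Q.a_subset by auto
  define T where "T = {s \<otimes> x [^] (k::nat) | s k. s \<in> carrier R - Q}"
  have cancel: "s \<in> J" if "s \<in> carrier R" "s \<otimes> x [^] (k::nat) \<in> J" for s k
    using that
  proof (induction k)
    case (Suc k)
    have "s \<otimes> x [^] k \<in> colon_ideal R J x"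
      using Suc.prems xc by (simp add: colon_ideal_def m_assoc)
    then show ?case using reg Suc by simp
  qed (simp add: that)
  have one: "\<one> \<notin> Q" using Q.I_notcarr Q.one_imp_carrier by auto
  have 1: "T \<subseteq> carrier R" using xc by (auto simp: T_def)
  have 2: "\<one> \<in> T" unfolding T_def using one by (auto intro!: exI[of _ \<one>] exI[of _ "0::nat"])
  have 3: "s \<otimes> t \<in> T" if "s \<in> T" "t \<in> T" for s t
  proof -
    from that obtain a i b j where ab: "s = a \<otimes> x [^] (i::nat)" "t = b \<otimes> x [^] (j::nat)"
      "a \<in> carrier R - Q" "b \<in> carrier R - Q" unfolding T_def by blast
    have "s \<otimes> t = (a \<otimes> b) \<otimes> x [^] (i + j)"
      using ab xc by (simp add: nat_pow_mult[symmetric] m_ac)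
    moreover have "a \<otimes> b \<in> carrier R - Q" using ab Q.I_prime by auto
    ultimately show ?thesis unfolding T_def by blast
  qed
  have 4: "J \<inter> T = {}" using cancel Q(2) by (auto simp: T_def)
  obtain P where P: "primeideal P R" "J \<subseteq> P" "P \<inter> T = {}"
    using exists_prime_avoiding[OF J 1 2 3 4] by blast
  interpret P: primeideal P R by fact
  \<comment> \<open>Exponent \<open>0\<close> puts the whole complement of \<open>Q\<close> into
    \<open>T\<close>; below, \<open>s = \<one>\<close> with exponent \<open>1\<close> puts
    \<open>x\<close> there, which makes the inclusion strict.\<close>
  have "P \<subseteq> Q"
  proof
    fix s assume s: "s \<in> P"
    show "s \<in> Q"
    proof (rule ccontr)
      assume "s \<notin> Q"
      then have "s \<in> T" unfolding T_def using s P.a_subset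
        by (auto intro!: exI[of _ s] exI[of _ "0::nat"])
      then show False using s P(3) by auto
    qed
  qed
  moreover have "x \<in> T" unfolding T_def using one xc
    by (auto intro!: exI[of _ \<one>] exI[of _ "1::nat"])
  then have "x \<notin> P" using P(3) by auto
  ultimately show ?thesis using that P x by blast
qed

lemma (in cring) regular_sequence_Cons:
  assumes "ideal J R" "x \<in> carrier R" "set xs \<subseteq> carrier R"
  shows "regular_sequence R J (x # xs) \<longleftrightarrow>
    colon_ideal R J x = J \<and> regular_sequence R (Idl (J \<union> {x})) xs"
proof -
  have J: "J \<subseteq> carrier R" using assms(1) by (meson ideal.Icarr subsetI)
  have *: "Idl (J \<union> set (take (Suc i) (x # xs))) = Idl (Idl (J \<union> {x}) \<union> set (take i xs))" for i
  proof -
    have "set (take i xs) \<subseteq> carrier R" using assms(3) by (meson order_trans set_take_subset)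
    then show ?thesis
      using idl_idl_Un[of "J \<union> {x}" "set (take i xs)"] J assms by simp
  qed
  have J0: "Idl (J \<union> set (take 0 (x # xs))) = J" using assms(1) by (simp add: idl_ideal)
  show ?thesis
    unfolding regular_sequence_def length_Cons All_less_Suc2 * J0 nth_Cons_0 nth_Cons_Suc
    using assms(2,3) by auto
qed

text \<open>The chain for the tail, taken over \<open>(J, x)\<close>, starts at a prime containing
  \<open>x\<close>. As \<open>x\<close> is a nonzerodivisor modulo \<open>J\<close>, a smaller prime
  over \<open>J\<close> can be put below it. The claim about \<open>P 0\<close> is what carries the
  induction.\<close>

lemma (in cring) prime_chain_of_regular_sequence:
  assumes "ideal J R" "primeideal Q R" "J \<subseteq> Q" "set xs \<subseteq> Q" "regular_sequence R J xs"
  shows "\<exists>P. prime_chain R (length xs) P \<and> P (length xs) = Q \<and> J \<subseteq> P 0"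
  using assms
proof (induction xs arbitrary: J)
  case Nil
  then show ?case by (auto simp: prime_chain_def intro!: exI[of _ "\<lambda>_. Q"])
next
  case (Cons x xs)
  have Qc: "Q \<subseteq> carrier R" using Cons.prems(2) by (meson ideal.Icarr primeideal_def subsetI)
  have x: "x \<in> carrier R" "set xs \<subseteq> carrier R" using Cons.prems Qc by auto
  let ?J = "Idl (J \<union> {x})"
  have reg: "colon_ideal R J x = J" "regular_sequence R ?J xs"
    using Cons.prems x regular_sequence_Cons by auto
  have J: "ideal ?J R" "J \<union> {x} \<subseteq> ?J"
    using Cons.prems(3) Qc x(1) genideal_ideal[of "J \<union> {x}"] genideal_self[of "J \<union> {x}"] by auto
  have "?J \<subseteq> Q"
    using Cons.prems by (intro genideal_minimal) (auto simp: primeideal_def)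
  then obtain P where P: "prime_chain R (length xs) P" "P (length xs) = Q" "?J \<subseteq> P 0"
    using Cons.IH[OF J(1) Cons.prems(2) _ _ reg(2)] Cons.prems by auto
  have "primeideal (P 0) R" using P by (auto simp: prime_chain_def)
  then obtain P' where P': "primeideal P' R" "J \<subseteq> P'" "P' \<subset> P 0"
    using smaller_prime_avoiding_regular[OF Cons.prems(1) _ _ _ reg(1), of "P 0"] P J by auto
  have "prime_chain R (Suc (length xs)) (case_nat P' P)"
    using P P' unfolding prime_chain_def
    by (auto simp: All_less_Suc2 less_Suc_eq_le[symmetric] simp del: less_Suc_eq_le)
  then show ?case using P P' by (auto intro!: exI[of _ "case_nat P' P"])
qed

text \<open>No localization is involved, since the chain built from a regular sequence inside
  \<open>Q\<close> already ends at \<open>Q\<close>.\<close>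

lemma (in cring) ideal_depth_le_prime_height:
  assumes "primeideal Q R"
  shows "ideal_depth R Q \<le> prime_height R Q"
  unfolding ideal_depth_def
proof (rule Sup_least, clarify)
  fix xs assume xs: "set xs \<subseteq> Q" "regular_sequence R {\<zero>} xs"
  have "\<zero> \<in> Q" using assms by (simp add: additive_subgroup.zero_closed ideal_def primeideal_def)
  then show "enat (length xs) \<le> prime_height R Q"
    using prime_chain_of_regular_sequence[OF zeroideal assms _ xs] unfolding prime_height_def
    by (intro Sup_upper) auto
qed

lemma prime_height_le_krull_dim: "prime_height R Q \<le> krull_dim R"
  unfolding prime_height_def krull_dim_def by (rule Sup_subset_mono) auto

section \<open>Correspondence between ideals of the quotient and ideals over
  \<open>I\<close>\<close>

context ideal
begin

abbreviation proj where "proj \<equiv> (+>) I"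

lemma proj_hom: "ring_hom_ring R (R Quot I) proj"
  by (rule rcos_ring_hom_ring)

lemma proj_surj: "carrier (R Quot I) = proj ` carrier R"
  by (auto simp: FactRing_simps)

lemma proj_zero: "\<zero>\<^bsub>R Quot I\<^esub> = I"
  by (simp add: FactRing_def)

lemma proj_mem_iff:
  assumes "ideal J R" "I \<subseteq> J" "a \<in> carrier R"
  shows "proj a \<in> proj ` J \<longleftrightarrow> a \<in> J"
proof
  assume "proj a \<in> proj ` J"
  then obtain b where b: "b \<in> J" "proj a = proj b" by auto
  have bc: "b \<in> carrier R" using b assms by (meson ideal.Icarr)
  then have "a \<ominus> b \<in> I"
    using quotient_eq_iff_same_a_r_cos[OF is_ideal assms(3) bc] b by simp
  then have "(a \<ominus> b) \<oplus> b \<in> J" using assms b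
    by (meson additive_subgroup.a_closed ideal_def subsetD)
  then show "a \<in> J" using assms bc by (simp add: minus_eq a_assoc l_neg)
qed auto

definition lift_ideal where "lift_ideal K = {r \<in> carrier R. proj r \<in> K}"

lemma lift_ideal:
  assumes "ideal K (R Quot I)"
  shows "ideal (lift_ideal K) R" "I \<subseteq> lift_ideal K" "proj ` lift_ideal K = K"
proof -
  show "ideal (lift_ideal K) R"
    using ring_hom_ring.ideal_vimage[OF proj_hom assms] by (simp add: lift_ideal_def)
  have z: "I \<in> K" using assms proj_zero
    by (metis additive_subgroup.zero_closed ideal.axioms(1))
  have "proj i = I" if "i \<in> I" for i using that a_rcos_zero is_ideal by auto
  then show "I \<subseteq> lift_ideal K" using z a_subset by (auto simp: lift_ideal_def)
  have "K \<subseteq> carrier (R Quot I)" using assms by (meson ideal.Icarr subsetI)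
  then show "proj ` lift_ideal K = K" unfolding proj_surj lift_ideal_def by auto
qed

lemma lift_ideal_image:
  assumes "ideal J R" "I \<subseteq> J"
  shows "lift_ideal (proj ` J) = J"
proof -
  have "J \<subseteq> carrier R" using assms by (meson ideal.Icarr subsetI)
  then show ?thesis using proj_mem_iff[OF assms] unfolding lift_ideal_def by blast
qed

lemma image_ideal: "ideal J R \<Longrightarrow> ideal (proj ` J) (R Quot I)"
  by (rule ring_ideal_imp_quot_ideal[OF is_ideal])

lemma image_carrier_iff:
  assumes "ideal J R" "I \<subseteq> J"
  shows "proj ` J = carrier (R Quot I) \<longleftrightarrow> J = carrier R"
proof
  assume "proj ` J = carrier (R Quot I)"
  then have "\<one> \<in> J" using proj_mem_iff[OF assms, of \<one>] proj_surj by auto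
  then show "J = carrier R" using assms(1) by (metis ideal.one_imp_carrier)
qed (simp add: proj_surj)

end

lemma (in ideal) image_prime:
  assumes "cring R" "primeideal P R" "I \<subseteq> P"
  shows "primeideal (proj ` P) (R Quot I)"
proof -
  interpret P: primeideal P R by fact
  interpret h: ring_hom_ring R "R Quot I" proj by (rule proj_hom)
  show ?thesis
  proof (rule primeidealI)
    show "ideal (proj ` P) (R Quot I)" by (rule image_ideal[OF P.is_ideal])
    show "cring (R Quot I)" using assms quotient_is_cring by auto
    show "carrier (R Quot I) \<noteq> proj ` P"
      using image_carrier_iff[OF P.is_ideal assms(3)] P.I_notcarr by auto
    fix a b assume ab: "a \<in> carrier (R Quot I)" "b \<in> carrier (R Quot I)" "a \<otimes>\<^bsub>R Quot I\<^esub> b \<in> proj ` P"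
    then obtain r s where rs: "r \<in> carrier R" "s \<in> carrier R" "a = proj r" "b = proj s"
      unfolding proj_surj by auto
    then have "r \<otimes> s \<in> P" using proj_mem_iff[OF P.is_ideal assms(3), of "r \<otimes> s"] ab by simp
    then show "a \<in> proj ` P \<or> b \<in> proj ` P" using P.I_prime rs by blast
  qed
qed

lemma (in ideal) lift_prime:
  assumes "cring R" "primeideal P (R Quot I)"
  shows "primeideal (lift_ideal P) R"
proof -
  interpret P: primeideal P "R Quot I" by fact
  interpret h: ring_hom_ring R "R Quot I" proj by (rule proj_hom)
  note L = lift_ideal[OF P.is_ideal]
  show ?thesis
  proof (rule primeidealI[OF L(1) assms(1)])
    show "carrier R \<noteq> lift_ideal P" using image_carrier_iff[OF L(1,2)] L(3) P.I_notcarr by auto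
    fix a b assume ab: "a \<in> carrier R" "b \<in> carrier R" "a \<otimes> b \<in> lift_ideal P"
    then show "a \<in> lift_ideal P \<or> b \<in> lift_ideal P"
      using P.I_prime[of "proj a" "proj b"] by (simp add: lift_ideal_def)
  qed
qed

lemma (in ideal) image_maximal:
  assumes "maximalideal Q R" "I \<subseteq> Q"
  shows "maximalideal (proj ` Q) (R Quot I)"
proof -
  interpret Q: maximalideal Q R by fact
  show ?thesis
  proof (rule maximalidealI)
    show "ideal (proj ` Q) (R Quot I)" by (rule image_ideal[OF Q.is_ideal])
    show "carrier (R Quot I) \<noteq> proj ` Q"
      using image_carrier_iff[OF Q.is_ideal assms(2)] Q.I_notcarr by auto
    fix K assume K: "ideal K (R Quot I)" "proj ` Q \<subseteq> K"
    note L = lift_ideal[OF K(1)]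
    have "Q \<subseteq> lift_ideal K" using K(2) Q.a_subset by (auto simp: lift_ideal_def)
    then have "lift_ideal K = Q \<or> lift_ideal K = carrier R"
      using Q.I_maximal[OF L(1)] L(1) by (meson ideal.Icarr subsetI)
    then show "K = proj ` Q \<or> K = carrier (R Quot I)" using L(3) proj_surj by auto
  qed
qed

lemma (in ideal) lift_maximal:
  assumes "maximalideal Q (R Quot I)"
  shows "maximalideal (lift_ideal Q) R"
proof -
  interpret Q: maximalideal Q "R Quot I" by fact
  note L = lift_ideal[OF Q.is_ideal]
  show ?thesis
  proof (rule maximalidealI[OF L(1)])
    show "carrier R \<noteq> lift_ideal Q" using image_carrier_iff[OF L(1,2)] L(3) Q.I_notcarr by auto
    fix J assume J: "ideal J R" "lift_ideal Q \<subseteq> J" "J \<subseteq> carrier R"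
    have "Q \<subseteq> proj ` J" "I \<subseteq> J" using L J(2) by (metis image_mono, blast)
    moreover have "proj ` J \<subseteq> carrier (R Quot I)" using J proj_surj by auto
    ultimately have "proj ` J = Q \<or> proj ` J = carrier (R Quot I)"
      using Q.I_maximal[OF image_ideal[OF J(1)]] by auto
    then show "J = lift_ideal Q \<or> J = carrier R"
      using lift_ideal_image[OF J(1) \<open>I \<subseteq> J\<close>] image_carrier_iff[OF J(1) \<open>I \<subseteq> J\<close>] by auto
  qed
qed

text \<open>\<open>proj\<close> maps each lifted ideal back onto the ideal it came from, so lifting
  is injective and strict inclusions stay strict.\<close>

lemma (in ideal) lift_prime_chain:
  assumes "cring R" "prime_chain (R Quot I) k P"
  shows "prime_chain R k (\<lambda>i. lift_ideal (P i))" "\<And>i. i \<le> k \<Longrightarrow> I \<subseteq> lift_ideal (P i)"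
proof -
  have id: "ideal (P i) (R Quot I)" if "i \<le> k" for i
    using assms(2) that by (auto simp: prime_chain_def primeideal_def)
  then show "I \<subseteq> lift_ideal (P i)" if "i \<le> k" for i using lift_ideal that by simp
  have "lift_ideal (P i) \<subset> lift_ideal (P (Suc i))" if "i < k" for i
  proof -
    have sub: "P i \<subset> P (Suc i)" using assms(2) that by (simp add: prime_chain_def)
    have "proj ` lift_ideal (P i) = P i" "proj ` lift_ideal (P (Suc i)) = P (Suc i)"
      using lift_ideal(3) id that by simp_all
    then have "lift_ideal (P i) \<noteq> lift_ideal (P (Suc i))" using sub by (metis psubset_eq)
    then show ?thesis using sub unfolding lift_ideal_def by blast
  qed
  then show "prime_chain R k (\<lambda>i. lift_ideal (P i))"
    using assms lift_prime by (auto simp: prime_chain_def)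
qed

lemma (in ideal) image_prime_chain:
  assumes "cring R" "prime_chain R k P" "I \<subseteq> P 0"
  shows "prime_chain (R Quot I) k (\<lambda>i. proj ` P i)"
proof -
  have sub: "I \<subseteq> P i" if "i \<le> k" for i
    using that
  proof (induction i)
    case (Suc i)
    then have "P i \<subset> P (Suc i)" using assms by (auto simp: prime_chain_def)
    then show ?case using Suc by auto
  qed (rule assms)
  have id: "ideal (P i) R" if "i \<le> k" for i
    using assms(2) that by (auto simp: prime_chain_def primeideal_def)
  have "proj ` P i \<subset> proj ` P (Suc i)" if "i < k" for i
  proof -
    have s: "P i \<subset> P (Suc i)" using assms(2) that by (simp add: prime_chain_def)
    have "lift_ideal (proj ` P i) = P i" "lift_ideal (proj ` P (Suc i)) = P (Suc i)"
      using lift_ideal_image id sub that by simp_all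
    then have "proj ` P i \<noteq> proj ` P (Suc i)" using s by (metis psubset_eq)
    then show ?thesis using s by blast
  qed
  then show ?thesis using assms image_prime sub by (auto simp: prime_chain_def)
qed

lemma (in ideal) lift_genideal:
  assumes "X \<subseteq> carrier R"
  shows "lift_ideal (Idl\<^bsub>R Quot I\<^esub> ({\<zero>\<^bsub>R Quot I\<^esub>} \<union> proj ` X)) = Idl (I \<union> X)"
proof -
  interpret T: ring "R Quot I" by (rule quotient_is_ring)
  have c: "{\<zero>\<^bsub>R Quot I\<^esub>} \<union> proj ` X \<subseteq> carrier (R Quot I)" using assms proj_surj by auto
  note K = T.genideal_ideal[OF c] T.genideal_self[OF c]
  note L = lift_ideal[OF K(1)]
  have IX: "I \<union> X \<subseteq> carrier R" using assms a_subset by auto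
  note J = genideal_ideal[OF IX] genideal_self[OF IX]
  have JI: "I \<subseteq> Idl (I \<union> X)" using J by auto
  show ?thesis
  proof
    have "I \<in> proj ` (Idl (I \<union> X))"
      using proj_zero JI image_ideal[OF J(1)]
      by (metis additive_subgroup.zero_closed ideal.axioms(1))
    then have "Idl\<^bsub>R Quot I\<^esub> ({\<zero>\<^bsub>R Quot I\<^esub>} \<union> proj ` X) \<subseteq> proj ` (Idl (I \<union> X))"
      using J(2) proj_zero by (intro T.genideal_minimal image_ideal[OF J(1)]) auto
    then show "lift_ideal (Idl\<^bsub>R Quot I\<^esub> ({\<zero>\<^bsub>R Quot I\<^esub>} \<union> proj ` X)) \<subseteq> Idl (I \<union> X)"
      using lift_ideal_image[OF J(1) JI] unfolding lift_ideal_def by blast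
    have "X \<subseteq> lift_ideal (Idl\<^bsub>R Quot I\<^esub> ({\<zero>\<^bsub>R Quot I\<^esub>} \<union> proj ` X))"
      using K(2) assms by (auto simp: lift_ideal_def)
    then show "Idl (I \<union> X) \<subseteq> lift_ideal (Idl\<^bsub>R Quot I\<^esub> ({\<zero>\<^bsub>R Quot I\<^esub>} \<union> proj ` X))"
      using L by (intro genideal_minimal) auto
  qed
qed

text \<open>The bridge between depth, which lives in the quotient ring, and all computations, which
  are made with representatives in \<open>R\<close>.\<close>

lemma (in ideal) regular_sequence_quotient:
  assumes "set xs \<subseteq> carrier R"
  shows "regular_sequence (R Quot I) {\<zero>\<^bsub>R Quot I\<^esub>} (map proj xs) \<longleftrightarrow> regular_sequence R I xs"
proof -
  interpret T: ring "R Quot I" by (rule quotient_is_ring)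
  interpret h: ring_hom_ring R "R Quot I" proj by (rule proj_hom)
  have "colon_ideal (R Quot I) (Idl\<^bsub>R Quot I\<^esub> ({\<zero>\<^bsub>R Quot I\<^esub>} \<union> set (take i (map proj xs)))) (map proj xs ! i)
       = Idl\<^bsub>R Quot I\<^esub> ({\<zero>\<^bsub>R Quot I\<^esub>} \<union> set (take i (map proj xs)))
     \<longleftrightarrow> colon_ideal R (Idl (I \<union> set (take i xs))) (xs ! i) = Idl (I \<union> set (take i xs))"
    if i: "i < length xs" for i
  proof -
    define X where "X = set (take i xs)"
    have X: "X \<subseteq> carrier R" using assms set_take_subset[of i xs] by (auto simp: X_def)
    define K where "K = Idl\<^bsub>R Quot I\<^esub> ({\<zero>\<^bsub>R Quot I\<^esub>} \<union> proj ` X)"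
    have c: "{\<zero>\<^bsub>R Quot I\<^esub>} \<union> proj ` X \<subseteq> carrier (R Quot I)" using X proj_surj by auto
    have K: "ideal K (R Quot I)" unfolding K_def using c by (rule T.genideal_ideal)
    have LK: "lift_ideal K = Idl (I \<union> X)" unfolding K_def by (rule lift_genideal[OF X])
    have Kc: "K \<subseteq> carrier (R Quot I)" using K by (meson ideal.Icarr subsetI)
    have f: "xs ! i \<in> carrier R" using assms i by auto
    have "colon_ideal (R Quot I) K (proj (xs ! i)) = K \<longleftrightarrow>
      (\<forall>r\<in>carrier R. proj r \<otimes>\<^bsub>R Quot I\<^esub> proj (xs ! i) \<in> K \<longleftrightarrow> proj r \<in> K)"
      using Kc unfolding colon_ideal_def proj_surj by blast
    also have "\<dots> \<longleftrightarrow> (\<forall>r\<in>carrier R. r \<otimes> xs ! i \<in> lift_ideal K \<longleftrightarrow> r \<in> lift_ideal K)"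
      using f by (simp add: lift_ideal_def)
    also have "\<dots> \<longleftrightarrow> colon_ideal R (lift_ideal K) (xs ! i) = lift_ideal K"
      unfolding colon_ideal_def lift_ideal_def by blast
    finally show ?thesis using i LK unfolding K_def by (simp add: X_def take_map)
  qed
  moreover have "set (map proj xs) \<subseteq> carrier (R Quot I)" using assms proj_surj by auto
  ultimately show ?thesis using assms unfolding regular_sequence_def by simp
qed

lemma (in ideal) noetherian_quotient:
  assumes "noetherian_ring R"
  shows "noetherian_ring (R Quot I)"
proof -
  interpret N: noetherian_ring R by fact
  interpret T: ring "R Quot I" by (rule quotient_is_ring)
  show ?thesis
  proof (rule T.noetherian_ringI)
    fix K assume K: "ideal K (R Quot I)"
    note L = lift_ideal[OF K]
    obtain A where A: "A \<subseteq> carrier R" "finite A" "lift_ideal K = Idl A"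
      using N.finetely_gen[OF L(1)] by blast
    have c: "proj ` A \<subseteq> carrier (R Quot I)" using A proj_surj by auto
    note G = T.genideal_ideal[OF c] T.genideal_self[OF c]
    have "proj ` A \<subseteq> K" using genideal_self[OF A(1)] A(3) L(3) by auto
    then have 1: "Idl\<^bsub>R Quot I\<^esub> (proj ` A) \<subseteq> K" using T.genideal_minimal[OF K] by auto
    have "Idl A \<subseteq> lift_ideal (Idl\<^bsub>R Quot I\<^esub> (proj ` A))"
      using G(2) A(1) by (intro genideal_minimal lift_ideal(1)[OF G(1)]) (auto simp: lift_ideal_def)
    then have "K \<subseteq> Idl\<^bsub>R Quot I\<^esub> (proj ` A)"
      using A(3) L(3) lift_ideal(3)[OF G(1)] by (metis image_mono)
    then show "\<exists>A\<subseteq>carrier (R Quot I). finite A \<and> K = Idl\<^bsub>R Quot I\<^esub> A"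
      using 1 c A(2) by (intro exI[of _ "proj ` A"]) auto
  qed
qed

section \<open>The polynomial ring\<close>

abbreviation keys where "keys \<equiv> Poly_Mapping.keys"
abbreviation lookup where "lookup \<equiv> Poly_Mapping.lookup"
abbreviation single where "single \<equiv> Poly_Mapping.single"

lemma keys_add_nat: "keys (s + t) = keys s \<union> keys (t :: 'a \<Rightarrow>\<^sub>0 nat)"
  by (auto simp: in_keys_iff lookup_add)

lemma mpoly_ring_simps [simp]:
  "mult (mpoly_ring n) = (*)" "one (mpoly_ring n) = 1" "zero (mpoly_ring n) = 0"
  "add (mpoly_ring n) = (+)"
  by (simp_all add: mpoly_ring_def)

lemma mem_carrier_mpoly: "p \<in> carrier (mpoly_ring n) \<longleftrightarrow> (\<forall>t\<in>keys p. keys t \<subseteq> {1..n})"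
  by (simp add: mpoly_ring_def)

lemma nat_pow_mpoly [simp]: "p [^]\<^bsub>mpoly_ring n\<^esub> (k::nat) = p ^ k"
  by (induction k) (simp_all add: nat_pow_def mult.commute)

definition Const :: "'k::comm_ring_1 \<Rightarrow> 'k mpoly" where "Const c = single 0 c"

lemma Const_0 [simp]: "Const 0 = 0" and Const_1 [simp]: "Const 1 = 1"
  and Const_add: "Const (a + b) = Const a + Const b"
  and Const_diff: "Const (a - b) = Const a - Const b"
  and Const_mult: "Const (a * b) = Const a * Const b"
  and Const_of_nat: "Const (of_nat m) = of_nat m"
  by (simp_all add: Const_def single_add single_diff mult_single)

lemma mpoly_carrier_closed:
  fixes p q :: "'k::comm_ring_1 mpoly"
  shows mpoly_carrier_zero: "(0 :: 'k mpoly) \<in> carrier (mpoly_ring n)"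
    and mpoly_carrier_one: "(1 :: 'k mpoly) \<in> carrier (mpoly_ring n)"
    and mpoly_carrier_add: "p \<in> carrier (mpoly_ring n) \<Longrightarrow> q \<in> carrier (mpoly_ring n) \<Longrightarrow> p + q \<in> carrier (mpoly_ring n)"
    and mpoly_carrier_mult: "p \<in> carrier (mpoly_ring n) \<Longrightarrow> q \<in> carrier (mpoly_ring n) \<Longrightarrow> p * q \<in> carrier (mpoly_ring n)"
    and mpoly_carrier_uminus: "p \<in> carrier (mpoly_ring n) \<Longrightarrow> - p \<in> carrier (mpoly_ring n)"
    and mpoly_carrier_diff: "p \<in> carrier (mpoly_ring n) \<Longrightarrow> q \<in> carrier (mpoly_ring n) \<Longrightarrow> p - q \<in> carrier (mpoly_ring n)"
    and mpoly_carrier_power: "p \<in> carrier (mpoly_ring n) \<Longrightarrow> p ^ k \<in> carrier (mpoly_ring n)"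
    and mpoly_carrier_Const: "Const (c :: 'k) \<in> carrier (mpoly_ring n)"
    and mpoly_carrier_Var: "i \<in> {1..n} \<Longrightarrow> (Var i :: 'k mpoly) \<in> carrier (mpoly_ring n)"
proof -
  interpret cring "mpoly_ring n :: 'k mpoly ring" by (rule cring_mpoly_ring)
  have add: "p + q \<in> carrier (mpoly_ring n)"
    if "p \<in> carrier (mpoly_ring n)" "q \<in> carrier (mpoly_ring n)" for p q :: "'k mpoly"
    using a_closed[of p q] that by simp
  have u: "- p \<in> carrier (mpoly_ring n)" if "p \<in> carrier (mpoly_ring n)" for p :: "'k mpoly"
    using that by (simp add: mem_carrier_mpoly)
  show "(0 :: 'k mpoly) \<in> carrier (mpoly_ring n)" "(1 :: 'k mpoly) \<in> carrier (mpoly_ring n)"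
    using zero_closed one_closed by auto
  show "Const c \<in> carrier (mpoly_ring n)" by (simp add: mem_carrier_mpoly Const_def)
  show "(Var i :: 'k mpoly) \<in> carrier (mpoly_ring n)" if "i \<in> {1..n}"
    using that by (auto simp: mem_carrier_mpoly Var_def)
  assume p: "p \<in> carrier (mpoly_ring n)"
  show "- p \<in> carrier (mpoly_ring n)" by (rule u[OF p])
  show "p ^ k \<in> carrier (mpoly_ring n)" using nat_pow_closed[OF p, of k] by simp
  assume q: "q \<in> carrier (mpoly_ring n)"
  show "p + q \<in> carrier (mpoly_ring n)" by (rule add[OF p q])
  show "p * q \<in> carrier (mpoly_ring n)" using m_closed[OF p q] by simp
  show "p - q \<in> carrier (mpoly_ring n)" using add[OF p u[OF q]] by simp
qed

lemma mpoly_carrier_sum: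
  "(\<And>i. i \<in> A \<Longrightarrow> f i \<in> carrier (mpoly_ring n)) \<Longrightarrow> sum f A \<in> carrier (mpoly_ring n)"
  by (induction A rule: infinite_finite_induct) (auto simp: mpoly_carrier_zero mpoly_carrier_add)

lemma ideal_mpolyI:
  fixes J :: "'k::comm_ring_1 mpoly set"
  assumes "J \<subseteq> carrier (mpoly_ring n)" "0 \<in> J" "\<And>a b. a \<in> J \<Longrightarrow> b \<in> J \<Longrightarrow> a + b \<in> J"
    and "\<And>a b. a \<in> carrier (mpoly_ring n) \<Longrightarrow> b \<in> J \<Longrightarrow> a * b \<in> J"
  shows "ideal J (mpoly_ring n)"
proof -
  interpret cring "mpoly_ring n :: 'k mpoly ring" by (rule cring_mpoly_ring)
  have minus: "- a \<in> J" if "a \<in> J" for a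
    using assms(4)[of "- 1" a] that by (simp add: mpoly_carrier_one mpoly_carrier_uminus)
  show ?thesis
  proof (rule idealI[OF ring_axioms])
    show "subgroup J (add_monoid (mpoly_ring n))"
    proof (rule add.subgroupI)
      fix a assume a: "a \<in> J"
      have "\<ominus>\<^bsub>mpoly_ring n\<^esub> a = - a"
        using a assms(1) mpoly_carrier_uminus[of a n] by (intro minus_equality) auto
      then show "\<ominus>\<^bsub>mpoly_ring n\<^esub> a \<in> J" using minus[OF a] by simp
    qed (use assms in auto)
  next
    fix a x assume "a \<in> J" "x \<in> carrier (mpoly_ring n :: 'k mpoly ring)"
    then show "x \<otimes>\<^bsub>mpoly_ring n\<^esub> a \<in> J" "a \<otimes>\<^bsub>mpoly_ring n\<^esub> x \<in> J"
      using assms(4)[of x a] by (simp_all add: mult.commute)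
  qed
qed

lemma ideal_mpolyD:
  fixes J :: "'k::comm_ring_1 mpoly set"
  assumes "ideal J (mpoly_ring n)"
  shows ideal_mpoly_carrier: "a \<in> J \<Longrightarrow> a \<in> carrier (mpoly_ring n)"
    and ideal_mpoly_zero: "0 \<in> J"
    and ideal_mpoly_add: "a \<in> J \<Longrightarrow> b \<in> J \<Longrightarrow> a + b \<in> J"
    and ideal_mpoly_mult: "b \<in> J \<Longrightarrow> c \<in> carrier (mpoly_ring n) \<Longrightarrow> c * b \<in> J"
    and ideal_mpoly_uminus: "a \<in> J \<Longrightarrow> - a \<in> J"
    and ideal_mpoly_diff: "a \<in> J \<Longrightarrow> b \<in> J \<Longrightarrow> a - b \<in> J"
proof -
  interpret ideal J "mpoly_ring n" by fact
  show "a \<in> carrier (mpoly_ring n)" if "a \<in> J" using that by simp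
  show "0 \<in> J" using additive_subgroup.zero_closed[OF additive_subgroup_axioms] by simp
  have add: "a + b \<in> J" if "a \<in> J" "b \<in> J" for a b
    using additive_subgroup.a_closed[OF additive_subgroup_axioms that] by simp
  have m: "c * b \<in> J" if "b \<in> J" "c \<in> carrier (mpoly_ring n)" for b c
    using I_l_closed[OF that] by simp
  have u: "- a \<in> J" if "a \<in> J" for a
    using m[of a "- 1"] that by (simp add: mpoly_carrier_one mpoly_carrier_uminus)
  show "c * b \<in> J" if "b \<in> J" "c \<in> carrier (mpoly_ring n)" using that by (rule m)
  assume a: "a \<in> J"
  show "- a \<in> J" using a by (rule u)
  assume b: "b \<in> J"
  show "a + b \<in> J" using a b by (rule add)
  show "a - b \<in> J" using add[OF a u[OF b]] by simp
qed

lemma ideal_mpoly_mem_add_iff: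
  fixes J :: "'k::comm_ring_1 mpoly set"
  assumes "ideal J (mpoly_ring n)" "a \<in> J"
  shows "a + b \<in> J \<longleftrightarrow> b \<in> J"
  using ideal_mpoly_add[OF assms(1,2), of b] ideal_mpoly_diff[OF assms(1) _ assms(2), of "a + b"] by auto

lemma ideal_mpoly_sum:
  assumes "ideal J (mpoly_ring n)" "\<And>i. i \<in> A \<Longrightarrow> f i \<in> J"
  shows "sum f A \<in> (J :: 'k::comm_ring_1 mpoly set)"
  using assms(2) by (induction A rule: infinite_finite_induct)
    (auto simp: ideal_mpoly_zero[OF assms(1)] ideal_mpoly_add[OF assms(1)])

lemma mem_idl_insert_mpoly:
  fixes J :: "'k::comm_ring_1 mpoly set"
  assumes "ideal J (mpoly_ring n)" "f \<in> carrier (mpoly_ring n)"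
  shows "x \<in> Idl\<^bsub>mpoly_ring n\<^esub> (J \<union> {f}) \<longleftrightarrow> (\<exists>r\<in>carrier (mpoly_ring n). x - f * r \<in> J)"
proof -
  have "x = j + f * r \<longleftrightarrow> x - f * r = j" for j r by (auto simp: algebra_simps)
  then show ?thesis
    using cring.idl_insert_iff[OF cring_mpoly_ring assms, of x] by auto
qed

lemma ideal_idl_insert_mpoly:
  fixes J :: "'k::comm_ring_1 mpoly set"
  assumes "ideal J (mpoly_ring n)" "A \<subseteq> carrier (mpoly_ring n)"
  shows "ideal (Idl\<^bsub>mpoly_ring n\<^esub> (J \<union> A)) (mpoly_ring n)" "J \<subseteq> Idl\<^bsub>mpoly_ring n\<^esub> (J \<union> A)"
    "A \<subseteq> Idl\<^bsub>mpoly_ring n\<^esub> (J \<union> A)"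
proof -
  interpret cring "mpoly_ring n :: 'k mpoly ring" by (rule cring_mpoly_ring)
  have c: "J \<union> A \<subseteq> carrier (mpoly_ring n)" using assms by (auto dest: ideal.Icarr)
  show "ideal (Idl\<^bsub>mpoly_ring n\<^esub> (J \<union> A)) (mpoly_ring n)" by (rule genideal_ideal[OF c])
  show "J \<subseteq> Idl\<^bsub>mpoly_ring n\<^esub> (J \<union> A)" "A \<subseteq> Idl\<^bsub>mpoly_ring n\<^esub> (J \<union> A)"
    using genideal_self[OF c] by auto
qed

lemma regular_sequence_pair_mpoly:
  fixes I :: "'k::comm_ring_1 mpoly set"
  assumes I: "ideal I (mpoly_ring n)" and f: "f \<in> carrier (mpoly_ring n)" and g: "g \<in> carrier (mpoly_ring n)"
  shows "regular_sequence (mpoly_ring n) I [f, g] \<longleftrightarrow>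
    (\<forall>s\<in>carrier (mpoly_ring n). f * s \<in> I \<longrightarrow> s \<in> I) \<and>
    (\<forall>s\<in>carrier (mpoly_ring n). g * s \<in> Idl\<^bsub>mpoly_ring n\<^esub> (I \<union> {f}) \<longrightarrow> s \<in> Idl\<^bsub>mpoly_ring n\<^esub> (I \<union> {f}))"
proof -
  interpret cring "mpoly_ring n :: 'k mpoly ring" by (rule cring_mpoly_ring)
  have *: "colon_ideal (mpoly_ring n) J h = J \<longleftrightarrow> (\<forall>s\<in>carrier (mpoly_ring n). h * s \<in> J \<longrightarrow> s \<in> J)"
    if J: "ideal J (mpoly_ring n)" and "h \<in> carrier (mpoly_ring n)" for J h
    using that ideal_mpoly_mult[OF J] ideal_mpoly_carrier[OF J]
    by (auto simp: colon_ideal_def mult.commute)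
  have r: "regular_sequence (mpoly_ring n) J []" for J :: "'k mpoly set"
    by (simp add: regular_sequence_def)
  have J: "ideal (Idl\<^bsub>mpoly_ring n\<^esub> (I \<union> {f})) (mpoly_ring n)"
    using I f by (intro ideal_idl_insert_mpoly) auto
  show ?thesis using I f g J by (simp add: regular_sequence_Cons r *)
qed

lemma radical_ideal_mpoly:
  fixes J :: "'k::comm_ring_1 mpoly set"
  assumes J: "ideal J (mpoly_ring n)"
  shows "ideal (radical_ideal (mpoly_ring n) J) (mpoly_ring n)" "J \<subseteq> radical_ideal (mpoly_ring n) J"
    "\<And>a k. a \<in> carrier (mpoly_ring n) \<Longrightarrow> a ^ k \<in> radical_ideal (mpoly_ring n) J \<Longrightarrow> a \<in> radical_ideal (mpoly_ring n) J"
proof -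
  note C = mpoly_carrier_closed
  \<comment> \<open>An induction on \<open>k\<close> replaces the binomial theorem: each step splits
    one factor \<open>a + b\<close> and records the choice in \<open>i\<close> or \<open>j\<close>.
    Once \<open>k = 0\<close>, the bound forces \<open>i \<ge> l\<close> or
    \<open>j \<ge> m\<close>.\<close>
  have step: "(a + b) ^ k * (a ^ i * b ^ j) \<in> J"
    if ab: "a \<in> carrier (mpoly_ring n)" "b \<in> carrier (mpoly_ring n)" "a ^ l \<in> J" "b ^ m \<in> J" "k + i + j \<ge> l + m"
    for a b k l m i j
    using ab(5)
  proof (induction k arbitrary: i j)
    case 0
    then consider "i \<ge> l" | "j \<ge> m" by linarith
    then show ?case
    proof cases
      case 1
      then have "a ^ i = a ^ (i - l) * a ^ l" by (simp flip: power_add)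
      then have "a ^ i * b ^ j = (b ^ j * a ^ (i - l)) * a ^ l" by (simp add: ac_simps)
      then show ?thesis using ideal_mpoly_mult[OF J ab(3), of "b ^ j * a ^ (i - l)"] ab by (simp add: C)
    next
      case 2
      then have "b ^ j = b ^ (j - m) * b ^ m" by (simp flip: power_add)
      then have "a ^ i * b ^ j = (a ^ i * b ^ (j - m)) * b ^ m" by (simp add: ac_simps)
      then show ?thesis using ideal_mpoly_mult[OF J ab(4), of "a ^ i * b ^ (j - m)"] ab by (simp add: C)
    qed
  next
    case (Suc k)
    have "(a + b) ^ Suc k * (a ^ i * b ^ j) =
        (a + b) ^ k * (a ^ Suc i * b ^ j) + (a + b) ^ k * (a ^ i * b ^ Suc j)"
      by (simp add: algebra_simps)
    then show ?case using Suc.IH[of "Suc i" j] Suc.IH[of i "Suc j"] Suc.prems ideal_mpoly_add[OF J] by simp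
  qed
  show "ideal (radical_ideal (mpoly_ring n) J) (mpoly_ring n)"
  proof (rule ideal_mpolyI)
    show "0 \<in> radical_ideal (mpoly_ring n) J"
      using ideal_mpoly_zero[OF J] by (auto simp: radical_ideal_def C intro!: exI[of _ 1])
    fix a b assume "b \<in> radical_ideal (mpoly_ring n) J"
    then obtain m where b: "b \<in> carrier (mpoly_ring n)" "b ^ m \<in> J" by (auto simp: radical_ideal_def)
    show "a + b \<in> radical_ideal (mpoly_ring n) J" if "a \<in> radical_ideal (mpoly_ring n) J"
    proof -
      from that obtain l where a: "a \<in> carrier (mpoly_ring n)" "a ^ l \<in> J" by (auto simp: radical_ideal_def)
      show ?thesis using step[OF a(1) b(1) a(2) b(2), of "l + m" 0 0] a b
        by (auto simp: radical_ideal_def C)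
    qed
    show "a * b \<in> radical_ideal (mpoly_ring n) J" if "a \<in> carrier (mpoly_ring n)"
      using ideal_mpoly_mult[OF J b(2), of "a ^ m"] that b
      by (auto simp: radical_ideal_def C power_mult_distrib intro!: exI[of _ m])
  qed (auto simp: radical_ideal_def)
  show "J \<subseteq> radical_ideal (mpoly_ring n) J"
    using ideal_mpoly_carrier[OF J] by (auto simp: radical_ideal_def intro!: exI[of _ 1])
  show "a \<in> radical_ideal (mpoly_ring n) J"
    if "a \<in> carrier (mpoly_ring n)" "a ^ k \<in> radical_ideal (mpoly_ring n) J" for a k
    using that by (auto simp: radical_ideal_def simp flip: power_mult)
qed

lemma colon_ideal_mpoly:
  fixes J :: "'k::comm_ring_1 mpoly set"
  assumes J: "ideal J (mpoly_ring n)" and s: "s \<in> carrier (mpoly_ring n)"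
  shows "ideal (colon_ideal (mpoly_ring n) J s) (mpoly_ring n)"
  using ideal_mpoly_mult[OF J] ideal_mpoly_add[OF J] ideal_mpoly_zero[OF J]
  by (intro ideal_mpolyI) (auto simp: colon_ideal_def mpoly_carrier_closed distrib_right mult.assoc)

section \<open>Coefficients\<close>

definition restr :: "'a set \<Rightarrow> ('a \<Rightarrow>\<^sub>0 'b::zero) \<Rightarrow> 'a \<Rightarrow>\<^sub>0 'b" where
  "restr A p = Poly_Mapping.mapp (\<lambda>t c. if t \<in> A then c else 0) p"

lemma lookup_restr: "lookup (restr A p) t = (if t \<in> A then lookup p t else 0)"
  by (auto simp: restr_def lookup_mapp when_def in_keys_iff)

lemma keys_restr: "keys (restr A p) = keys p \<inter> A"
  by (auto simp: in_keys_iff lookup_restr split: if_splits)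

lemma restr_add: "restr A (p + q) = restr A p + restr A (q :: 'a \<Rightarrow>\<^sub>0 'b::comm_monoid_add)"
  by (rule poly_mapping_eqI) (simp add: lookup_restr lookup_add)

lemma restr_diff: "restr A (p - q) = restr A p - restr A (q :: 'a \<Rightarrow>\<^sub>0 'b::ab_group_add)"
  by (rule poly_mapping_eqI) (simp add: lookup_restr lookup_minus)

lemma restr_self: "keys p \<subseteq> A \<Longrightarrow> restr A p = p"
  by (rule poly_mapping_eqI) (auto simp: lookup_restr in_keys_iff)

lemma restr_zero: "keys p \<inter> A = {} \<Longrightarrow> restr A p = 0"
  by (rule poly_mapping_eqI) (auto simp: lookup_restr in_keys_iff)

lemma restr_split: "p = restr A p + restr (- A) (p :: 'a \<Rightarrow>\<^sub>0 'b::comm_monoid_add)"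
  by (rule poly_mapping_eqI) (simp add: lookup_restr lookup_add)

lemma restr_carrier: "p \<in> carrier (mpoly_ring n) \<Longrightarrow> restr A p \<in> carrier (mpoly_ring n)"
  by (auto simp: mem_carrier_mpoly keys_restr)

text \<open>The condition makes \<open>A\<close> closed under sums and its complement absorbing, so
  every product involving a part outside \<open>A\<close> stays outside \<open>A\<close>.\<close>

lemma restr_mult:
  fixes p q :: "'a::monoid_add \<Rightarrow>\<^sub>0 'b::semiring_0"
  assumes "\<And>s t. s + t \<in> A \<longleftrightarrow> s \<in> A \<and> t \<in> A"
  shows "restr A (p * q) = restr A p * restr A q"
proof -
  let ?p = "restr A p" and ?p' = "restr (- A) p" and ?q = "restr A q" and ?q' = "restr (- A) q"
  have "p * q = (?p + ?p') * (?q + ?q')" by (simp flip: restr_split)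
  also have "\<dots> = ?p * ?q + (?p * ?q' + ?p' * (?q + ?q'))"
    by (simp only: distrib_left distrib_right ac_simps)
  also have "?q + ?q' = q" by (rule restr_split[symmetric])
  finally have e: "p * q = ?p * ?q + (?p * ?q' + ?p' * q)" .
  have 1: "keys (?p * ?q) \<subseteq> A"
    using keys_mult[of ?p ?q] assms by (auto simp: keys_restr)
  have "keys (?p * ?q') \<inter> A = {}" "keys (?p' * q) \<inter> A = {}"
    using keys_mult[of ?p ?q'] keys_mult[of ?p' q] assms by (auto simp: keys_restr)
  then have 2: "keys (?p * ?q' + ?p' * q) \<inter> A = {}"
    using keys_add[of "?p * ?q'" "?p' * q"] by blast
  show ?thesis unfolding e restr_add[of A "?p * ?q"] restr_self[OF 1] restr_zero[OF 2] by simp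
qed

lemma poly_mapping_sum_single: "p = (\<Sum>t\<in>keys p. single t (lookup p t))"
  by (rule poly_mapping_eqI)
    (auto simp: lookup_sum lookup_single when_def in_keys_iff sum.delta)

lemma lookup_single_mult:
  fixes p :: "'a::cancel_comm_monoid_add \<Rightarrow>\<^sub>0 'b::semiring_0"
  shows "lookup (single s c * p) (s + t) = c * lookup p t"
    and "(\<And>t. u \<noteq> s + t) \<Longrightarrow> lookup (single s c * p) u = 0"
proof -
  have e: "single s c * p = (\<Sum>t\<in>keys p. single (s + t) (c * lookup p t))"
    by (subst (1) poly_mapping_sum_single[of p]) (simp add: sum_distrib_left mult_single)
  show "lookup (single s c * p) (s + t) = c * lookup p t"
    unfolding e by (auto simp: lookup_sum lookup_single when_def in_keys_iff sum.delta)
  assume "\<And>t. u \<noteq> s + t"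
  then have "s + t \<noteq> u" for t by metis
  then show "lookup (single s c * p) u = 0"
    unfolding e by (simp add: lookup_sum lookup_single)
qed

lemma lookup_Const_mult: "lookup (Const c * p) u = c * lookup p u"
  using lookup_single_mult(1)[of 0 c p u] by (simp add: Const_def)

lemma single_add_diff:
  assumes "lookup u i \<noteq> (0::nat)"
  shows "single i 1 + (u - single i 1) = u"
  using assms by (intro poly_mapping_eqI) (auto simp: lookup_add lookup_minus lookup_single when_def)

text \<open>The guard matters because exponents are subtracted with truncation: if \<open>u\<close>
  has exponent zero at \<open>i\<close>, then \<open>u - single i 1\<close> is \<open>u\<close>
  again.\<close>

lemma lookup_Var_mult:
  "lookup (Var i * p) u = (if lookup u i = 0 then 0 else lookup p (u - single i 1))"
proof (cases "lookup u i = 0")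
  case True
  then have "u \<noteq> single i 1 + t" for t by (auto simp: lookup_add)
  then show ?thesis using True by (simp add: Var_def lookup_single_mult(2))
next
  case False
  then show ?thesis
    using lookup_single_mult(1)[of "single i 1" 1 p "u - single i 1"] single_add_diff[OF False]
    by (simp add: Var_def)
qed

definition deg :: "(nat \<Rightarrow>\<^sub>0 nat) \<Rightarrow> nat" where "deg t = (\<Sum>i\<in>keys t. lookup t i)"

lemma deg_eq_sum: "finite A \<Longrightarrow> keys t \<subseteq> A \<Longrightarrow> deg t = (\<Sum>i\<in>A. lookup t i)"
  unfolding deg_def by (rule sum.mono_neutral_left) (auto simp: in_keys_iff)

lemma deg_add: "deg (s + t) = deg s + deg t"
  using deg_eq_sum[of "keys s \<union> keys t" s] deg_eq_sum[of "keys s \<union> keys t" t]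
    deg_eq_sum[of "keys s \<union> keys t" "s + t"]
  by (simp add: keys_add_nat lookup_add sum.distrib)

lemma deg_single: "deg (single i k) = k"
  by (simp add: deg_def)

lemma single_mpoly_induct:
  assumes "keys t \<subseteq> A" "P (Const c)"
    and "\<And>i s. i \<in> A \<Longrightarrow> keys s \<subseteq> A \<Longrightarrow> P (single s c) \<Longrightarrow> P (Var i * single s c)"
  shows "P (single t (c :: 'k::comm_ring_1))"
  using assms(1)
proof (induction "deg t" arbitrary: t rule: less_induct)
  case less
  show ?case
  proof (cases "t = 0")
    case True
    then show ?thesis using assms(2) by (simp add: Const_def)
  next
    case False
    then obtain i where i: "i \<in> keys t" by (metis keys_eq_empty all_not_in_conv)
    define s where "s = t - single i 1"
    have t: "t = single i 1 + s" using i single_add_diff[of t i] by (simp add: s_def in_keys_iff)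
    have s: "keys s \<subseteq> A" "i \<in> A" using less.prems i by (auto simp: t keys_add_nat)
    have "deg s < deg t" by (simp add: t deg_add deg_single)
    then have "P (single s c)" using less.hyps s by blast
    moreover have "single t c = Var i * single s c" by (simp add: t Var_def mult_single)
    ultimately show ?thesis using assms(3)[of i s] s by simp
  qed
qed

lemma mpoly_induct [consumes 1, case_names Const add Var]:
  assumes "p \<in> carrier (mpoly_ring n)"
    and "\<And>c. P (Const c)"
    and "\<And>p q. p \<in> carrier (mpoly_ring n) \<Longrightarrow> q \<in> carrier (mpoly_ring n) \<Longrightarrow> P p \<Longrightarrow> P q \<Longrightarrow> P (p + q)"
    and "\<And>i p. i \<in> {1..n} \<Longrightarrow> p \<in> carrier (mpoly_ring n) \<Longrightarrow> P p \<Longrightarrow> P (Var i * p)"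
  shows "P (p :: 'k::comm_ring_1 mpoly)"
proof -
  have c: "single s c \<in> carrier (mpoly_ring n)" if "keys s \<subseteq> {1..n}" for s and c :: 'k
    using that by (auto simp: mem_carrier_mpoly)
  have mono: "P (single t (lookup p t))" if t: "t \<in> keys p" for t
  proof (rule single_mpoly_induct[where A = "{1..n}" and P = P])
    show "keys t \<subseteq> {1..n}" using t assms(1) by (simp add: mem_carrier_mpoly)
    show "P (Const (lookup p t))" by (rule assms(2))
    fix i s assume "i \<in> {1..n}" "keys s \<subseteq> {1..n}" "P (single s (lookup p t))"
    then show "P (Var i * single s (lookup p t))" by (intro assms(4) c)
  qed
  have "P (\<Sum>t\<in>A. single t (lookup p t))" if "finite A" "A \<subseteq> keys p" for A
    using that
  proof (induction A)
    case empty
    then show ?case using assms(2)[of 0] by simp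
  next
    case (insert t A)
    have "single s (lookup p s) \<in> carrier (mpoly_ring n)" if "s \<in> insert t A" for s
      using that assms(1) insert.prems by (intro c) (auto simp: mem_carrier_mpoly)
    then have "P (single t (lookup p t) + (\<Sum>t\<in>A. single t (lookup p t)))"
      using insert by (intro assms(3) mono mpoly_carrier_sum) simp_all
    then show ?case using insert.hyps by simp
  qed
  from this[of "keys p"] show ?thesis using poly_mapping_sum_single[of p] by simp
qed

section \<open>Monomial ideals\<close>

definition monomial_set :: "nat \<Rightarrow> (nat \<Rightarrow>\<^sub>0 nat) set \<Rightarrow> bool" where
  "monomial_set n U \<longleftrightarrow> (\<forall>t\<in>U. keys t \<subseteq> {1..n}) \<and>
     (\<forall>t\<in>U. \<forall>s. keys s \<subseteq> {1..n} \<longrightarrow> t + s \<in> U)"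

text \<open>With a monomial ideal in this form, membership is a condition on the support, and every
  restriction of a member is again a member.\<close>

definition span_of :: "(nat \<Rightarrow>\<^sub>0 nat) set \<Rightarrow> 'k::comm_ring_1 mpoly set" where
  "span_of U = {p. keys p \<subseteq> U}"

lemma monomial_set_add: "monomial_set n U \<Longrightarrow> t \<in> U \<Longrightarrow> keys s \<subseteq> {1..n} \<Longrightarrow> t + s \<in> U"
  by (simp add: monomial_set_def)

lemma monomial_set_keys: "monomial_set n U \<Longrightarrow> t \<in> U \<Longrightarrow> keys t \<subseteq> {1..n}"
  by (simp add: monomial_set_def)

lemma ideal_span_of:
  assumes "monomial_set n U"
  shows "ideal (span_of U :: 'k::comm_ring_1 mpoly set) (mpoly_ring n)"
proof (rule ideal_mpolyI)
  show "(span_of U :: 'k mpoly set) \<subseteq> carrier (mpoly_ring n)"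
  proof
    fix p :: "'k mpoly" assume "p \<in> span_of U"
    then have "t \<in> U" if "t \<in> keys p" for t using that by (auto simp: span_of_def)
    then show "p \<in> carrier (mpoly_ring n)" using monomial_set_keys[OF assms] by (simp add: mem_carrier_mpoly)
  qed
  fix a b :: "'k mpoly" assume b: "b \<in> span_of U"
  show "a + b \<in> span_of U" if "a \<in> span_of U"
    using that b keys_add[of a b] by (auto simp: span_of_def)
  show "a * b \<in> span_of U" if "a \<in> carrier (mpoly_ring n)"
  proof -
    have "t \<in> U" if t: "t \<in> keys (a * b)" for t
    proof -
      obtain u v where "u \<in> keys a" "v \<in> keys b" "t = v + u"
        using subsetD[OF keys_mult t] by (auto simp: add.commute)
      then show ?thesis using b \<open>a \<in> _\<close> monomial_set_add[OF assms, of v u]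
        by (auto simp: span_of_def mem_carrier_mpoly)
    qed
    then show ?thesis by (auto simp: span_of_def)
  qed
qed (simp add: span_of_def)

lemma monomial_ideal_span_of:
  fixes I :: "'k::comm_ring_1 mpoly set"
  assumes "monomial_ideal n I"
  obtains U where "monomial_set n U" "I = span_of U"
proof -
  obtain M where M: "\<And>t. t \<in> M \<Longrightarrow> keys t \<subseteq> {1..n}"
    and I: "I = Idl\<^bsub>mpoly_ring n\<^esub> ((\<lambda>t. single t 1) ` M)"
    using assms unfolding monomial_ideal_def by blast
  interpret cring "mpoly_ring n :: 'k mpoly ring" by (rule cring_mpoly_ring)
  define U where "U = {m + s | m s. m \<in> M \<and> keys s \<subseteq> {1..n}}"
  have U: "monomial_set n U"
    using M unfolding monomial_set_def U_def by (fastforce simp: keys_add_nat add.assoc)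
  have c: "(\<lambda>t. single t (1::'k)) ` M \<subseteq> carrier (mpoly_ring n)"
    using M by (auto simp: mem_carrier_mpoly)
  have id: "ideal I (mpoly_ring n)" unfolding I by (rule genideal_ideal[OF c])
  have gen: "single m 1 \<in> I" if "m \<in> M" for m using genideal_self[OF c] that I by auto
  have "I = span_of U"
  proof
    have "m \<in> U" if "m \<in> M" for m
      unfolding U_def using that by (intro CollectI exI[of _ m] exI[of _ "0 :: nat \<Rightarrow>\<^sub>0 nat"]) simp
    then have "(\<lambda>t. single t (1::'k)) ` M \<subseteq> span_of U" by (auto simp: span_of_def)
    then show "I \<subseteq> span_of U" unfolding I by (intro genideal_minimal ideal_span_of U)
    show "span_of U \<subseteq> I"
    proof
      fix p :: "'k mpoly" assume p: "p \<in> span_of U"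
      have "single t (lookup p t) \<in> I" if t: "t \<in> keys p" for t
      proof -
        obtain m s where ms: "m \<in> M" "keys s \<subseteq> {1..n}" "t = m + s"
          using t p unfolding span_of_def U_def by blast
        have "single t (lookup p t) = single s (lookup p t) * single m 1"
          by (simp add: mult_single ms add.commute)
        also have "\<dots> \<in> I" using ms by (intro ideal_mpoly_mult[OF id gen]) (auto simp: mem_carrier_mpoly)
        finally show ?thesis .
      qed
      then show "p \<in> I"
        using ideal_mpoly_sum[OF id, of "keys p" "\<lambda>t. single t (lookup p t)"] poly_mapping_sum_single[of p]
        by simp
    qed
  qed
  then show ?thesis using that U by blast
qed

lemma span_of_restr: "restr U p \<in> span_of U"
  by (simp add: span_of_def keys_restr)

text \<open>The ideal generated by the variables with index outside \<open>F\<close>. The set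
  \<open>F\<close> lists the variables that survive in the quotient, so a larger \<open>F\<close>
  gives a smaller ideal.\<close>

definition var_prime :: "nat \<Rightarrow> nat set \<Rightarrow> 'k::comm_ring_1 mpoly set" where
  "var_prime n F = span_of {t. keys t \<subseteq> {1..n} \<and> \<not> keys t \<subseteq> F}"

lemma ideal_var_prime: "ideal (var_prime n F) (mpoly_ring n)"
  unfolding var_prime_def by (rule ideal_span_of) (auto simp: monomial_set_def keys_add_nat)

text \<open>The ideal is the kernel of the restriction to monomials in the variables of
  \<open>F\<close>. By \<open>restr_mult\<close> that restriction is multiplicative, and its values
  lie in a domain.\<close>

lemma primeideal_var_prime: "primeideal (var_prime n F :: 'k::idom mpoly set) (mpoly_ring n)"
proof (rule primeidealI[OF ideal_var_prime cring_mpoly_ring])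
  let ?A = "{t. keys t \<subseteq> F}"
  have mem: "p \<in> var_prime n F \<longleftrightarrow> restr ?A p = 0" if "p \<in> carrier (mpoly_ring n)" for p :: "'k mpoly"
  proof -
    have "restr ?A p = 0 \<longleftrightarrow> keys p \<inter> ?A = {}" by (simp flip: keys_eq_empty keys_restr)
    then show ?thesis using that by (auto simp: var_prime_def span_of_def mem_carrier_mpoly)
  qed
  have "(1 :: 'k mpoly) \<notin> var_prime n F" by (simp add: var_prime_def span_of_def)
  then show "carrier (mpoly_ring n) \<noteq> (var_prime n F :: 'k mpoly set)"
    using mpoly_carrier_one by blast
  fix a b :: "'k mpoly"
  assume ab: "a \<in> carrier (mpoly_ring n)" "b \<in> carrier (mpoly_ring n)" "a \<otimes>\<^bsub>mpoly_ring n\<^esub> b \<in> var_prime n F"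
  have "restr ?A (a * b) = restr ?A a * restr ?A b"
    by (rule restr_mult) (auto simp: keys_add_nat)
  then have "restr ?A a * restr ?A b = 0"
    using mem[of "a * b"] ab by (simp add: mpoly_carrier_mult)
  then show "a \<in> var_prime n F \<or> b \<in> var_prime n F" using mem ab by auto
qed

lemma Var_mem_var_prime: "i \<in> {1..n} \<Longrightarrow> (Var i :: 'k::comm_ring_1 mpoly) \<in> var_prime n F \<longleftrightarrow> i \<notin> F"
  by (auto simp: Var_def var_prime_def span_of_def)

lemma var_prime_psubset:
  assumes "F \<subset> F'" "F' \<subseteq> {1..n}"
  shows "(var_prime n F' :: 'k::comm_ring_1 mpoly set) \<subset> var_prime n F"
proof -
  obtain i where "i \<in> F'" "i \<notin> F" using assms by blast
  then have "(Var i :: 'k mpoly) \<in> var_prime n F" "(Var i :: 'k mpoly) \<notin> var_prime n F'"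
    using assms by (subst Var_mem_var_prime; blast)+
  moreover have "(var_prime n F' :: 'k mpoly set) \<subseteq> var_prime n F"
    using assms unfolding var_prime_def span_of_def by blast
  ultimately show ?thesis by blast
qed

lemma irrelevant_ideal_eq: "(irrelevant_ideal n :: 'k::comm_ring_1 mpoly set) = var_prime n {}"
proof
  interpret cring "mpoly_ring n :: 'k mpoly ring" by (rule cring_mpoly_ring)
  have c: "Var ` {1..n} \<subseteq> carrier (mpoly_ring n :: 'k mpoly ring)" using mpoly_carrier_Var by blast
  have id: "ideal (irrelevant_ideal n :: 'k mpoly set) (mpoly_ring n)"
    unfolding irrelevant_ideal_def by (rule genideal_ideal[OF c])
  have gen: "(Var i :: 'k mpoly) \<in> irrelevant_ideal n" if "i \<in> {1..n}" for i
    using genideal_self[OF c] that unfolding irrelevant_ideal_def by blast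
  show "(irrelevant_ideal n :: 'k mpoly set) \<subseteq> var_prime n {}"
    unfolding irrelevant_ideal_def
    by (intro genideal_minimal ideal_var_prime) (auto simp: Var_mem_var_prime)
  show "var_prime n {} \<subseteq> (irrelevant_ideal n :: 'k mpoly set)"
  proof
    fix p :: "'k mpoly" assume p: "p \<in> var_prime n {}"
    have "single t (lookup p t) \<in> irrelevant_ideal n" if t: "t \<in> keys p" for t
    proof -
      have "keys t \<subseteq> {1..n}" "t \<noteq> 0" using p t by (auto simp: var_prime_def span_of_def)
      moreover have "keys t \<subseteq> {1..n} \<Longrightarrow> single t (lookup p t) \<in> irrelevant_ideal n \<or> t = 0"
      proof -
        obtain i where i: "i \<in> keys t" using \<open>t \<noteq> 0\<close> by (metis keys_eq_empty all_not_in_conv)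
        have e: "single t (lookup p t) = single (t - single i 1) (lookup p t) * Var i"
          using single_add_diff[of t i] i by (simp add: Var_def mult_single add.commute in_keys_iff)
        have "keys (t - single i 1) \<subseteq> keys t" by (auto simp: in_keys_iff lookup_minus)
        then show "keys t \<subseteq> {1..n} \<Longrightarrow> ?thesis" unfolding e using i
          by (intro disjI1 ideal_mpoly_mult[OF id gen]) (auto simp: mem_carrier_mpoly)
      qed
      ultimately show ?thesis by blast
    qed
    then show "p \<in> irrelevant_ideal n"
      using ideal_mpoly_sum[OF id, of "keys p" "\<lambda>t. single t (lookup p t)"] poly_mapping_sum_single[of p]
      by simp
  qed
qed

lemma Var_power: "Var i ^ N = single (single i N) (1 :: 'k::comm_ring_1)"
  by (induction N) (simp_all add: Var_def mult_single flip: single_add)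

lemma prod_Var_power:
  "finite F \<Longrightarrow> (\<Prod>i\<in>F. Var i) ^ N = single (\<Sum>i\<in>F. single i N) (1 :: 'k::comm_ring_1)"
  by (induction F rule: finite_induct) (simp_all add: Var_power power_mult_distrib mult_single)

text \<open>Failure of the inclusion yields a monomial \<open>t\<close> in \<open>U\<close> that
  uses only variables from \<open>F\<close>. No exponent of \<open>t\<close> exceeds
  \<open>deg t\<close>, so \<open>t\<close> divides that power of the product.\<close>

lemma prod_Var_in_radical:
  assumes U: "monomial_set n U" and F: "F \<subseteq> {1..n}" and nsub: "\<not> span_of U \<subseteq> (var_prime n F :: 'k::comm_ring_1 mpoly set)"
  shows "(\<Prod>i\<in>F. Var i) \<in> radical_ideal (mpoly_ring n) (span_of U :: 'k mpoly set)"
proof -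
  have fin: "finite F" using F finite_subset by blast
  obtain t where t: "t \<in> U" "keys t \<subseteq> F"
    using nsub monomial_set_keys[OF U] by (auto simp: var_prime_def span_of_def)
  define s where "s = (\<Sum>i\<in>F. single i (deg t)) - t"
  have le: "lookup t i \<le> deg t" for i
  proof (cases "i \<in> keys t")
    case True
    then show ?thesis unfolding deg_def by (rule member_le_sum) auto
  qed (simp add: in_keys_iff)
  have l: "lookup (\<Sum>i\<in>F. single i (deg t)) j = (if j \<in> F then deg t else 0)" for j
    using fin by (simp add: lookup_sum lookup_single when_def sum.delta)
  have "lookup t j = 0" if "j \<notin> F" for j using that t by (auto simp: in_keys_iff)
  then have e: "(\<Sum>i\<in>F. single i (deg t)) = t + s"
    unfolding s_def by (intro poly_mapping_eqI) (auto simp: lookup_add lookup_minus l le)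
  have "keys s \<subseteq> F" unfolding s_def by (auto simp: in_keys_iff lookup_minus l split: if_splits)
  then have "t + s \<in> U" using monomial_set_add[OF U t(1)] F by blast
  then have "(\<Prod>i\<in>F. Var i) ^ deg t \<in> (span_of U :: 'k mpoly set)"
    unfolding prod_Var_power[OF fin] e by (simp add: span_of_def)
  moreover have "(\<Prod>i\<in>F. Var i) \<in> carrier (mpoly_ring n :: 'k mpoly ring)"
    using fin F
    by (induction F rule: finite_induct) (auto simp: mpoly_carrier_one intro!: mpoly_carrier_mult mpoly_carrier_Var)
  ultimately show ?thesis by (auto simp: radical_ideal_def)
qed

text \<open>A prime containing a monomial contains one of its variables. Hence every prime over a
  monomial ideal contains a prime generated by variables that still lies over the ideal.\<close>

lemma span_of_subset_var_prime:
  fixes P :: "'k::comm_ring_1 mpoly set"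
  assumes U: "monomial_set n U" and P: "primeideal P (mpoly_ring n)" and sub: "span_of U \<subseteq> P"
  shows "span_of U \<subseteq> (var_prime n {i \<in> {1..n}. Var i \<notin> P} :: 'k mpoly set)"
proof -
  interpret P: primeideal P "mpoly_ring n" by fact
  let ?F = "{i \<in> {1..n}. Var i \<notin> P}"
  have "single t (1::'k) \<notin> P" if "keys t \<subseteq> ?F" for t
    using that
  proof (rule single_mpoly_induct)
    show "Const 1 \<notin> P" using P.I_notcarr P.one_imp_carrier by auto
    fix i s assume *: "i \<in> ?F" "keys s \<subseteq> ?F" "single s 1 \<notin> P"
    then show "Var i * single s 1 \<notin> P"
      using P.I_prime[of "Var i" "single s 1"] mpoly_carrier_Var[of i n]
      by (force simp: mem_carrier_mpoly)
  qed
  moreover have "single t (1::'k) \<in> P" if "t \<in> U" for t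
    using sub that by (auto simp: span_of_def)
  ultimately have "\<not> keys t \<subseteq> ?F" if "t \<in> U" for t using that by blast
  then show ?thesis using monomial_set_keys[OF U] by (auto simp: var_prime_def span_of_def)
qed

section \<open>Linear forms\<close>

definition lin :: "nat \<Rightarrow> (nat \<Rightarrow> 'k) \<Rightarrow> 'k::comm_ring_1 mpoly" where
  "lin n c = (\<Sum>i=1..n. Const (c i) * Var i)"

lemma lin_carrier: "lin n c \<in> carrier (mpoly_ring n)"
  unfolding lin_def
  by (intro mpoly_carrier_sum mpoly_carrier_mult mpoly_carrier_Const mpoly_carrier_Var) auto

lemma lin_combine:
  "Const a * lin n c - Const b * lin n d = lin n (\<lambda>i. a * c i - b * d i)"
  by (simp add: lin_def sum_distrib_left sum_subtractf Const_diff Const_mult algebra_simps)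

lemma lin_cong: "(\<And>i. i \<in> {1..n} \<Longrightarrow> c i = d i) \<Longrightarrow> lin n c = lin n d"
  unfolding lin_def by (rule sum.cong) auto

lemma lookup_lin_mult:
  "lookup (lin n c * p) u = (\<Sum>i=1..n. if lookup u i = 0 then 0 else c i * lookup p (u - single i 1))"
  unfolding lin_def sum_distrib_right lookup_sum
  by (rule sum.cong) (auto simp: mult.assoc lookup_Const_mult lookup_Var_mult)

lemma homogeneous_lin: "homogeneous (lin n c)"
proof -
  have "deg t = 1" if "t \<in> keys (lin n c)" for t
  proof -
    have "lookup (lin n c * 1) t \<noteq> 0" using that by (simp add: in_keys_iff)
    then obtain i where "(if lookup t i = 0 then 0 else c i * lookup (1 :: 'a mpoly) (t - single i 1)) \<noteq> 0"
      unfolding lookup_lin_mult by (rule sum.not_neutral_contains_not_neutral)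
    then have i: "lookup t i \<noteq> 0" "lookup (1 :: 'a mpoly) (t - single i 1) \<noteq> 0"
      by (auto split: if_splits)
    then have "t - single i 1 = 0" by (auto simp: lookup_one when_def split: if_splits)
    then have "t = single i 1" using single_add_diff[OF i(1)] by simp
    then show ?thesis by (simp add: deg_single)
  qed
  then show ?thesis unfolding homogeneous_def deg_def by blast
qed

lemma Const_mult_mem_iff:
  fixes J :: "'k::field mpoly set"
  assumes "ideal J (mpoly_ring n)" "c \<noteq> 0"
  shows "Const c * p \<in> J \<longleftrightarrow> p \<in> J"
proof
  assume "Const c * p \<in> J"
  then have "Const (1 / c) * (Const c * p) \<in> J"
    by (rule ideal_mpoly_mult[OF assms(1)]) (rule mpoly_carrier_Const)
  then show "p \<in> J" using assms(2) by (simp flip: mult.assoc Const_mult)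
qed (rule ideal_mpoly_mult[OF assms(1) _ mpoly_carrier_Const])

text \<open>Each term other than the \<open>k\<close>th vanishes modulo \<open>J\<close>, through
  its coefficient or its product with \<open>a\<close>. This elimination step serves both radicals
  and maximal ideals.\<close>

lemma lin_mod:
  fixes J :: "'k::field mpoly set"
  assumes J: "ideal J (mpoly_ring n)" and k: "k \<in> {1..n}"
    and other: "\<And>j. j \<in> {1..n} \<Longrightarrow> j \<noteq> k \<Longrightarrow> c j = 0 \<or> a * Var j \<in> J"
  shows "a * lin n c - Const (c k) * (a * Var k) \<in> J"
proof -
  have "a * lin n c = Const (c k) * (a * Var k) + (\<Sum>j\<in>{1..n}-{k}. Const (c j) * (a * Var j))"
    unfolding lin_def using k by (subst sum.remove[of _ k]) (auto simp: distrib_left sum_distrib_left ac_simps)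
  moreover have "(\<Sum>j\<in>{1..n}-{k}. Const (c j) * (a * Var j)) \<in> J"
  proof (rule ideal_mpoly_sum[OF J])
    fix j assume j: "j \<in> {1..n} - {k}"
    show "Const (c j) * (a * Var j) \<in> J"
    proof (cases "c j = 0")
      case True
      then show ?thesis using ideal_mpoly_zero[OF J] by simp
    next
      case False
      then show ?thesis using other[of j] j Const_mult_mem_iff[OF J] by blast
    qed
  qed
  ultimately show ?thesis by simp
qed

lemma lin_isolate:
  fixes J :: "'k::field mpoly set"
  assumes J: "ideal J (mpoly_ring n)" and k: "k \<in> {1..n}" "c k \<noteq> 0"
    and mem: "a * lin n c \<in> J"
    and other: "\<And>j. j \<in> {1..n} \<Longrightarrow> j \<noteq> k \<Longrightarrow> c j = 0 \<or> a * Var j \<in> J"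
  shows "a * Var k \<in> J"
  using ideal_mpoly_diff[OF J mem lin_mod[OF J k(1) other]] Const_mult_mem_iff[OF J k(2)] by simp

text \<open>The coefficients are \<open>i (j - 1) - (i - 1) j = j - i\<close>, so in characteristic
  zero exactly the variable of index \<open>i\<close> disappears. Truncation in \<open>j - 1\<close>
  is harmless because indices start at 1.\<close>

lemma lin_eliminate:
  assumes "i \<in> {1..n}"
  shows "Const (of_nat i) * lin n (\<lambda>j. of_nat (j - 1)) - Const (of_nat (i - 1)) * lin n of_nat
    = lin n (\<lambda>j. of_nat j - of_nat i :: 'k::comm_ring_1)"
  unfolding lin_combine using assms by (intro lin_cong) (auto simp: of_nat_diff algebra_simps)

text \<open>Multiplying the form by \<open>Var i\<close> leaves \<open>i\<close> times the square of
  \<open>Var i\<close> modulo the mixed products; \<open>i\<close> is invertible and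
  \<open>A\<close> is closed under roots.\<close>

lemma Var_mem_of_pairs:
  fixes A :: "'k::field_char_0 mpoly set"
  assumes A: "ideal A (mpoly_ring n)"
    and root: "\<And>a k. a \<in> carrier (mpoly_ring n) \<Longrightarrow> a ^ k \<in> A \<Longrightarrow> a \<in> A"
    and f: "lin n of_nat \<in> A"
    and pairs: "\<And>i j. i \<in> {1..n} \<Longrightarrow> j \<in> {1..n} \<Longrightarrow> i \<noteq> j \<Longrightarrow> Var i * Var j \<in> A"
    and i: "i \<in> {1..n}"
  shows "Var i \<in> A"
proof -
  have V: "(Var i :: 'k mpoly) \<in> carrier (mpoly_ring n)" using i by (rule mpoly_carrier_Var)
  have "Var i * Var i \<in> A"
    using i by (intro lin_isolate[OF A i, of of_nat] ideal_mpoly_mult[OF A f V]) (auto intro!: pairs)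
  then show ?thesis using root[OF V, of 2] by (simp add: power2_eq_square)
qed

text \<open>Multiply the form without \<open>Var i\<close> by \<open>Var i * Var j\<close>: modulo
  the triple products only \<open>j - i\<close> times \<open>Var i * Var j * Var j\<close> is left.
  One more factor \<open>Var i\<close> turns this into a square.\<close>

lemma pairs_mem_of_triples:
  fixes A :: "'k::field_char_0 mpoly set"
  assumes A: "ideal A (mpoly_ring n)"
    and root: "\<And>a k. a \<in> carrier (mpoly_ring n) \<Longrightarrow> a ^ k \<in> A \<Longrightarrow> a \<in> A"
    and f: "lin n of_nat \<in> A" "lin n (\<lambda>j. of_nat (j - 1)) \<in> A"
    and triples: "\<And>i j k. i \<in> {1..n} \<Longrightarrow> j \<in> {1..n} \<Longrightarrow> k \<in> {1..n} \<Longrightarrow> card {i, j, k} = 3 \<Longrightarrow>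
      Var i * Var j * Var k \<in> A"
    and ij: "i \<in> {1..n}" "j \<in> {1..n}" "i \<noteq> j"
  shows "Var i * Var j \<in> A"
proof -
  have V: "(Var i :: 'k mpoly) \<in> carrier (mpoly_ring n)" "(Var j :: 'k mpoly) \<in> carrier (mpoly_ring n)"
    using ij by (auto intro: mpoly_carrier_Var)
  have VV: "(Var i * Var j :: 'k mpoly) \<in> carrier (mpoly_ring n)" using V by (rule mpoly_carrier_mult)
  have g: "lin n (\<lambda>j. of_nat j - of_nat i :: 'k) \<in> A"
    unfolding lin_eliminate[OF ij(1), symmetric]
    by (intro ideal_mpoly_diff[OF A] ideal_mpoly_mult[OF A] f mpoly_carrier_Const)
  have "(Var i * Var j) * Var j \<in> A"
  proof (rule lin_isolate[OF A ij(2), of "\<lambda>j. of_nat j - of_nat i"])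
    show "of_nat j - of_nat i \<noteq> (0::'k)" using ij by simp
    show "Var i * Var j * lin n (\<lambda>j. of_nat j - of_nat i) \<in> A" by (rule ideal_mpoly_mult[OF A g VV])
    fix k assume k: "k \<in> {1..n}" "k \<noteq> j"
    show "of_nat k - of_nat i = (0::'k) \<or> Var i * Var j * Var k \<in> A"
      using triples[OF ij(1,2) k(1)] k ij by (cases "k = i") auto
  qed
  then have "Var i * (Var i * Var j * Var j) \<in> A" by (rule ideal_mpoly_mult[OF A _ V(1)])
  then have "(Var i * Var j) ^ 2 \<in> A" by (simp add: power2_eq_square ac_simps)
  then show ?thesis by (rule root[OF VV])
qed

section \<open>Inverting a variable modulo a monomial ideal\<close>

text \<open>The monomials of the saturation of the ideal by \<open>x_i\<close>, that is, of its
  extension to \<open>S[1/x_i]\<close> contracted back to \<open>S\<close>; no localized ring has to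
  be built.\<close>

definition localize_set :: "nat \<Rightarrow> nat \<Rightarrow> (nat \<Rightarrow>\<^sub>0 nat) set \<Rightarrow> (nat \<Rightarrow>\<^sub>0 nat) set" where
  "localize_set n i U = {t. keys t \<subseteq> {1..n} \<and> (\<exists>N. t + single i N \<in> U)}"

lemma monomial_set_localize:
  assumes U: "monomial_set n U"
  shows "monomial_set n (localize_set n i U)"
  unfolding monomial_set_def
proof (intro conjI ballI allI impI)
  fix t assume t: "t \<in> localize_set n i U"
  then obtain N where N: "keys t \<subseteq> {1..n}" "t + single i N \<in> U" by (auto simp: localize_set_def)
  show "keys t \<subseteq> {1..n}" by fact
  fix s :: "nat \<Rightarrow>\<^sub>0 nat" assume s: "keys s \<subseteq> {1..n}"
  have "(t + s) + single i N \<in> U" using monomial_set_add[OF U N(2) s] by (simp add: ac_simps)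
  then show "t + s \<in> localize_set n i U" using N s by (auto simp: localize_set_def keys_add_nat)
qed

lemma localize_set_superset: "monomial_set n U \<Longrightarrow> U \<subseteq> localize_set n i U"
  using monomial_set_keys[of n U] by (auto simp: localize_set_def intro!: exI[of _ 0])

lemma localize_set_cancel:
  assumes "keys t \<subseteq> {1..n}" "t + single i 1 \<in> localize_set n i U"
  shows "t \<in> localize_set n i U"
proof -
  obtain N where "t + single i 1 + single i N \<in> U" using assms by (auto simp: localize_set_def)
  then have "t + single i (1 + N) \<in> U" by (simp only: add.assoc single_add)
  then show ?thesis using assms by (auto simp: localize_set_def)
qed

text \<open>Inverting a second variable keeps the first one cancellable, so two variables can be
  inverted in turn.\<close>

lemma localize_set_cancel_other:
  assumes cancel: "\<And>t. keys t \<subseteq> {1..n} \<Longrightarrow> t + single i 1 \<in> U \<Longrightarrow> t \<in> U" and j: "j \<in> {1..n}"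
    and t: "keys t \<subseteq> {1..n}" "t + single i 1 \<in> localize_set n j U"
  shows "t \<in> localize_set n j U"
proof -
  obtain N where "t + single i 1 + single j N \<in> U" using t by (auto simp: localize_set_def)
  then have "(t + single j N) + single i 1 \<in> U" by (simp add: ac_simps)
  moreover have "keys (t + single j N) \<subseteq> {1..n}" using t j by (auto simp: keys_add_nat)
  ultimately have "t + single j N \<in> U" using cancel by blast
  then show ?thesis using t by (auto simp: localize_set_def)
qed

lemma span_of_mono: "U \<subseteq> V \<Longrightarrow> span_of U \<subseteq> span_of V"
  by (auto simp: span_of_def)

text \<open>Each monomial of \<open>p\<close> needs its own power of \<open>Var i\<close>; the
  support is finite, so these powers can be multiplied together.\<close>

lemma span_of_localize:
  fixes p :: "'k::comm_ring_1 mpoly"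
  assumes U: "monomial_set n U" and i: "i \<in> {1..n}" and p: "p \<in> span_of (localize_set n i U)"
  obtains N where "Var i ^ N * p \<in> span_of U"
proof -
  note id = ideal_span_of[OF U, where 'k = 'k]
  have V: "(Var i :: 'k mpoly) ^ N \<in> carrier (mpoly_ring n)" for N
    using i by (intro mpoly_carrier_power mpoly_carrier_Var)
  have "\<exists>N. Var i ^ N * (\<Sum>t\<in>A. single t (lookup p t)) \<in> span_of U" if "finite A" "A \<subseteq> keys p" for A
    using that
  proof (induction A)
    case empty
    then show ?case by (simp add: span_of_def)
  next
    case (insert t A)
    then obtain N where N: "Var i ^ N * (\<Sum>t\<in>A. single t (lookup p t)) \<in> span_of U" by blast
    have "t \<in> localize_set n i U" using insert.prems p by (auto simp: span_of_def)
    then obtain M where "single i M + t \<in> U" by (auto simp: localize_set_def add.commute)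
    then have M: "Var i ^ M * single t (lookup p t) \<in> span_of U"
      by (simp add: Var_power mult_single span_of_def)
    have "Var i ^ (N + M) * (single t (lookup p t) + (\<Sum>t\<in>A. single t (lookup p t))) =
        Var i ^ N * (Var i ^ M * single t (lookup p t)) + Var i ^ M * (Var i ^ N * (\<Sum>t\<in>A. single t (lookup p t)))"
      by (simp add: power_add algebra_simps)
    also have "\<dots> \<in> span_of U"
      by (intro ideal_mpoly_add[OF id] ideal_mpoly_mult[OF id] M N V)
    finally show ?case using insert.hyps by auto
  qed
  from this[of "keys p"] show ?thesis using that poly_mapping_sum_single[of p] by auto
qed

definition free_of :: "nat \<Rightarrow> 'k::comm_ring_1 mpoly \<Rightarrow> bool" where
  "free_of i p \<longleftrightarrow> (\<forall>t\<in>keys p. lookup t i = 0)"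

lemma free_of_0: "free_of i 0"
  by (simp add: free_of_def)

lemma free_of_Const: "free_of i (Const c)"
  by (simp add: free_of_def Const_def)

lemma free_of_Var: "i \<noteq> j \<Longrightarrow> free_of i (Var j)"
  by (simp add: free_of_def Var_def lookup_single)

lemma free_of_add: "free_of i p \<Longrightarrow> free_of i q \<Longrightarrow> free_of i (p + q)"
  using keys_add[of p q] by (auto simp: free_of_def)

lemma free_of_mult: "free_of i p \<Longrightarrow> free_of i q \<Longrightarrow> free_of i (p * q)"
  using keys_mult[of p q] by (fastforce simp: free_of_def lookup_add)

lemma free_of_lin: "c i = 0 \<Longrightarrow> free_of i (lin n c)"
proof -
  assume c: "c i = 0"
  have "free_of i (\<Sum>j\<in>A. Const (c j) * Var j)" for A
  proof (induction A rule: infinite_finite_induct)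
    case (insert j A)
    have "free_of i (Const (c j) * Var j)"
      using c by (cases "i = j") (auto simp: free_of_0 intro!: free_of_mult free_of_Const free_of_Var)
    then show ?case using insert by (simp add: free_of_add)
  qed (simp_all add: free_of_0)
  then show ?thesis by (simp add: lin_def)
qed

text \<open>Since \<open>x\<^sub>i\<close> is invertible modulo \<open>V\<close>, the monomials of \<open>s\<close> outside \<open>V\<close> with maximal
  exponent at \<open>i\<close> survive the multiplication by the form, and \<open>r\<close> cannot cancel them.\<close>
lemma span_of_lin_cancel:
  fixes s r :: "'k::idom mpoly"
  assumes V: "monomial_set n V" and cancel: "\<And>t. keys t \<subseteq> {1..n} \<Longrightarrow> t + single i 1 \<in> V \<Longrightarrow> t \<in> V"
    and i: "i \<in> {1..n}" "c i \<noteq> 0" and s: "s \<in> carrier (mpoly_ring n)"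
    and mem: "lin n c * s + r \<in> span_of V" and r: "free_of i r"
  shows "s \<in> span_of V"
proof (rule ccontr)
  assume "s \<notin> span_of V"
  define s' where "s' = restr (- V) s"
  note id = ideal_span_of[OF V, where 'k = 'k]
  have ks: "keys s' = keys s - V" by (auto simp: s'_def keys_restr)
  then have ne: "keys s' \<noteq> {}" using \<open>s \<notin> span_of V\<close> by (auto simp: span_of_def)
  have "Max ((\<lambda>t. lookup t i) ` keys s') \<in> (\<lambda>t. lookup t i) ` keys s'" using ne by (intro Max_in) auto
  then obtain t where t: "t \<in> keys s'" "lookup t i = Max ((\<lambda>t. lookup t i) ` keys s')" by auto
  have max: "lookup u i \<le> lookup t i" if "u \<in> keys s'" for u using that t(2) by simp
  \<comment> \<open>The monomial at which the product is tested. A contribution of index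
    \<open>j \<noteq> i\<close> would need a monomial of \<open>s'\<close> with larger exponent at
    \<open>i\<close> than \<open>t\<close>, and \<open>r\<close> does not involve
    \<open>x_i\<close>, so nothing cancels \<open>c i * lookup s' t\<close>.\<close>
  define u where "u = t + single i 1"
  have "lin n c * s = lin n c * restr V s + lin n c * s'"
    unfolding s'_def by (simp flip: distrib_left restr_split)
  then have "lin n c * s' + r = (lin n c * s + r) - lin n c * restr V s" by simp
  also have "\<dots> \<in> span_of V"
    by (intro ideal_mpoly_diff[OF id mem] ideal_mpoly_mult[OF id span_of_restr lin_carrier])
  finally have mem': "lin n c * s' + r \<in> span_of V" .
  have "lookup (lin n c * s') u = (\<Sum>j=1..n. if j = i then c i * lookup s' t else 0)"
    unfolding lookup_lin_mult
  proof (rule sum.cong)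
    fix j assume "j \<in> {1..n}"
    show "(if lookup u j = 0 then 0 else c j * lookup s' (u - single j 1)) =
        (if j = i then c i * lookup s' t else 0)"
    proof (cases "j = i")
      case True
      then show ?thesis by (simp add: u_def lookup_add)
    next
      case False
      then have "lookup (u - single j 1) i = Suc (lookup t i)"
        by (simp add: u_def lookup_add lookup_minus lookup_single)
      then have "u - single j 1 \<notin> keys s'" using max[of "u - single j 1"] by auto
      then show ?thesis using False by (simp add: in_keys_iff)
    qed
  qed simp
  also have "\<dots> = c i * lookup s' t" using i by simp
  finally have "lookup (lin n c * s') u \<noteq> 0" using t(1) i by (simp add: in_keys_iff)
  moreover have "lookup u i \<noteq> 0" by (simp add: u_def lookup_add)
  then have "lookup r u = 0" using r unfolding free_of_def by (meson in_keys_iff)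
  ultimately have "u \<in> keys (lin n c * s' + r)" by (simp add: in_keys_iff lookup_add)
  then have "u \<in> V" using mem' by (auto simp: span_of_def)
  moreover have "keys t \<subseteq> {1..n}" using t(1) ks s by (auto simp: mem_carrier_mpoly)
  ultimately show False using cancel[of t] t(1) ks by (auto simp: u_def)
qed

text \<open>Division with remainder by a polynomial that is linear in \<open>x_i\<close> with the
  unit \<open>c i\<close> as leading coefficient.\<close>

lemma lin_division:
  fixes s :: "'k::field mpoly"
  assumes i: "i \<in> {1..n}" "c i \<noteq> 0" and s: "s \<in> carrier (mpoly_ring n)"
  shows "\<exists>q\<in>carrier (mpoly_ring n). \<exists>r\<in>carrier (mpoly_ring n). s = lin n c * q + r \<and> free_of i r"
  using s
proof (induction s rule: mpoly_induct)
  case (Const a)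
  show ?case
    by (intro bexI[of _ 0] bexI[of _ "Const a"]) (simp_all add: free_of_Const mpoly_carrier_closed)
next
  case (add p p')
  from add.IH(1) obtain q r where 1: "q \<in> carrier (mpoly_ring n)" "r \<in> carrier (mpoly_ring n)"
    "p = lin n c * q + r" "free_of i r" by blast
  from add.IH(2) obtain q' r' where 2: "q' \<in> carrier (mpoly_ring n)" "r' \<in> carrier (mpoly_ring n)"
    "p' = lin n c * q' + r'" "free_of i r'" by blast
  show ?case using 1 2
    by (intro bexI[of _ "q + q'"] bexI[of _ "r + r'"])
      (simp_all add: free_of_add mpoly_carrier_add algebra_simps)
next
  case (Var j p)
  from Var.IH obtain q r where 1: "q \<in> carrier (mpoly_ring n)" "r \<in> carrier (mpoly_ring n)"
    "p = lin n c * q + r" "free_of i r" by blast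
  have V: "(Var j :: 'k mpoly) \<in> carrier (mpoly_ring n)" using Var.hyps by (intro mpoly_carrier_Var)
  show ?case
  proof (cases "j = i")
    case False
    then show ?thesis using 1 V
      by (intro bexI[of _ "Var j * q"] bexI[of _ "Var j * r"])
        (simp_all add: free_of_mult free_of_Var mpoly_carrier_mult algebra_simps)
  next
    case True
    \<comment> \<open>The form without its \<open>x_i\<close> term: modulo the form,
      \<open>x_i\<close> equals \<open>- lin n d / c i\<close>.\<close>
    define d where "d = c(i := 0)"
    have "lin n c = Const (c i) * Var i + (\<Sum>j\<in>{1..n}-{i}. Const (c j) * Var j)"
      unfolding lin_def using i by (subst sum.remove[of _ i]) auto
    also have "(\<Sum>j\<in>{1..n}-{i}. Const (c j) * Var j) = lin n d"
      unfolding lin_def d_def using i by (subst (2) sum.remove[of _ i]) auto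
    finally have e: "Const (c i) * Var i = lin n c - lin n d" by simp
    have "Const (1 / c i) * (Const (c i) * Var i) = Var i"
      using i by (simp flip: mult.assoc Const_mult)
    then have e': "Var i = Const (1 / c i) * (lin n c - lin n d)" by (simp add: e)
    have "Var j * p = lin n c * (Var j * q) + Var i * r"
      by (simp add: 1(3) True algebra_simps)
    also have "\<dots> = lin n c * (Var j * q + Const (1 / c i) * r) + (Const (- 1 / c i) * lin n d) * r"
      by (subst e') (simp add: algebra_simps Const_def single_uminus)
    finally show ?thesis using 1 V
      by (intro bexI[of _ "Var j * q + Const (1 / c i) * r"] bexI[of _ "(Const (- 1 / c i) * lin n d) * r"])
        (simp_all add: free_of_mult free_of_Const free_of_lin d_def mpoly_carrier_closed lin_carrier)
  qed
qed

lemma Var_mem_radical_colon: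
  fixes s :: "'k::idom mpoly"
  assumes U: "monomial_set n U" and i: "i \<in> {1..n}" "c i \<noteq> 0" and s: "s \<in> carrier (mpoly_ring n)"
    and mem: "lin n c * s \<in> span_of U"
  shows "Var i \<in> radical_ideal (mpoly_ring n) (colon_ideal (mpoly_ring n) (span_of U) s)"
proof -
  have "s \<in> span_of (localize_set n i U)"
  proof (rule span_of_lin_cancel[of n "localize_set n i U" i c s 0])
    show "lin n c * s + 0 \<in> span_of (localize_set n i U)"
      using mem span_of_mono[OF localize_set_superset[OF U]] by auto
    show "t \<in> localize_set n i U" if "keys t \<subseteq> {1..n}" "t + single i 1 \<in> localize_set n i U" for t
      using that by (rule localize_set_cancel)
  qed (use i s in \<open>simp_all add: free_of_0 monomial_set_localize[OF U]\<close>)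
  then obtain N where "Var i ^ N * s \<in> span_of U" using span_of_localize[OF U i(1)] by blast
  then show ?thesis using i
    by (auto simp: radical_ideal_def colon_ideal_def mpoly_carrier_power mpoly_carrier_Var)
qed

text \<open>Both variables are inverted. The relation is rewritten with a form and a representative
  \<open>s0\<close> that are free of \<open>x_i\<close>; the multiple of the first form in it then
  vanishes by \<open>span_of_lin_cancel\<close> at \<open>i\<close>, and the other form is cancelled
  from \<open>s0\<close> at \<open>j\<close>.\<close>

lemma Var_Var_mem_radical_colon:
  fixes s :: "'k::field_char_0 mpoly"
  assumes U: "monomial_set n U" and ij: "i \<in> {1..n}" "j \<in> {1..n}" "i \<noteq> j"
    and s: "s \<in> carrier (mpoly_ring n)"
    and mem: "lin n (\<lambda>j. of_nat (j - 1)) * s \<in> Idl\<^bsub>mpoly_ring n\<^esub> (span_of U \<union> {lin n of_nat})"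
  shows "Var i * Var j \<in> radical_ideal (mpoly_ring n)
    (colon_ideal (mpoly_ring n) (Idl\<^bsub>mpoly_ring n\<^esub> (span_of U \<union> {lin n of_nat})) s)"
proof -
  let ?f = "lin n of_nat :: 'k mpoly" and ?g = "lin n (\<lambda>k. of_nat k - of_nat i) :: 'k mpoly"
  let ?J = "Idl\<^bsub>mpoly_ring n\<^esub> (span_of U \<union> {?f})"
  define U' V where "U' = localize_set n i U" and "V = localize_set n j U'"
  have U': "monomial_set n U'" and V: "monomial_set n V"
    using U by (simp_all add: U'_def V_def monomial_set_localize)
  have sub: "span_of U \<subseteq> (span_of V :: 'k mpoly set)"
    using localize_set_superset[OF U, of i] localize_set_superset[OF U', of j]
    by (intro span_of_mono) (auto simp: U'_def V_def)
  note id = ideal_span_of[OF U, where 'k = 'k] and idV = ideal_span_of[OF V, where 'k = 'k]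
  have idJ: "ideal ?J (mpoly_ring n)" and J: "span_of U \<subseteq> ?J" "?f \<in> ?J"
    using ideal_idl_insert_mpoly[OF id, of "{?f}"] lin_carrier[of n of_nat] by auto
  have ci: "t \<in> V" if "keys t \<subseteq> {1..n}" "t + single i 1 \<in> V" for t
    using localize_set_cancel_other[of n i U' j t] localize_set_cancel[of _ n i U] that ij
    unfolding V_def U'_def by blast
  have cj: "t \<in> V" if "keys t \<subseteq> {1..n}" "t + single j 1 \<in> V" for t
    using localize_set_cancel[of t n j U'] that unfolding V_def by blast
  obtain q s0 where q: "q \<in> carrier (mpoly_ring n)" and s0: "s0 \<in> carrier (mpoly_ring n)"
    and ss: "s = ?f * q + s0" and free: "free_of i s0"
    using lin_division[OF ij(1) _ s, of of_nat] ij by auto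
  \<comment> \<open>Up to a multiple of \<open>?f\<close>, the form \<open>?g\<close> is
    \<open>i\<close> times the second form, so membership in \<open>?J\<close> is preserved.\<close>
  have "?g * s0 = Const (of_nat i) * (lin n (\<lambda>j. of_nat (j - 1)) * s) - Const (of_nat (i - 1)) * s * ?f - ?g * q * ?f"
    using ss by (simp add: lin_eliminate[OF ij(1), symmetric] algebra_simps)
  also have "\<dots> \<in> ?J" using s q
    by (intro ideal_mpoly_diff[OF idJ] ideal_mpoly_mult[OF idJ] mem J mpoly_carrier_mult mpoly_carrier_Const lin_carrier)
  finally obtain r where r: "r \<in> carrier (mpoly_ring n)" "?g * s0 - ?f * r \<in> span_of U"
    using mem_idl_insert_mpoly[OF id lin_carrier] by blast
  have "?f * (- r) + ?g * s0 \<in> span_of V" using r sub by (auto simp: algebra_simps)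
  moreover have "free_of i (?g * s0)" using free by (intro free_of_mult free_of_lin) simp_all
  ultimately have "- r \<in> span_of V"
    using ij r(1) by (intro span_of_lin_cancel[OF V ci ij(1), of of_nat "- r" "?g * s0"] mpoly_carrier_uminus) simp_all
  then have "?f * (- r) \<in> span_of V" by (intro ideal_mpoly_mult[OF idV] lin_carrier)
  then have "?g * s0 + 0 \<in> span_of V"
    using ideal_mpoly_mem_add_iff[OF idV, of "?f * (- r)" "?g * s0"] \<open>?f * (- r) + ?g * s0 \<in> span_of V\<close>
    by (simp only: add_0_right)
  then have "s0 \<in> span_of V"
    using ij s0
    by (intro span_of_lin_cancel[OF V cj ij(2), of "\<lambda>k. of_nat k - of_nat i" s0 0]) (simp_all add: free_of_0)
  then obtain M where "Var j ^ M * s0 \<in> span_of U'"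
    unfolding V_def using span_of_localize[OF U' ij(2)] by blast
  then obtain N where N: "Var i ^ N * (Var j ^ M * s0) \<in> span_of U"
    unfolding U'_def using span_of_localize[OF U ij(1)] by blast
  have Vc: "(Var i :: 'k mpoly) \<in> carrier (mpoly_ring n)" "(Var j :: 'k mpoly) \<in> carrier (mpoly_ring n)"
    using ij by (auto intro: mpoly_carrier_Var)
  have "(Var i * Var j) ^ (N + M) * s =
      (Var i ^ M * Var j ^ N) * (Var i ^ N * (Var j ^ M * s0)) + (Var i * Var j) ^ (N + M) * q * ?f"
    by (simp add: ss power_add power_mult_distrib algebra_simps)
  also have "\<dots> \<in> ?J"
    using subsetD[OF J(1) N] Vc q
    by (intro ideal_mpoly_add[OF idJ] ideal_mpoly_mult[OF idJ _ mpoly_carrier_mult] J(2)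
        mpoly_carrier_mult mpoly_carrier_power) simp_all
  finally show ?thesis using Vc
    by (auto simp: radical_ideal_def colon_ideal_def mpoly_carrier_mult mpoly_carrier_power)
qed

section \<open>Regular sequences of length two\<close>

lemma nonzerodivisor_power:
  fixes I :: "'k::comm_ring_1 mpoly set"
  assumes f: "f \<in> carrier (mpoly_ring n)"
    and reg: "\<And>s. s \<in> carrier (mpoly_ring n) \<Longrightarrow> f * s \<in> I \<Longrightarrow> s \<in> I"
    and s: "s \<in> carrier (mpoly_ring n)" "f ^ a * s \<in> I"
  shows "s \<in> I"
  using s
proof (induction a)
  case (Suc a)
  then have "f * (f ^ a * s) \<in> I" by (simp add: mult.assoc)
  moreover have "f ^ a * s \<in> carrier (mpoly_ring n)"
    using Suc.prems f by (intro mpoly_carrier_mult mpoly_carrier_power)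
  ultimately have "f ^ a * s \<in> I" using reg by blast
  then show ?case using Suc by simp
qed simp

text \<open>Radicals and leading forms only provide powers of the elements. To cancel
  \<open>g\<close> modulo \<open>(I, f^a)\<close>, induct on \<open>a\<close>: an element
  \<open>s\<close> that \<open>g\<close> multiplies into the ideal is a multiple
  \<open>f * s'\<close> modulo \<open>I\<close>, and cancelling \<open>f\<close> gives the same
  situation for \<open>s'\<close> with a smaller exponent.\<close>

lemma regular_sequence_powers:
  fixes I :: "'k::comm_ring_1 mpoly set"
  assumes I: "ideal I (mpoly_ring n)" and reg: "regular_sequence (mpoly_ring n) I [f, g]"
  shows "regular_sequence (mpoly_ring n) I [f ^ a, g ^ b]"
proof -
  have f: "f \<in> carrier (mpoly_ring n)" and g: "g \<in> carrier (mpoly_ring n)"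
    using reg by (auto simp: regular_sequence_def)
  let ?J = "\<lambda>a. Idl\<^bsub>mpoly_ring n\<^esub> (I \<union> {f ^ a})"
  have fa: "f ^ a \<in> carrier (mpoly_ring n)" for a using f by (rule mpoly_carrier_power)
  have rf: "s \<in> I" if "s \<in> carrier (mpoly_ring n)" "f * s \<in> I" for s
    using reg that unfolding regular_sequence_pair_mpoly[OF I f g] by blast
  have rg: "s \<in> ?J 1" if "s \<in> carrier (mpoly_ring n)" "g * s \<in> ?J 1" for s
    using reg that unfolding regular_sequence_pair_mpoly[OF I f g] by simp
  have 1: "s \<in> ?J a" if "s \<in> carrier (mpoly_ring n)" "g * s \<in> ?J a" for s a
    using that
  proof (induction a arbitrary: s)
    case 0
    show ?case unfolding mem_idl_insert_mpoly[OF I fa]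
      using 0 by (intro bexI[of _ s]) (simp_all add: ideal_mpoly_zero[OF I])
  next
    case (Suc a)
    obtain r where r: "r \<in> carrier (mpoly_ring n)" "g * s - f ^ Suc a * r \<in> I"
      using Suc.prems mem_idl_insert_mpoly[OF I fa] by blast
    have "g * s \<in> ?J 1"
      unfolding mem_idl_insert_mpoly[OF I fa]
      using r fa[of a] by (intro bexI[of _ "f ^ a * r"]) (auto simp: mult.assoc mpoly_carrier_mult)
    then have "s \<in> ?J 1" using rg Suc.prems by blast
    then obtain s' where s': "s' \<in> carrier (mpoly_ring n)" "s - f * s' \<in> I"
      unfolding mem_idl_insert_mpoly[OF I fa] by auto
    have c: "g * s' - f ^ a * r \<in> carrier (mpoly_ring n)"
      using g s' fa r by (intro mpoly_carrier_diff mpoly_carrier_mult)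
    have "f * (g * s' - f ^ a * r) = (g * s - f ^ Suc a * r) - g * (s - f * s')"
      by (simp add: algebra_simps)
    also have "\<dots> \<in> I" by (rule ideal_mpoly_diff[OF I r(2) ideal_mpoly_mult[OF I s'(2) g]])
    finally have "g * s' - f ^ a * r \<in> I" using rf c by blast
    then have "s' \<in> ?J a"
      using Suc.IH[OF s'(1)] r(1) unfolding mem_idl_insert_mpoly[OF I fa] by blast
    then obtain s'' where s'': "s'' \<in> carrier (mpoly_ring n)" "s' - f ^ a * s'' \<in> I"
      unfolding mem_idl_insert_mpoly[OF I fa] by auto
    have "s - f ^ Suc a * s'' = (s - f * s') + f * (s' - f ^ a * s'')" by (simp add: algebra_simps)
    also have "\<dots> \<in> I" by (rule ideal_mpoly_add[OF I s'(2) ideal_mpoly_mult[OF I s''(2) f]])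
    finally show ?case using s'' unfolding mem_idl_insert_mpoly[OF I fa] by blast
  qed
  show ?thesis
    unfolding regular_sequence_pair_mpoly[OF I fa mpoly_carrier_power[OF g]]
    using nonzerodivisor_power[OF f rf] nonzerodivisor_power[OF g 1] by blast
qed

text \<open>This is the vanishing of \<open>Ext\<^sup>1\<close> of the residue field, made explicit: multiplying by the
  first and second element of the sequence gives a relation that the sequence lets us divide.\<close>
lemma regular_sequence_exchange:
  fixes I :: "'k::comm_ring_1 mpoly set"
  assumes I: "ideal I (mpoly_ring n)" and reg: "regular_sequence (mpoly_ring n) I [y, z]"
    and f: "f \<in> carrier (mpoly_ring n)" and rf: "\<And>s. s \<in> carrier (mpoly_ring n) \<Longrightarrow> f * s \<in> I \<Longrightarrow> s \<in> I"
    and s: "s \<in> carrier (mpoly_ring n)" "y * s \<in> Idl\<^bsub>mpoly_ring n\<^esub> (I \<union> {f})" "z * s \<in> Idl\<^bsub>mpoly_ring n\<^esub> (I \<union> {f})"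
  shows "s \<in> Idl\<^bsub>mpoly_ring n\<^esub> (I \<union> {f})"
proof -
  have y: "y \<in> carrier (mpoly_ring n)" and z: "z \<in> carrier (mpoly_ring n)"
    using reg by (auto simp: regular_sequence_def)
  note R = reg[unfolded regular_sequence_pair_mpoly[OF I y z]]
  obtain a b where a: "a \<in> carrier (mpoly_ring n)" "y * s - f * a \<in> I"
    and b: "b \<in> carrier (mpoly_ring n)" "z * s - f * b \<in> I"
    using s mem_idl_insert_mpoly[OF I f] by blast
  \<comment> \<open>Multiplying \<open>s\<close> by \<open>y\<close> and \<open>z\<close> in either
    order gives the same result, and \<open>f\<close> can be cancelled from the comparison.\<close>
  have "f * (z * a - y * b) = y * (z * s - f * b) - z * (y * s - f * a)" by (simp add: algebra_simps)
  also have "\<dots> \<in> I"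
    by (rule ideal_mpoly_diff[OF I ideal_mpoly_mult[OF I b(2) y] ideal_mpoly_mult[OF I a(2) z]])
  moreover have "z * a - y * b \<in> carrier (mpoly_ring n)"
    using a b y z by (intro mpoly_carrier_diff mpoly_carrier_mult)
  ultimately have "z * a - y * b \<in> I" using rf by simp
  then have "z * a \<in> Idl\<^bsub>mpoly_ring n\<^esub> (I \<union> {y})" using b(1) unfolding mem_idl_insert_mpoly[OF I y] by blast
  then have "a \<in> Idl\<^bsub>mpoly_ring n\<^esub> (I \<union> {y})" using R a by blast
  then obtain c where c: "c \<in> carrier (mpoly_ring n)" "a - y * c \<in> I"
    unfolding mem_idl_insert_mpoly[OF I y] by blast
  have "y * (s - f * c) = (y * s - f * a) + f * (a - y * c)" by (simp add: algebra_simps)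
  also have "\<dots> \<in> I" by (rule ideal_mpoly_add[OF I a(2) ideal_mpoly_mult[OF I c(2) f]])
  moreover have "s - f * c \<in> carrier (mpoly_ring n)"
    using s(1) f c by (intro mpoly_carrier_diff mpoly_carrier_mult)
  ultimately have "s - f * c \<in> I" using R by simp
  then show ?thesis using c unfolding mem_idl_insert_mpoly[OF I f] by blast
qed

lemma linear_forms_regular:
  fixes y z :: "'k::field_char_0 mpoly"
  assumes U: "monomial_set n U" and yz: "y \<in> irrelevant_ideal n" "z \<in> irrelevant_ideal n"
    and reg: "regular_sequence (mpoly_ring n) (span_of U) [y, z]"
  shows "regular_sequence (mpoly_ring n) (span_of U) [lin n of_nat :: 'k mpoly, lin n (\<lambda>j. of_nat (j - 1))]"
proof -
  note id = ideal_span_of[OF U, where 'k = 'k]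
  interpret cring "mpoly_ring n :: 'k mpoly ring" by (rule cring_mpoly_ring)
  let ?f = "lin n of_nat :: 'k mpoly"
  let ?J = "Idl\<^bsub>mpoly_ring n\<^esub> (span_of U \<union> {?f})"
  have idJ: "ideal ?J (mpoly_ring n)" and J: "span_of U \<subseteq> ?J" "?f \<in> ?J"
    using ideal_idl_insert_mpoly[OF id, of "{?f}"] lin_carrier[of n of_nat] by auto
  have y: "y \<in> carrier (mpoly_ring n)" and z: "z \<in> carrier (mpoly_ring n)"
    using reg by (auto simp: regular_sequence_def)
  have irr: "irrelevant_ideal n \<subseteq> A" if "ideal A (mpoly_ring n)" "\<And>i. i \<in> {1..n} \<Longrightarrow> Var i \<in> A"
    for A :: "'k mpoly set"
    unfolding irrelevant_ideal_def using that by (intro genideal_minimal) auto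
  have rf: "s \<in> span_of U" if s: "s \<in> carrier (mpoly_ring n)" "?f * s \<in> span_of U" for s
  proof -
    have "y \<in> radical_ideal (mpoly_ring n) (colon_ideal (mpoly_ring n) (span_of U) s)"
      using irr[OF radical_ideal_mpoly(1)[OF colon_ideal_mpoly[OF id s(1)]]]
        Var_mem_radical_colon[OF U _ _ s] yz(1) by fastforce
    then obtain k where "y ^ k * s \<in> span_of U" by (auto simp: radical_ideal_def colon_ideal_def)
    then show ?thesis
      using nonzerodivisor_power[OF y _ s(1)] reg unfolding regular_sequence_pair_mpoly[OF id y z] by blast
  qed
  have "s \<in> ?J" if s: "s \<in> carrier (mpoly_ring n)" "lin n (\<lambda>j. of_nat (j - 1)) * s \<in> ?J" for s
  proof -
    let ?C = "colon_ideal (mpoly_ring n) ?J s"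
    note C = colon_ideal_mpoly[OF idJ s(1)]
    \<comment> \<open>So far the radical is known to contain only products of two distinct
      variables. With \<open>?f\<close> in the colon ideal, \<open>Var_mem_of_pairs\<close> recovers
      each single variable.\<close>
    have "?f \<in> ?C"
      using ideal_mpoly_mult[OF idJ J(2) s(1)] lin_carrier[of n of_nat] by (simp add: colon_ideal_def mult.commute)
    then have "?f \<in> radical_ideal (mpoly_ring n) ?C" using radical_ideal_mpoly(2)[OF C] by blast
    then have "irrelevant_ideal n \<subseteq> radical_ideal (mpoly_ring n) ?C"
      using Var_Var_mem_radical_colon[OF U _ _ _ s]
      by (intro irr Var_mem_of_pairs[OF radical_ideal_mpoly(1,3)[OF C]] radical_ideal_mpoly(1)[OF C])
    then obtain k l where "y ^ k * s \<in> ?J" "z ^ l * s \<in> ?J"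
      using yz by (fastforce simp: radical_ideal_def colon_ideal_def)
    then show ?thesis
      using regular_sequence_exchange[OF id regular_sequence_powers[OF id reg] lin_carrier rf s(1)] by blast
  qed
  with rf show ?thesis
    unfolding regular_sequence_pair_mpoly[OF id lin_carrier lin_carrier] by simp
qed

section \<open>Hilbert's basis theorem\<close>

lemma nat_seq_mono_subseq:
  fixes s :: "nat \<Rightarrow> nat"
  obtains r :: "nat \<Rightarrow> nat" where "strict_mono r" "mono (\<lambda>k. s (r k))"
proof -
  obtain g where g: "strict_mono g" "monoseq (\<lambda>k. s (g k))" using seq_monosub by blast
  show ?thesis
  proof (cases "\<forall>m. \<forall>k\<ge>m. s (g m) \<le> s (g k)")
    case True
    then show ?thesis using that[of g] g by (auto simp: mono_def)
  next
    case False
    \<comment> \<open>Otherwise the subsequence is nonincreasing; consisting of natural numbers, it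
      is constant from the point where it reaches its minimum \<open>v\<close>.\<close>
    then have dec: "s (g k) \<le> s (g m)" if "m \<le> k" for m k using g(2) that by (auto simp: monoseq_def)
    define v where "v = (LEAST v. \<exists>k. s (g k) = v)"
    have "\<exists>k. s (g k) = v" unfolding v_def by (rule LeastI[of "\<lambda>v. \<exists>k. s (g k) = v" "s (g 0)"]) auto
    then obtain k0 where k0: "s (g k0) = v" by blast
    have "v \<le> s (g k)" for k unfolding v_def by (rule Least_le) auto
    then have "s (g (k0 + k)) = v" for k using dec[of k0 "k0 + k"] k0 by (simp add: antisym)
    then show ?thesis
      using that[of "\<lambda>k. g (k0 + k)"] g(1) by (auto simp: strict_mono_def mono_def)
  qed
qed

text \<open>Passing to a subsequence once for each variable makes all exponents nondecreasing along
  one sequence; its first two members are then comparable by divisibility.\<close>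

lemma dickson_sequence:
  fixes t :: "nat \<Rightarrow> nat \<Rightarrow>\<^sub>0 nat"
  assumes "finite A" "\<And>k. keys (t k) \<subseteq> A"
  obtains i j u where "i < j" "t j = t i + u"
proof -
  have "\<exists>r :: nat \<Rightarrow> nat. strict_mono r \<and> (\<forall>x\<in>B. mono (\<lambda>k. lookup (t (r k)) x))" if "finite B" for B
    using that
  proof (induction B)
    case empty
    then show ?case by (intro exI[of _ "\<lambda>k. k"]) (simp add: strict_mono_def)
  next
    case (insert x B)
    then obtain r :: "nat \<Rightarrow> nat" where r: "strict_mono r" "\<And>y. y \<in> B \<Longrightarrow> mono (\<lambda>k. lookup (t (r k)) y)" by blast
    obtain r' :: "nat \<Rightarrow> nat" where r': "strict_mono r'" "mono (\<lambda>k. lookup (t (r (r' k))) x)"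
      using nat_seq_mono_subseq[of "\<lambda>k. lookup (t (r k)) x"] by blast
    have "mono (\<lambda>k. lookup (t (r (r' k))) y)" if "y \<in> B" for y
      using r(2)[OF that] r'(1) by (simp add: mono_def strict_mono_less_eq)
    then show ?case using r r'
      by (intro exI[of _ "\<lambda>k. r (r' k)"]) (auto simp: strict_mono_def)
  qed
  then obtain r :: "nat \<Rightarrow> nat" where r: "strict_mono r" "\<And>x. x \<in> A \<Longrightarrow> mono (\<lambda>k. lookup (t (r k)) x)"
    using assms(1) by blast
  have "lookup (t (r 0)) x \<le> lookup (t (r 1)) x" for x
  proof (cases "x \<in> A")
    case True
    then show ?thesis using r(2) by (simp add: mono_def)
  next
    case False
    then have "x \<notin> keys (t (r 0))" using assms(2) by blast
    then show ?thesis by (simp add: in_keys_iff)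
  qed
  then have "t (r 1) = t (r 0) + (t (r 1) - t (r 0))"
    by (intro poly_mapping_eqI) (simp add: lookup_add lookup_minus)
  moreover have "r 0 < r 1" using r(1) by (simp add: strict_mono_def)
  ultimately show ?thesis using that by blast
qed

text \<open>The divisibility-minimal elements form an antichain, which
  \<open>dickson_sequence\<close> forces to be finite. A divisor of least degree shows that every
  element has a minimal one below it.\<close>

lemma dickson_set:
  fixes L :: "(nat \<Rightarrow>\<^sub>0 nat) set"
  assumes A: "finite A" "\<And>t. t \<in> L \<Longrightarrow> keys t \<subseteq> A"
  obtains B where "finite B" "B \<subseteq> L" "\<And>t. t \<in> L \<Longrightarrow> \<exists>b\<in>B. \<exists>u. t = b + u"
proof -
  define B where "B = {b \<in> L. \<forall>l\<in>L. (\<exists>u. b = l + u) \<longrightarrow> l = b}"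
  have "finite B"
  proof (rule ccontr)
    assume "infinite B"
    then obtain f :: "nat \<Rightarrow> nat \<Rightarrow>\<^sub>0 nat" where f: "inj f" "range f \<subseteq> B"
      using infinite_countable_subset by blast
    have "f k \<in> L" for k using f(2) by (auto simp: B_def)
    then have "keys (f k) \<subseteq> A" for k by (rule A(2))
    then obtain i j u where ij: "i < j" "f j = f i + u" using dickson_sequence[OF A(1)] by metis
    moreover have "f i \<in> L" "f j \<in> B" using f(2) by (auto simp: B_def)
    ultimately have "f i = f j" unfolding B_def by blast
    then show False using f(1) ij(1) by (auto simp: inj_def)
  qed
  moreover have "\<exists>b\<in>B. \<exists>u. t = b + u" if t: "t \<in> L" for t
  proof -
    obtain b where b: "b \<in> L \<and> (\<exists>u. t = b + u)"
      and min: "\<And>l. l \<in> L \<and> (\<exists>u. t = l + u) \<Longrightarrow> deg b \<le> deg l"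
      using ex_has_least_nat[of "\<lambda>b. b \<in> L \<and> (\<exists>u. t = b + u)" t deg] t
      by (metis add.right_neutral)
    have "l = b" if l: "l \<in> L" "b = l + u" for l u
    proof -
      have "deg b \<le> deg l" using b l by (intro min) (auto simp: add.assoc)
      then have "deg u = 0" using l(2) by (simp add: deg_add)
      then have "u = 0" by (auto simp: deg_def in_keys_iff intro!: poly_mapping_eqI)
      then show ?thesis using l(2) by simp
    qed
    then show ?thesis using b unfolding B_def by blast
  qed
  ultimately show ?thesis using that[of B] by (auto simp: B_def)
qed

text \<open>The order on exponent functions is lexicographic, decided at the smallest index where
  they differ; against \<open>0\<close> this is the least index in the support of
  \<open>t\<close>.\<close>

lemma zero_le_monomial: "0 \<le> (t :: nat \<Rightarrow>\<^sub>0 nat)"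
proof (cases "t = 0")
  case False
  then obtain i where "lookup t i \<noteq> 0" by (metis poly_mapping_eqI lookup_zero)
  then have *: "lookup t (LEAST i. lookup t i \<noteq> 0) \<noteq> 0" by (rule LeastI)
  have "0 < t"
    unfolding less_poly_mapping.rep_eq less_fun_def
    using * not_less_Least by (intro exI[of _ "LEAST i. lookup t i \<noteq> 0"]) auto
  then show ?thesis by simp
qed simp

text \<open>On all monomials the lexicographic order is not well founded, since the variables
  themselves descend as their index grows; hence the finite set \<open>A\<close>. In a descending
  sequence over \<open>A\<close>, a later member divisible by an earlier one gives a
  contradiction.\<close>

lemma wf_monomial_less:
  assumes "finite A"
  shows "wf {(s, t). s < t \<and> keys s \<subseteq> A \<and> keys (t :: nat \<Rightarrow>\<^sub>0 nat) \<subseteq> A}"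
  unfolding wf_iff_no_infinite_down_chain
proof
  assume "\<exists>f. \<forall>i. (f (Suc i), f i) \<in> {(s, t :: nat \<Rightarrow>\<^sub>0 nat). s < t \<and> keys s \<subseteq> A \<and> keys t \<subseteq> A}"
  then obtain f :: "nat \<Rightarrow> nat \<Rightarrow>\<^sub>0 nat" where "\<forall>i. (f (Suc i), f i) \<in> {(s, t). s < t \<and> keys s \<subseteq> A \<and> keys t \<subseteq> A}" ..
  then have f: "f (Suc i) < f i" "keys (f i) \<subseteq> A" for i by simp_all
  obtain i j u where ij: "i < j" "f j = f i + u" using dickson_sequence[of A f, OF assms f(2)] by metis
  have "f i \<le> f j" using ij(2) add_left_mono[OF zero_le_monomial[of u], of "f i"] by simp
  moreover have "f j \<le> f (Suc i)"
    by (rule lift_Suc_antimono_le[of f, OF less_imp_le[OF f(1)]]) (use ij(1) in simp)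
  ultimately show False using f(1)[of i] by simp
qed

text \<open>The factor \<open>c\<close> makes the leading terms cancel, and no monomial of the
  subtracted multiple exceeds the old leading one because the order is compatible with
  addition.\<close>

lemma reduce_leading_monomial:
  fixes p q :: "'k::field mpoly"
  assumes p: "p \<noteq> 0" and q: "q \<noteq> 0" and u: "Max (keys p) = Max (keys q) + u"
  defines "c \<equiv> lookup p (Max (keys p)) / lookup q (Max (keys q))"
  defines "p' \<equiv> p - single u c * q"
  assumes p': "p' \<noteq> 0"
  shows "Max (keys p') < Max (keys p)"
proof -
  have qM: "Max (keys q) \<in> keys q" using q by (intro Max_in) auto
  have le: "t \<le> Max (keys p)" if t: "t \<in> keys p'" for t
  proof -
    have "t \<in> keys p \<or> t \<in> keys (single u c * q)"
      using t keys_diff[of p "single u c * q"] unfolding p'_def by blast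
    then show ?thesis
    proof
      assume "t \<in> keys (single u c * q)"
      then obtain v where v: "v \<in> keys q" "t = u + v"
        using keys_mult[of "single u c" q] by (auto split: if_splits)
      then have "v \<le> Max (keys q)" by simp
      then show ?thesis unfolding u v(2) by (simp add: add.commute[of u])
    qed simp
  qed
  have "lookup (single u c * q) (Max (keys p)) = c * lookup q (Max (keys q))"
    using lookup_single_mult(1)[of u c q "Max (keys q)"] u by (simp add: add.commute)
  then have "lookup p' (Max (keys p)) = 0"
    using qM by (simp add: p'_def lookup_minus c_def in_keys_iff)
  then have "Max (keys p) \<notin> keys p'" by (simp add: in_keys_iff)
  moreover have "Max (keys p') \<in> keys p'" using p' by (intro Max_in) auto
  ultimately show ?thesis using le[of "Max (keys p')"] by (metis order_le_less)
qed

text \<open>Gordan's argument: Dickson's lemma gives finitely many members of the ideal whose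
  leading monomials divide those of all others, and reduction by these members ends at
  \<open>0\<close> because the order is well founded.\<close>

theorem noetherian_mpoly_ring: "noetherian_ring (mpoly_ring n :: 'k::field mpoly ring)"
proof -
  interpret cring "mpoly_ring n :: 'k mpoly ring" by (rule cring_mpoly_ring)
  show ?thesis
  proof (rule noetherian_ringI)
    fix J :: "'k mpoly set" assume J: "ideal J (mpoly_ring n)"
    define L where "L = (\<lambda>p. Max (keys p)) ` (J - {0})"
    have keysM: "keys (Max (keys p)) \<subseteq> {1..n}" if "p \<in> J" "p \<noteq> 0" for p
    proof -
      have "Max (keys p) \<in> keys p" using that by (intro Max_in) auto
      then show ?thesis using ideal_mpoly_carrier[OF J that(1)] by (simp add: mem_carrier_mpoly)
    qed
    then have "keys t \<subseteq> {1..n}" if "t \<in> L" for t using that unfolding L_def by blast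
    then obtain B where B: "finite B" "B \<subseteq> L" "\<And>t. t \<in> L \<Longrightarrow> \<exists>b\<in>B. \<exists>u. t = b + u"
      using dickson_set[of "{1..n}" L] by (metis finite_atLeastAtMost)
    obtain G where G: "finite G" "G \<subseteq> J - {0}" "B = (\<lambda>p. Max (keys p)) ` G"
      using B(1,2) unfolding L_def by (meson finite_subset_image)
    have Gc: "G \<subseteq> carrier (mpoly_ring n)" using G(2) ideal_mpoly_carrier[OF J] by blast
    note id = genideal_ideal[OF Gc] and gen = genideal_self[OF Gc]
    have "p \<in> J \<Longrightarrow> p \<noteq> 0 \<Longrightarrow> Max (keys p) = t \<Longrightarrow> p \<in> Idl\<^bsub>mpoly_ring n\<^esub> G" for p t
    proof (induction t arbitrary: p rule: wf_induct_rule[OF wf_monomial_less[of "{1..n}"]])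
      case 1
      show ?case by simp
    next
      case (2 t)
      have "t \<in> L" using "2.prems" by (auto simp: L_def)
      then obtain g u where g: "g \<in> G" "Max (keys p) = Max (keys g) + u"
        using B(3)[of t] G(3) "2.prems"(3) by blast
      have gJ: "g \<in> J" "g \<noteq> 0" using g G(2) by auto
      define c where "c = lookup p (Max (keys p)) / lookup g (Max (keys g))"
      define p' where "p' = p - single u c * g"
      have "keys u \<subseteq> {1..n}"
        using keysM[OF "2.prems"(1,2)] unfolding g(2) by (simp add: keys_add_nat)
      then have uc: "single u c \<in> carrier (mpoly_ring n)" by (auto simp: mem_carrier_mpoly)
      have p'J: "p' \<in> J"
        unfolding p'_def using "2.prems"(1) gJ uc by (intro ideal_mpoly_diff[OF J] ideal_mpoly_mult[OF J])
      have "p' \<in> Idl\<^bsub>mpoly_ring n\<^esub> G"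
      proof (cases "p' = 0")
        case True
        then show ?thesis using ideal_mpoly_zero[OF id] by simp
      next
        case False
        then have "Max (keys p') < t"
          using reduce_leading_monomial[OF "2.prems"(2) gJ(2) g(2)] "2.prems"(3) unfolding p'_def c_def by simp
        moreover have "keys t \<subseteq> {1..n}" using keysM[OF "2.prems"(1,2)] "2.prems"(3) by simp
        ultimately show ?thesis
          using "2.IH"[of "Max (keys p')" p'] p'J False keysM by blast
      qed
      moreover have "single u c * g \<in> Idl\<^bsub>mpoly_ring n\<^esub> G"
        using gen g(1) uc by (intro ideal_mpoly_mult[OF id]) auto
      ultimately show ?case
        using ideal_mpoly_add[OF id, of p' "single u c * g"] by (simp add: p'_def)
    qed
    then have "J \<subseteq> Idl\<^bsub>mpoly_ring n\<^esub> G" using ideal_mpoly_zero[OF id] by blast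
    moreover have "Idl\<^bsub>mpoly_ring n\<^esub> G \<subseteq> J" using G(2) by (intro genideal_minimal[OF J]) auto
    ultimately show "\<exists>A\<subseteq>carrier (mpoly_ring n). finite A \<and> J = Idl\<^bsub>mpoly_ring n\<^esub> A"
      using G(1) Gc by blast
  qed
qed

section \<open>Maximal ideals of \<open>K[u, v]\<close>\<close>

text \<open>Modulo \<open>w\<close> the leading coefficient of \<open>h\<close> is invertible, with
  inverse \<open>- x\<close>. If \<open>a\<close> did not vanish modulo \<open>w\<close>, its top
  surviving coefficient would reappear up to this unit in the product, in degree at least
  \<open>degree h\<close> and hence positive.\<close>

lemma not_dvd_coeff_mult:
  fixes a h :: "'a::idom poly"
  assumes w: "w dvd x * lead_coeff h + 1" and h: "degree h > 0"
    and dvd: "\<And>i. i > 0 \<Longrightarrow> w dvd coeff (h * a) i"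
  shows "w dvd coeff a i"
proof (rule ccontr)
  assume "\<not> w dvd coeff a i"
  let ?D = "{i. \<not> w dvd coeff a i}"
  have fin: "finite ?D"
    by (rule finite_subset[of _ "{..degree a}"]) (auto simp: not_less[symmetric] coeff_eq_0)
  define d where "d = Max ?D"
  have d: "\<not> w dvd coeff a d" "\<And>j. j > d \<Longrightarrow> w dvd coeff a j"
    using fin \<open>\<not> w dvd coeff a i\<close> Max_in[OF fin] Max_ge[OF fin] unfolding d_def by fastforce+
  let ?m = "degree h"
  have "coeff (h * a) (?m + d) = (\<Sum>i\<le>?m + d. coeff h i * coeff a (?m + d - i))" by (rule coeff_mult)
  also have "\<dots> = coeff h ?m * coeff a d + (\<Sum>i\<in>{..?m + d} - {?m}. coeff h i * coeff a (?m + d - i))"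
    by (subst sum.remove[of _ ?m]) auto
  finally have e: "lead_coeff h * coeff a d =
      coeff (h * a) (?m + d) - (\<Sum>i\<in>{..?m + d} - {?m}. coeff h i * coeff a (?m + d - i))" by simp
  have "w dvd (\<Sum>i\<in>{..?m + d} - {?m}. coeff h i * coeff a (?m + d - i))"
  proof (rule dvd_sum)
    fix i assume i: "i \<in> {..?m + d} - {?m}"
    show "w dvd coeff h i * coeff a (?m + d - i)"
    proof (cases "i > ?m")
      case True
      then show ?thesis by (simp add: coeff_eq_0)
    next
      case False
      then show ?thesis using i by (intro dvd_mult d(2)) auto
    qed
  qed
  then have "w dvd lead_coeff h * coeff a d" unfolding e using h by (intro dvd_diff dvd) auto
  then have "w dvd x * (lead_coeff h * coeff a d)" by simp
  moreover have "w dvd (x * lead_coeff h + 1) * coeff a d" using w by simp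
  ultimately have "w dvd (x * lead_coeff h + 1) * coeff a d - x * (lead_coeff h * coeff a d)"
    by (intro dvd_diff)
  then show False using d(1) by (simp add: algebra_simps)
qed

text \<open>Otherwise take \<open>h \<in> q\<close> of minimal degree in \<open>v\<close>, with leading coefficient \<open>c\<close>. Pseudo-division
  by \<open>h\<close> shows that an inverse of \<open>1 + u c\<close> modulo \<open>q\<close> would make this polynomial divide a power
  of \<open>c\<close>, to which it is coprime.\<close>
lemma maximal_ideal_meets_coefficients:
  fixes q :: "'k::field poly poly set"
  assumes zero: "0 \<in> q" and add: "\<And>a b. a \<in> q \<Longrightarrow> b \<in> q \<Longrightarrow> a + b \<in> q"
    and mult: "\<And>a b. b \<in> q \<Longrightarrow> a * b \<in> q" and one: "1 \<notin> q"
    and inv: "\<And>w. w \<notin> q \<Longrightarrow> \<exists>e. w * e - 1 \<in> q"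
  shows "\<exists>c. c \<noteq> 0 \<and> [:c:] \<in> q"
proof (rule ccontr)
  assume "\<not> ?thesis"
  then have triv: "c = 0" if "[:c:] \<in> q" for c using that by blast
  have diff: "a - b \<in> q" if "a \<in> q" "b \<in> q" for a b using add[of a "(- 1) * b"] mult[of b "- 1"] that by simp
  define u :: "'k poly" where "u = [:0, 1:]"
  \<comment> \<open>Provides a nonzero element of \<open>q\<close>: as \<open>u\<close> is not a
    unit, \<open>[:u:] * e - 1\<close> cannot vanish.\<close>
  have "[:u:] \<notin> q" using triv[of u] by (auto simp: u_def)
  then obtain e where e: "[:u:] * e - 1 \<in> q" using inv by blast
  have "[:u:] * e - 1 \<noteq> 0"
  proof
    assume "[:u:] * e - 1 = 0"
    then have "coeff ([:u:] * e) 0 = coeff 1 0" by simp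
    then have "poly (u * coeff e 0) 0 = 1" by simp
    then show False by (simp add: u_def)
  qed
  then obtain h where h: "h \<in> q \<and> h \<noteq> 0" and min: "\<And>g. g \<in> q \<and> g \<noteq> 0 \<Longrightarrow> degree h \<le> degree g"
    using ex_has_least_nat[of "\<lambda>h. h \<in> q \<and> h \<noteq> 0" _ degree] e by blast
  define c where "c = lead_coeff h"
  have c: "c \<noteq> 0" using h by (simp add: c_def)
  have deg: "degree h > 0"
  proof (rule ccontr)
    assume "\<not> degree h > 0"
    then obtain a where "h = [:a:]" by (metis degree_eq_zeroE neq0_conv)
    then show False using triv h by auto
  qed
  \<comment> \<open>The value \<open>1\<close> at \<open>0\<close> keeps \<open>w\<close> nonzero
    whatever \<open>c\<close> is, and \<open>w\<close> is congruent to \<open>1\<close> modulo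
    \<open>c\<close>, hence coprime to it.\<close>
  define w where "w = 1 + u * c"
  have "poly w 0 = 1" by (simp add: w_def u_def)
  then have "[:w:] \<notin> q" using triv[of w] by auto
  then obtain e where e: "[:w:] * e - 1 \<in> q" using inv by blast
  obtain a r where ar: "pseudo_divmod ([:w:] * e - 1) h = (a, r)" by force
  define k where "k = Suc (degree ([:w:] * e - 1)) - degree h"
  have d: "smult (c ^ k) ([:w:] * e - 1) = h * a + r" "r = 0 \<or> degree r < degree h"
    using pseudo_divmod[OF _ ar] h by (auto simp: c_def k_def)
  have "smult (c ^ k) ([:w:] * e - 1) = [:c ^ k:] * ([:w:] * e - 1)" by simp
  then have "smult (c ^ k) ([:w:] * e - 1) \<in> q" using mult[OF e] by metis
  then have "r \<in> q" using diff[of "smult (c ^ k) ([:w:] * e - 1)" "h * a"] mult[of h a] h d(1)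
    by (simp add: mult.commute)
  then have "r = 0" using d(2) min[of r] by (auto simp: not_le[symmetric])
  then have ha: "h * a = smult (c ^ k) (smult w e) - [:c ^ k:]"
    using d(1) by (simp add: smult_diff_right)
  \<comment> \<open>In positive degree \<open>h * a\<close> agrees with a multiple of
    \<open>w\<close>, so all of \<open>a\<close> vanishes modulo \<open>w\<close>; the constant
    coefficient of \<open>h * a\<close> then yields \<open>w dvd c ^ k\<close>.\<close>
  have "w dvd coeff a i" for i
  proof (rule not_dvd_coeff_mult[where h = h and x = u])
    show "w dvd u * lead_coeff h + 1" by (simp add: w_def c_def add.commute)
    show "w dvd coeff (h * a) i" if "i > 0" for i
      unfolding ha using that by (cases i) (auto simp: mult.left_commute)
  qed (rule deg)
  then have "w dvd coeff (h * a) 0" by (simp add: coeff_mult)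
  then have "w dvd c ^ k * (w * coeff e 0) - c ^ k" by (simp add: ha mult.assoc)
  moreover have "w dvd c ^ k * (w * coeff e 0)" by (simp add: mult.left_commute)
  ultimately have "w dvd c ^ k * (w * coeff e 0) - (c ^ k * (w * coeff e 0) - c ^ k)"
    by (rule dvd_diff[rotated])
  then have "w dvd c ^ k" by simp
  \<comment> \<open>The factors \<open>c\<close> are removed one at a time through
    \<open>c ^ k = w * c ^ k - u * c ^ Suc k\<close>.\<close>
  then have "w dvd 1"
  proof (induction k)
    case (Suc k)
    then have "w dvd w * c ^ k - u * c ^ Suc k" by (intro dvd_diff) auto
    also have "w * c ^ k - u * c ^ Suc k = c ^ k" by (simp add: w_def algebra_simps)
    finally show ?case by (rule Suc.IH)
  qed simp
  moreover from this have "w \<noteq> 0" by auto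
  ultimately have "degree w = 0" by (simp add: is_unit_iff_degree)
  moreover have "degree w = degree (u * c)"
    unfolding w_def by (rule degree_add_eq_right) (use c in \<open>simp add: u_def degree_mult_eq\<close>)
  ultimately show False using c by (simp add: u_def degree_mult_eq)
qed

text \<open>Nonzero primes of \<open>K[x]\<close> are maximal. Let \<open>e\<close> generate
  \<open>q\<close>, and let \<open>c = e * k\<close> have least degree in \<open>p\<close>. If
  \<open>k\<close> rather than \<open>e\<close> were in \<open>p\<close>, then \<open>e\<close>
  would be constant and \<open>q\<close> would contain \<open>1\<close>.\<close>

lemma prime_chain_univariate:
  fixes p q :: "'k::field poly set"
  assumes p: "\<And>a b. a \<in> p \<Longrightarrow> b * a \<in> p" "\<And>a b. a * b \<in> p \<Longrightarrow> a \<in> p \<or> b \<in> p"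
    and q: "\<And>a b. a \<in> q \<Longrightarrow> b \<in> q \<Longrightarrow> a - b \<in> q" "\<And>a b. a \<in> q \<Longrightarrow> b * a \<in> q" "1 \<notin> q"
    and sub: "p \<subseteq> q" and c: "c \<in> p" "c \<noteq> 0"
  shows "q \<subseteq> p"
proof -
  obtain c where c: "c \<in> p \<and> c \<noteq> 0" and minc: "\<And>g. g \<in> p \<and> g \<noteq> 0 \<Longrightarrow> degree c \<le> degree g"
    using ex_has_least_nat[of "\<lambda>h. h \<in> p \<and> h \<noteq> 0" _ degree] c by blast
  obtain e where e: "e \<in> q \<and> e \<noteq> 0" and mine: "\<And>g. g \<in> q \<and> g \<noteq> 0 \<Longrightarrow> degree e \<le> degree g"
    using ex_has_least_nat[of "\<lambda>h. h \<in> q \<and> h \<noteq> 0" _ degree] c sub by blast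
  have dvd: "e dvd g" if "g \<in> q" for g
  proof -
    have "g mod e = g - g div e * e" by (simp add: minus_div_mult_eq_mod)
    then have "g mod e \<in> q" using q(1)[OF that q(2)] e by simp
    then have "g mod e = 0" using mine[of "g mod e"] degree_mod_less[of e g] e by (auto simp: not_le[symmetric])
    then show ?thesis by (simp add: dvd_eq_mod_eq_0)
  qed
  obtain k where k: "c = e * k" using dvd c sub by blast
  have "e \<in> p"
  proof (rule ccontr)
    assume "e \<notin> p"
    then have "k \<in> p" using p(2)[of e k] k c by auto
    then have "degree c \<le> degree k" using minc[of k] k c by auto
    then have "degree e = 0" using k c by (auto simp: degree_mult_eq)
    then obtain x where x: "e = [:x:]" "x \<noteq> 0" using e by (metis degree_eq_zeroE pCons_eq_0_iff)
    then have "1 = [:1 / x:] * e" by (simp add: one_pCons)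
    then show False using q(2)[of e "[:1 / x:]"] q(3) e by simp
  qed
  then show ?thesis using dvd p(1) by (metis dvdE mult.commute subsetI)
qed

section \<open>Evaluating polynomials at two forms\<close>

definition ev :: "('a::comm_ring_1 \<Rightarrow> 'b::comm_ring_1) \<Rightarrow> 'b \<Rightarrow> 'a poly \<Rightarrow> 'b" where
  "ev h x p = poly (map_poly h p) x"

lemma ev_pCons: "h 0 = 0 \<Longrightarrow> ev h x (pCons a p) = h a + x * ev h x p"
  by (simp add: ev_def map_poly_pCons)

lemma ev_0: "ev h x 0 = 0"
  by (simp add: ev_def)

text \<open>Evaluation \<open>ev h x\<close> is itself such a map, which allows it to be nested for
  polynomials in two variables.\<close>

locale ring_map =
  fixes h :: "'a::comm_ring_1 \<Rightarrow> 'b::comm_ring_1"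
  assumes h_0: "h 0 = 0" and h_1: "h 1 = 1" and h_add: "h (a + b) = h a + h b"
    and h_mult: "h (a * b) = h a * h b"
begin

lemma ev_add: "ev h x (p + q) = ev h x p + ev h x q"
proof (induction p arbitrary: q)
  case (pCons a p)
  show ?case
  proof (cases q)
    case (pCons b r)
    then show ?thesis using pCons.IH[of r] by (simp add: ev_pCons h_0 h_add algebra_simps)
  qed
qed (simp add: ev_0)

lemma ev_smult: "ev h x (smult a p) = h a * ev h x p"
  by (induction p) (simp_all add: ev_0 ev_pCons h_0 h_mult algebra_simps)

lemma ev_mult: "ev h x (p * q) = ev h x p * ev h x q"
  by (induction p) (simp_all add: ev_0 ev_pCons h_0 ev_add ev_smult algebra_simps)

lemma ring_map_ev: "ring_map (ev h x)"
  by unfold_locales (simp_all add: ev_0 ev_add ev_mult one_pCons ev_pCons h_0 h_1)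

lemma h_uminus: "h (- a) = - h a"
proof -
  have "h a + h (- a) = 0" using h_add[of a "- a"] h_0 by simp
  then show ?thesis by (simp add: add_eq_0_iff)
qed

lemma h_diff: "h (a - b) = h a - h b"
  using h_add[of a "- b"] h_uminus by simp

end

interpretation Const: ring_map Const
  by unfold_locales (simp_all add: Const_add Const_mult)

lemma ev_closed:
  assumes "x \<in> carrier (mpoly_ring n)" "h 0 = 0" "\<And>a. h a \<in> carrier (mpoly_ring n)"
  shows "ev h x p \<in> carrier (mpoly_ring n)"
  using assms(1,3)
  by (induction p) (simp_all add: ev_0 ev_pCons assms(2) mpoly_carrier_zero mpoly_carrier_add mpoly_carrier_mult)

text \<open>Here \<open>K[u, v]\<close> is \<open>K[u][v]\<close>: the inner variable goes to
  \<open>f\<close> and the outer one to \<open>g\<close>, so a constant \<open>[:c:]\<close> of the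
  outer ring becomes a polynomial in \<open>f\<close> alone.\<close>

definition ev2 :: "'k::comm_ring_1 mpoly \<Rightarrow> 'k mpoly \<Rightarrow> 'k poly poly \<Rightarrow> 'k mpoly" where
  "ev2 f g = ev (ev Const f) g"

lemma ring_map_ev2: "ring_map (ev2 f g)"
  unfolding ev2_def by (intro ring_map.ring_map_ev Const.ring_map_ev)

lemma ev2_closed:
  assumes "f \<in> carrier (mpoly_ring n)" "g \<in> carrier (mpoly_ring n)"
  shows "ev2 f g p \<in> carrier (mpoly_ring n)"
  unfolding ev2_def
  by (intro ev_closed assms) (simp_all add: ev_0 ev_closed assms mpoly_carrier_Const)

lemma ev2_const: "ev2 f g [:c:] = ev Const f c"
  by (simp add: ev2_def ev_pCons ev_0)

lemma maximalideal_inverse: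
  fixes Q :: "'k::comm_ring_1 mpoly set"
  assumes Q: "maximalideal Q (mpoly_ring n)" and a: "a \<in> carrier (mpoly_ring n)" "a \<notin> Q"
  obtains r where "r \<in> carrier (mpoly_ring n)" "a * r - 1 \<in> Q"
proof -
  interpret Q: maximalideal Q "mpoly_ring n" by fact
  note id = Q.is_ideal
  have i: "ideal (Idl\<^bsub>mpoly_ring n\<^esub> (Q \<union> {a})) (mpoly_ring n)" "Q \<subseteq> Idl\<^bsub>mpoly_ring n\<^esub> (Q \<union> {a})"
    "a \<in> Idl\<^bsub>mpoly_ring n\<^esub> (Q \<union> {a})"
    using ideal_idl_insert_mpoly[OF id, of "{a}"] a by auto
  then have "Idl\<^bsub>mpoly_ring n\<^esub> (Q \<union> {a}) = carrier (mpoly_ring n)"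
    using Q.I_maximal[OF i(1)] a(2) ideal_mpoly_carrier[OF i(1)] by blast
  then have "1 \<in> Idl\<^bsub>mpoly_ring n\<^esub> (Q \<union> {a})" by (simp add: mpoly_carrier_one)
  then obtain r where "r \<in> carrier (mpoly_ring n)" "1 - a * r \<in> Q"
    using mem_idl_insert_mpoly[OF id a(1)] by blast
  then show ?thesis using that[of r] ideal_mpoly_uminus[OF id, of "1 - a * r"] by simp
qed

text \<open>Substitution maps \<open>K[u, v]\<close> onto \<open>S/Q\<close>, so the preimage
  \<open>q\<close> of \<open>Q\<close> inherits inverses modulo \<open>q\<close> from this field.
  This takes the place of the Nullstellensatz without assuming K algebraically closed.\<close>

lemma maximalideal_contains_univariate:
  fixes Q :: "'k::field mpoly set"
  assumes Q: "maximalideal Q (mpoly_ring n)"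
    and fg: "f \<in> carrier (mpoly_ring n)" "g \<in> carrier (mpoly_ring n)"
    and surj: "\<And>s. s \<in> carrier (mpoly_ring n) \<Longrightarrow> \<exists>e. s - ev2 f g e \<in> Q"
  shows "\<exists>c. c \<noteq> 0 \<and> ev Const f c \<in> Q"
proof -
  interpret Q: maximalideal Q "mpoly_ring n" by fact
  interpret phi: ring_map "ev2 f g" by (rule ring_map_ev2)
  note id = Q.is_ideal and cl = ev2_closed[OF fg]
  define q where "q = {e. ev2 f g e \<in> Q}"
  have "\<exists>c. c \<noteq> 0 \<and> [:c:] \<in> q"
  proof (rule maximal_ideal_meets_coefficients)
    show "0 \<in> q" using ideal_mpoly_zero[OF id] by (simp add: q_def phi.h_0)
    show "a + b \<in> q" if "a \<in> q" "b \<in> q" for a b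
      using that ideal_mpoly_add[OF id] by (simp add: q_def phi.h_add)
    show "a * b \<in> q" if "b \<in> q" for a b
      using that ideal_mpoly_mult[OF id _ cl] by (simp add: q_def phi.h_mult)
    show "1 \<notin> q" using Q.I_notcarr Q.one_imp_carrier by (auto simp: q_def phi.h_1)
    fix w assume "w \<notin> q"
    then obtain r where r: "r \<in> carrier (mpoly_ring n)" "ev2 f g w * r - 1 \<in> Q"
      using maximalideal_inverse[OF Q cl] unfolding q_def by blast
    obtain e where e: "r - ev2 f g e \<in> Q" using surj[OF r(1)] by blast
    have "ev2 f g (w * e - 1) = (ev2 f g w * r - 1) - ev2 f g w * (r - ev2 f g e)"
      by (simp add: phi.h_diff phi.h_mult phi.h_1 algebra_simps)
    also have "\<dots> \<in> Q" by (rule ideal_mpoly_diff[OF id r(2) ideal_mpoly_mult[OF id e cl]])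
    finally show "\<exists>e. w * e - 1 \<in> q" unfolding q_def by blast
  qed
  then show ?thesis by (simp add: q_def ev2_const)
qed

lemma ev2_surj_mod:
  fixes Q :: "'k::field mpoly set"
  assumes id: "ideal Q (mpoly_ring n)"
    and fg: "f \<in> carrier (mpoly_ring n)" "g \<in> carrier (mpoly_ring n)"
    and vars: "\<And>i. i \<in> {1..n} \<Longrightarrow> \<exists>a b. Var i - (Const a * f + Const b * g) \<in> Q"
    and s: "s \<in> carrier (mpoly_ring n)"
  shows "\<exists>e. s - ev2 f g e \<in> Q"
  using s
proof (induction s rule: mpoly_induct)
  interpret phi: ring_map "ev2 f g" by (rule ring_map_ev2)
  note cl = ev2_closed[OF fg]
  {
    case (Const c)
    have "ev2 f g [:[:c:]:] = Const c" by (simp add: ev2_const ev_pCons ev_0)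
    then show ?case using ideal_mpoly_zero[OF id] by (metis diff_self)
  next
    case (add p p')
    from add.IH obtain e e' where "p - ev2 f g e \<in> Q" "p' - ev2 f g e' \<in> Q" by blast
    then have "(p - ev2 f g e) + (p' - ev2 f g e') \<in> Q" by (rule ideal_mpoly_add[OF id])
    then show ?case by (intro exI[of _ "e + e'"]) (simp add: phi.h_add algebra_simps)
  next
    case (Var i p)
    from Var.IH obtain e where e: "p - ev2 f g e \<in> Q" by blast
    obtain a b where ab: "Var i - (Const a * f + Const b * g) \<in> Q" using vars Var.hyps by blast
    have e': "ev2 f g [:[:0, a:], [:b:]:] = Const a * f + Const b * g"
      by (simp add: ev2_def ev_pCons ev_0 mult.commute)
    have "Var i * p - ev2 f g ([:[:0, a:], [:b:]:] * e) =
        Var i * (p - ev2 f g e) + ev2 f g e * (Var i - (Const a * f + Const b * g))"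
      by (simp only: phi.h_mult e') (simp add: algebra_simps)
    also have "\<dots> \<in> Q"
      using Var.hyps by (intro ideal_mpoly_add[OF id] ideal_mpoly_mult[OF id] e ab cl mpoly_carrier_Var)
    finally show ?case by blast
  }
qed

section \<open>Leading forms\<close>

definition hc :: "nat \<Rightarrow> 'k::comm_ring_1 mpoly \<Rightarrow> 'k mpoly" where
  "hc d = restr {t. deg t = d}"

lemma lookup_hc: "lookup (hc d p) t = (if deg t = d then lookup p t else 0)"
  by (simp add: hc_def lookup_restr)

lemma keys_hc: "keys (hc d p) = {t \<in> keys p. deg t = d}"
  by (auto simp: hc_def keys_restr)

lemma hc_add: "hc d (p + q) = hc d p + hc d q"
  by (simp add: hc_def restr_add)

lemma hc_diff: "hc d (p - q) = hc d p - hc d q"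
  by (simp add: hc_def restr_diff)

lemma hc_0: "hc d 0 = 0"
  by (rule poly_mapping_eqI) (simp add: lookup_hc)

lemma hc_Const_mult: "hc d (Const c * p) = Const c * hc d p"
  by (rule poly_mapping_eqI) (simp add: lookup_hc lookup_Const_mult)

lemma hc_eq_0: "(\<And>t. t \<in> keys p \<Longrightarrow> deg t \<noteq> d) \<Longrightarrow> hc d p = 0"
  unfolding hc_def by (rule restr_zero) auto

lemma hc_hc: "hc d (hc d p) = hc d p"
  unfolding hc_def by (rule restr_self) (simp add: keys_restr)

lemma hc_carrier: "p \<in> carrier (mpoly_ring n) \<Longrightarrow> hc d p \<in> carrier (mpoly_ring n)"
  unfolding hc_def by (rule restr_carrier)

lemma hc_span_of: "p \<in> span_of U \<Longrightarrow> hc d p \<in> span_of U"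
  by (auto simp: span_of_def keys_hc)

lemma deg_diff_single:
  assumes "lookup u i \<noteq> 0"
  shows "deg u = Suc (deg (u - single i 1))"
  using deg_add[of "single i 1" "u - single i 1"] single_add_diff[OF assms] by (simp add: deg_single)

lemma hc_lin_mult: "hc (Suc d) (lin n c * p) = lin n c * hc d p"
proof (rule poly_mapping_eqI)
  fix u
  have dd: "deg (u - single i 1) = d \<longleftrightarrow> deg u = Suc d" if "lookup u i \<noteq> 0" for i
    using deg_diff_single[OF that] by simp
  show "lookup (hc (Suc d) (lin n c * p)) u = lookup (lin n c * hc d p) u"
    unfolding lookup_hc lookup_lin_mult
    by (cases "deg u = Suc d") (auto simp: dd simp del: One_nat_def intro!: sum.cong sum.neutral)
qed

lemma hc_0_lin_mult: "hc 0 (lin n c * p) = 0"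
proof (rule poly_mapping_eqI)
  fix u
  have "lookup u i = 0" if "deg u = 0" for i
    using that deg_diff_single[of u i] by auto
  then show "lookup (hc 0 (lin n c * p)) u = lookup 0 u"
    by (auto simp: lookup_hc lookup_lin_mult)
qed

lemma hc_lin_power: "hc (a + d) (lin n c ^ a * p) = lin n c ^ a * hc d p"
  by (induction a) (simp_all add: hc_lin_mult mult.assoc)

lemma hc_lin_power_0: "d < a \<Longrightarrow> hc d (lin n c ^ a * p) = 0"
proof (induction a arbitrary: d)
  case (Suc a)
  then show ?case by (cases d) (simp_all add: hc_0_lin_mult hc_lin_mult mult.assoc)
qed simp

definition deg_le :: "nat \<Rightarrow> 'k::comm_ring_1 mpoly \<Rightarrow> bool" where
  "deg_le d p \<longleftrightarrow> (\<forall>t\<in>keys p. deg t \<le> d)"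

lemma deg_le_add: "deg_le d p \<Longrightarrow> deg_le d q \<Longrightarrow> deg_le d (p + q)"
  using keys_add[of p q] by (auto simp: deg_le_def)

lemma deg_le_mono: "deg_le d p \<Longrightarrow> d \<le> e \<Longrightarrow> deg_le e p"
  by (auto simp: deg_le_def)

lemma deg_le_Const_mult: "deg_le d p \<Longrightarrow> deg_le d (Const c * p)"
  by (auto simp: deg_le_def in_keys_iff lookup_Const_mult)

lemma deg_le_lin_mult:
  assumes "deg_le d p"
  shows "deg_le (Suc d) (lin n c * p)"
  unfolding deg_le_def
proof
  fix u assume "u \<in> keys (lin n c * p)"
  then have "(\<Sum>i=1..n. if lookup u i = 0 then 0 else c i * lookup p (u - single i 1)) \<noteq> 0"
    by (simp add: in_keys_iff lookup_lin_mult)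
  then obtain i where "(if lookup u i = 0 then 0 else c i * lookup p (u - single i 1)) \<noteq> 0"
    by (rule sum.not_neutral_contains_not_neutral)
  then have "lookup u i \<noteq> 0" "u - single i 1 \<in> keys p" by (auto simp: in_keys_iff split: if_splits)
  then show "deg u \<le> Suc d" using assms deg_diff_single[of u i] by (simp add: deg_le_def)
qed

text \<open>Only the top power of the form reaches degree \<open>a + d\<close>. Allowing any bound
  \<open>a\<close> on the degree of \<open>p\<close>, with \<open>coeff p a\<close> possibly zero,
  makes the induction uniform.\<close>

lemma leading_form_ev:
  fixes s :: "'k::comm_ring_1 mpoly"
  assumes "deg_le d s"
  shows "degree p \<le> a \<Longrightarrow> deg_le (a + d) (ev Const (lin n c) p * s) \<and>
    hc (a + d) (ev Const (lin n c) p * s) = Const (coeff p a) * (lin n c ^ a * hc d s)"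
proof (induction p arbitrary: a)
  case 0
  then show ?case by (simp add: ev_0 deg_le_def hc_0)
next
  case (pCons x p)
  have e: "ev Const (lin n c) (pCons x p) * s = Const x * s + lin n c * (ev Const (lin n c) p * s)"
    by (simp add: ev_pCons algebra_simps)
  have x: "deg_le d (Const x * s)" using assms by (rule deg_le_Const_mult)
  show ?case
  proof (cases a)
    case 0
    then have "p = 0" using pCons.prems by (auto split: if_splits)
    then show ?thesis using 0 x by (simp add: ev_pCons ev_0 hc_Const_mult)
  next
    case (Suc a')
    then have "degree p \<le> a'" using pCons.prems by (cases "p = 0") auto
    note IH = pCons.IH[OF this]
    have "hc (Suc (a' + d)) (Const x * s) = 0" using x by (intro hc_eq_0) (auto simp: deg_le_def)
    moreover have "deg_le (Suc (a' + d)) (Const x * s)" using x by (rule deg_le_mono) simp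
    ultimately show ?thesis unfolding e
      using IH deg_le_lin_mult[of "a' + d" "ev Const (lin n c) p * s" n c]
      by (simp add: Suc hc_add hc_lin_mult deg_le_add)
  qed
qed

text \<open>Degrees are measured modulo the monomial ideal: only monomials outside \<open>U\<close> count.\<close>
lemma deg_ev_mult_mod:
  fixes s :: "'k::field mpoly"
  assumes U: "monomial_set n U"
    and reg: "\<And>s. s \<in> carrier (mpoly_ring n) \<Longrightarrow> lin n c * s \<in> span_of U \<Longrightarrow> s \<in> span_of U"
    and p: "p \<noteq> 0" and s: "s \<in> carrier (mpoly_ring n)"
    and bound: "\<And>t. t \<in> keys (ev Const (lin n c) p * s) \<Longrightarrow> t \<notin> U \<Longrightarrow> deg t < M"
    and t: "t \<in> keys s" "t \<notin> U"
  shows "deg t + degree p < M"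
proof -
  note id = ideal_span_of[OF U, where 'k = 'k]
  let ?f = "lin n c" and ?F = "ev Const (lin n c) p" and ?a = "degree p"
  define s' where "s' = restr (- U) s"
  have ks: "keys s' = keys s - U" by (auto simp: s'_def keys_restr)
  have F: "?F \<in> carrier (mpoly_ring n)" by (intro ev_closed lin_carrier mpoly_carrier_Const) simp
  define D where "D = Max (deg ` keys s')"
  have D: "D \<in> deg ` keys s'" unfolding D_def using t ks by (intro Max_in) auto
  then obtain t0 where t0: "t0 \<in> keys s'" "deg t0 = D" by auto
  have le: "deg_le D s'" unfolding deg_le_def D_def by auto
  \<comment> \<open>Otherwise the component of \<open>?F * s'\<close> in degree
    \<open>?a + D\<close> has no monomial outside \<open>U\<close>. It is a nonzero constant times
    \<open>?f ^ ?a * hc D s'\<close>, so cancelling \<open>?f\<close> puts the top component of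
    \<open>s'\<close> into the ideal, against the choice of \<open>D\<close>.\<close>
  have "\<not> M \<le> ?a + D"
  proof
    assume M: "M \<le> ?a + D"
    have Fs: "?F * s = ?F * restr U s + ?F * s'"
      unfolding s'_def by (simp flip: distrib_left restr_split)
    have I: "?F * restr U s \<in> span_of U" by (intro ideal_mpoly_mult[OF id span_of_restr] F)
    have "hc (?a + D) (?F * s') \<in> span_of U"
      unfolding span_of_def
    proof (intro CollectI subsetI)
      fix u assume u: "u \<in> keys (hc (?a + D) (?F * s'))"
      show "u \<in> U"
      proof (rule ccontr)
        assume "u \<notin> U"
        then have "lookup (?F * restr U s) u = 0" using I by (auto simp: span_of_def in_keys_iff)
        then have "u \<in> keys (?F * s)" using u by (simp add: Fs in_keys_iff lookup_add lookup_hc split: if_splits)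
        then show False using bound[of u] \<open>u \<notin> U\<close> u M by (auto simp: keys_hc)
      qed
    qed
    then have "Const (lead_coeff p) * (?f ^ ?a * hc D s') \<in> span_of U"
      using leading_form_ev[OF le, of p ?a n c] by simp
    then have "?f ^ ?a * hc D s' \<in> span_of U" using Const_mult_mem_iff[OF id] p by simp
    then have "hc D s' \<in> span_of U"
      using nonzerodivisor_power[OF lin_carrier reg hc_carrier] s
      unfolding s'_def by (blast intro: restr_carrier)
    then have "t0 \<in> U" using t0 by (auto simp: span_of_def keys_hc)
    then show False using t0 ks by auto
  qed
  moreover have "deg t \<le> D" using le t ks by (simp add: deg_le_def)
  ultimately show ?thesis by simp
qed

text \<open>Induction on the degree of \<open>s\<close> outside \<open>U\<close>. In top degree the
  relation makes a power of the second form times the top component of \<open>s\<close> a multiple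
  of a power of the first, modulo the ideal. Regularity of the powers passes this on to the
  component itself, and subtracting a multiple of \<open>ev Const (lin n c) p\<close> with the same
  top component lowers the degree.\<close>

lemma ev_relation_mod:
  fixes s t :: "'k::field mpoly"
  assumes U: "monomial_set n U" and reg: "regular_sequence (mpoly_ring n) (span_of U) [lin n c, lin n d]"
    and p: "p \<noteq> 0" and q: "q \<noteq> 0"
    and st: "s \<in> carrier (mpoly_ring n)" "t \<in> carrier (mpoly_ring n)"
    and rel: "ev Const (lin n c) p * t + ev Const (lin n d) q * s \<in> span_of U"
    and N: "\<And>u. u \<in> keys s \<Longrightarrow> u \<notin> U \<Longrightarrow> deg u < N"
  shows "\<exists>w\<in>carrier (mpoly_ring n). s - ev Const (lin n c) p * w \<in> span_of U"
  using st rel N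
proof (induction N arbitrary: s t)
  case 0
  then have "s \<in> span_of U" by (auto simp: span_of_def)
  then show ?case by (intro bexI[of _ 0]) (simp_all add: mpoly_carrier_zero)
next
  case (Suc N)
  note id = ideal_span_of[OF U, where 'k = 'k]
  let ?f = "lin n c :: 'k mpoly" and ?g = "lin n d :: 'k mpoly"
  let ?F = "ev Const ?f p" and ?G = "ev Const ?g q" and ?a = "degree p" and ?b = "degree q"
  have fc: "?f ^ k \<in> carrier (mpoly_ring n)" "?g ^ k \<in> carrier (mpoly_ring n)" for k
    by (intro mpoly_carrier_power lin_carrier)+
  have F: "?F \<in> carrier (mpoly_ring n)" and G: "?G \<in> carrier (mpoly_ring n)"
    by (intro ev_closed lin_carrier mpoly_carrier_Const, simp)+
  have regf: "s \<in> span_of U" if "s \<in> carrier (mpoly_ring n)" "?f * s \<in> span_of U" for s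
    using reg that unfolding regular_sequence_pair_mpoly[OF id lin_carrier lin_carrier] by blast
  have regg: "s \<in> Idl\<^bsub>mpoly_ring n\<^esub> (span_of U \<union> {?f ^ ?a})"
    if "s \<in> carrier (mpoly_ring n)" "?g ^ ?b * s \<in> Idl\<^bsub>mpoly_ring n\<^esub> (span_of U \<union> {?f ^ ?a})" for s
    using regular_sequence_powers[OF id reg, of ?a ?b] that
    unfolding regular_sequence_pair_mpoly[OF id fc] by blast
  define s' t' where "s' = restr (- U) s" and "t' = restr (- U) t"
  have s'c: "s' \<in> carrier (mpoly_ring n)" and t'c: "t' \<in> carrier (mpoly_ring n)"
    using Suc.prems by (auto simp: s'_def t'_def restr_carrier)
  have sd: "s = restr U s + s'" and td: "t = restr U t + t'"
    unfolding s'_def t'_def by (rule restr_split)+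
  have sle: "deg_le N s'"
    using Suc.prems(4) by (auto simp: deg_le_def s'_def keys_restr less_Suc_eq_le)
  have rel1: "?F * t + ?G * s' \<in> span_of U"
  proof -
    have "?G * s = ?G * restr U s + ?G * s'" by (simp flip: distrib_left sd)
    then have "?F * t + ?G * s' = (?F * t + ?G * s) - ?G * restr U s" by simp
    also have "\<dots> \<in> span_of U"
      by (intro ideal_mpoly_diff[OF id] Suc.prems ideal_mpoly_mult[OF id span_of_restr] G)
    finally show ?thesis .
  qed
  have lead_g: "deg_le (?b + N) (?G * s')"
    "hc (?b + N) (?G * s') = Const (lead_coeff q) * (?g ^ ?b * hc N s')"
    using leading_form_ev[OF sle, of q ?b n d] by auto
  \<comment> \<open>Outside \<open>U\<close> the monomials of \<open>?F * t\<close> must cancel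
    against those of \<open>?G * s'\<close>. This bounds the degree of \<open>t\<close>, so
    \<open>?F * t'\<close> contributes nothing above degree \<open>?b + N\<close>.\<close>
  have tdeg: "deg u + ?a < Suc (?b + N)" if "u \<in> keys t" "u \<notin> U" for u
  proof (rule deg_ev_mult_mod[OF U regf p Suc.prems(2) _ that])
    fix v assume v: "v \<in> keys (?F * t)" "v \<notin> U"
    have "lookup (?F * t + ?G * s') v = 0" using rel1 v(2) by (auto simp: span_of_def in_keys_iff)
    then have "v \<in> keys (?G * s')" using v(1) by (auto simp: in_keys_iff lookup_add)
    then show "deg v < Suc (?b + N)" using lead_g(1) by (auto simp: deg_le_def)
  qed
  have rel2: "?F * t' + ?G * s' \<in> span_of U"
  proof -
    have "?F * t = ?F * restr U t + ?F * t'" by (simp flip: distrib_left td)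
    then have "?F * t' + ?G * s' = (?F * t + ?G * s') - ?F * restr U t" by simp
    also have "\<dots> \<in> span_of U"
      by (intro ideal_mpoly_diff[OF id] rel1 ideal_mpoly_mult[OF id span_of_restr] F)
    finally show ?thesis .
  qed
  \<comment> \<open>In degree \<open>?b + N\<close> the product \<open>?F * t'\<close> is a constant
    times \<open>?f ^ ?a\<close> times a component of \<open>t'\<close>; if that degree is below
    \<open>?a\<close>, the bound forces \<open>t' = 0\<close>.\<close>
  obtain v where v: "v \<in> carrier (mpoly_ring n)" "hc (?b + N) (?F * t') = ?f ^ ?a * v"
  proof (cases "?a \<le> ?b + N")
    case True
    have "deg_le (?b + N - ?a) t'"
      using tdeg True by (fastforce simp: deg_le_def t'_def keys_restr)
    from leading_form_ev[OF this, of p ?a n c]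
    have "hc (?b + N) (?F * t') = ?f ^ ?a * (Const (lead_coeff p) * hc (?b + N - ?a) t')"
      using True by (simp add: mult.left_commute)
    then show ?thesis using that mpoly_carrier_mult[OF mpoly_carrier_Const hc_carrier[OF t'c]] by blast
  next
    case False
    then have "keys t' = {}" using tdeg by (fastforce simp: t'_def keys_restr)
    then have "t' = 0" by simp
    then show ?thesis using that[of 0] by (simp add: mpoly_carrier_zero hc_0)
  qed
  have "hc (?b + N) (?F * t' + ?G * s') \<in> span_of U" using rel2 by (rule hc_span_of)
  then have "?f ^ ?a * v + Const (lead_coeff q) * (?g ^ ?b * hc N s') \<in> span_of U"
    by (simp add: hc_add v(2) lead_g(2))
  then have "Const (lead_coeff q) * (?g ^ ?b * hc N s') \<in> Idl\<^bsub>mpoly_ring n\<^esub> (span_of U \<union> {?f ^ ?a})"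
    unfolding mem_idl_insert_mpoly[OF id fc(1)] using v(1)
    by (intro bexI[of _ "- v"]) (auto simp: mpoly_carrier_uminus add.commute)
  moreover have idJ: "ideal (Idl\<^bsub>mpoly_ring n\<^esub> (span_of U \<union> {?f ^ ?a})) (mpoly_ring n)"
    using fc(1) by (intro ideal_idl_insert_mpoly[OF id]) auto
  ultimately have "?g ^ ?b * hc N s' \<in> Idl\<^bsub>mpoly_ring n\<^esub> (span_of U \<union> {?f ^ ?a})"
    using Const_mult_mem_iff[OF idJ] q by simp
  then have "hc N s' \<in> Idl\<^bsub>mpoly_ring n\<^esub> (span_of U \<union> {?f ^ ?a})" using regg hc_carrier[OF s'c] by blast
  then obtain w0 where w0: "w0 \<in> carrier (mpoly_ring n)" "hc N s' - ?f ^ ?a * w0 \<in> span_of U"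
    unfolding mem_idl_insert_mpoly[OF id fc(1)] by blast
  from hc_span_of[OF w0(2), of N]
  have w1: "hc N s' - hc N (?f ^ ?a * w0) \<in> span_of U" by (simp add: hc_diff hc_hc)
  \<comment> \<open>Take the component of \<open>w0\<close> in degree \<open>N - ?a\<close>, divided
    by the leading coefficient of \<open>p\<close>. For \<open>N < ?a\<close> the component to be
    matched is zero and \<open>w = 0\<close> serves.\<close>
  obtain w where w: "w \<in> carrier (mpoly_ring n)" "deg_le N (?F * w)" "hc N (?F * w) = hc N (?f ^ ?a * w0)"
  proof (cases "?a \<le> N")
    case True
    let ?w = "Const (1 / lead_coeff p) * hc (N - ?a) w0"
    have wle: "deg_le (N - ?a) ?w"
      by (intro deg_le_Const_mult) (auto simp: deg_le_def keys_hc)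
    have "hc (N - ?a) ?w = ?w" unfolding hc_Const_mult by (simp add: hc_hc)
    then have "hc N (?F * ?w) = (Const (lead_coeff p) * Const (1 / lead_coeff p)) * (?f ^ ?a * hc (N - ?a) w0)"
      using leading_form_ev[OF wle, of p ?a n c] True by (simp add: algebra_simps)
    also have "\<dots> = ?f ^ ?a * hc (N - ?a) w0" using p by (simp flip: Const_mult)
    also have "\<dots> = hc N (?f ^ ?a * w0)" using hc_lin_power[of ?a "N - ?a" n c w0] True by simp
    finally have "hc N (?F * ?w) = hc N (?f ^ ?a * w0)" .
    moreover have "deg_le N (?F * ?w)" using leading_form_ev[OF wle, of p ?a n c] True by simp
    ultimately show ?thesis
      using that mpoly_carrier_mult[OF mpoly_carrier_Const hc_carrier[OF w0(1)]] by blast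
  next
    case False
    then show ?thesis using that[of 0]
      by (simp add: hc_lin_power_0 mpoly_carrier_zero hc_0 deg_le_def)
  qed
  define s1 where "s1 = s' - ?F * w"
  have s1c: "s1 \<in> carrier (mpoly_ring n)"
    unfolding s1_def by (intro mpoly_carrier_diff mpoly_carrier_mult s'c F w)
  have t1c: "t' + ?G * w \<in> carrier (mpoly_ring n)"
    by (intro mpoly_carrier_add mpoly_carrier_mult t'c G w)
  \<comment> \<open>Subtracting \<open>?F * w\<close> from \<open>s'\<close> is compensated by
    adding \<open>?G * w\<close> to \<open>t'\<close>, so the relation persists.\<close>
  have "?F * (t' + ?G * w) + ?G * s1 = ?F * t' + ?G * s'" by (simp add: s1_def algebra_simps)
  then have rel3: "?F * (t' + ?G * w) + ?G * s1 \<in> span_of U" using rel2 by simp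
  have s1deg: "deg u < N" if u: "u \<in> keys s1" "u \<notin> U" for u
  proof -
    have "deg u \<le> N" using u(1) keys_diff[of s' "?F * w"] sle w(2) by (auto simp: s1_def deg_le_def)
    moreover have "hc N s1 \<in> span_of U" using w1 w(3) by (simp add: s1_def hc_diff)
    then have "deg u \<noteq> N" using u by (auto simp: span_of_def keys_hc)
    ultimately show ?thesis by simp
  qed
  obtain w' where w': "w' \<in> carrier (mpoly_ring n)" "s1 - ?F * w' \<in> span_of U"
    using Suc.IH[OF s1c t1c rel3 s1deg] by blast
  have "s - ?F * (w + w') = restr U s + (s1 - ?F * w')"
    using sd by (simp add: s1_def algebra_simps)
  also have "\<dots> \<in> span_of U" by (rule ideal_mpoly_add[OF id span_of_restr w'(2)])
  finally show ?case using mpoly_carrier_add[OF w(1) w'(1)] by blast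
qed

lemma regular_sequence_ev:
  fixes U :: "(nat \<Rightarrow>\<^sub>0 nat) set" and p q :: "'k::field poly"
  assumes U: "monomial_set n U" and reg: "regular_sequence (mpoly_ring n) (span_of U) [lin n c, lin n d]"
    and p: "p \<noteq> 0" and q: "q \<noteq> 0"
  shows "regular_sequence (mpoly_ring n) (span_of U) [ev Const (lin n c) p, ev Const (lin n d) q]"
proof -
  note id = ideal_span_of[OF U, where 'k = 'k]
  let ?F = "ev Const (lin n c) p" and ?G = "ev Const (lin n d) q"
  have F: "?F \<in> carrier (mpoly_ring n)" and G: "?G \<in> carrier (mpoly_ring n)"
    by (intro ev_closed lin_carrier mpoly_carrier_Const, simp)+
  have regf: "s \<in> span_of U" if "s \<in> carrier (mpoly_ring n)" "lin n c * s \<in> span_of U" for s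
    using reg that unfolding regular_sequence_pair_mpoly[OF id lin_carrier lin_carrier] by blast
  have 1: "s \<in> span_of U" if s: "s \<in> carrier (mpoly_ring n)" "?F * s \<in> span_of U" for s
  proof (rule ccontr)
    assume "s \<notin> span_of U"
    then obtain t where "t \<in> keys s" "t \<notin> U" by (auto simp: span_of_def)
    \<comment> \<open>The bound \<open>M = 0\<close> is admissible because the product has no
      monomial outside \<open>U\<close>.\<close>
    then have "deg t + degree p < 0"
      using s(2) by (intro deg_ev_mult_mod[OF U regf p s(1)]) (auto simp: span_of_def)
    then show False by simp
  qed
  have 2: "s \<in> Idl\<^bsub>mpoly_ring n\<^esub> (span_of U \<union> {?F})"
    if s: "s \<in> carrier (mpoly_ring n)" "?G * s \<in> Idl\<^bsub>mpoly_ring n\<^esub> (span_of U \<union> {?F})" for s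
  proof -
    obtain r where r: "r \<in> carrier (mpoly_ring n)" "?G * s - ?F * r \<in> span_of U"
      using s(2) unfolding mem_idl_insert_mpoly[OF id F] by blast
    have "?F * (- r) + ?G * s \<in> span_of U" using r(2) by simp
    moreover have "deg u < Suc (Max (deg ` keys s))" if "u \<in> keys s" for u
      using that by (simp add: less_Suc_eq_le)
    ultimately show ?thesis
      unfolding mem_idl_insert_mpoly[OF id F]
      using ev_relation_mod[OF U reg p q s(1) mpoly_carrier_uminus[OF r(1)]] by blast
  qed
  show ?thesis unfolding regular_sequence_pair_mpoly[OF id F G] using 1 2 by simp
qed

section \<open>Dimension two\<close>

lemma prime_chain_mono: "prime_chain R k P \<Longrightarrow> j \<le> k \<Longrightarrow> prime_chain R j P"
  by (auto simp: prime_chain_def)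

lemma krull_dim_obtain_chain:
  assumes "krull_dim R = enat (Suc k)"
  obtains P where "prime_chain R (Suc k) P"
proof -
  have "\<exists>j P. j \<ge> Suc k \<and> prime_chain R j P"
  proof (rule ccontr)
    assume "\<not> ?thesis"
    then have "krull_dim R \<le> enat k"
      unfolding krull_dim_def by (intro Sup_least) (auto simp: not_le less_Suc_eq_le)
    then show False using assms by simp
  qed
  then show ?thesis using that prime_chain_mono by blast
qed

lemma prime_chain_le_krull_dim: "prime_chain R k P \<Longrightarrow> enat k \<le> krull_dim R"
  unfolding krull_dim_def by (rule Sup_upper) auto

lemma regular_sequence_prefix:
  assumes "regular_sequence R J (xs @ ys)"
  shows "regular_sequence R J xs"
  unfolding regular_sequence_def
proof (intro conjI allI impI)
  show "set xs \<subseteq> carrier R" using assms by (simp add: regular_sequence_def)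
  fix i assume i: "i < length xs"
  then have "take i (xs @ ys) = take i xs" "(xs @ ys) ! i = xs ! i" by (simp_all add: nth_append)
  moreover have "i < length (xs @ ys)" using i by simp
  ultimately show "colon_ideal R (Idl\<^bsub>R\<^esub> (J \<union> set (take i xs))) (xs ! i) = Idl\<^bsub>R\<^esub> (J \<union> set (take i xs))"
    using assms unfolding regular_sequence_def by metis
qed

lemma primeideal_mpolyD:
  fixes P :: "'k::comm_ring_1 mpoly set"
  assumes "primeideal P (mpoly_ring n)"
  shows "ideal P (mpoly_ring n)" "1 \<notin> P"
    "\<And>a b. a \<in> carrier (mpoly_ring n) \<Longrightarrow> b \<in> carrier (mpoly_ring n) \<Longrightarrow> a * b \<in> P \<Longrightarrow> a \<in> P \<or> b \<in> P"
proof -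
  interpret P: primeideal P "mpoly_ring n" by fact
  show "ideal P (mpoly_ring n)" by (rule P.is_ideal)
  show "1 \<notin> P" using P.I_notcarr P.one_imp_carrier by auto
  show "\<And>a b. a \<in> carrier (mpoly_ring n) \<Longrightarrow> b \<in> carrier (mpoly_ring n) \<Longrightarrow> a * b \<in> P \<Longrightarrow> a \<in> P \<or> b \<in> P"
    using P.I_prime by simp
qed

lemma primeideal_mpoly_root:
  fixes P :: "'k::comm_ring_1 mpoly set"
  assumes P: "primeideal P (mpoly_ring n)" and a: "a \<in> carrier (mpoly_ring n)" "a ^ k \<in> P"
  shows "a \<in> P"
  using a
proof (induction k)
  case (Suc k)
  then show ?case using primeideal_mpolyD(3)[OF P, of a "a ^ k"] by (auto intro: mpoly_carrier_power)
qed (use primeideal_mpolyD(2)[OF P] in simp)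

text \<open>A prime ideal that contains all variables but one contracts to a univariate polynomial ring.\<close>
lemma no_prime_chain_of_one_variable:
  fixes P :: "nat \<Rightarrow> 'k::field mpoly set" and x :: "'k mpoly"
  assumes ch: "prime_chain (mpoly_ring n) 2 P" and x: "x \<in> carrier (mpoly_ring n)"
    and vars: "\<And>i. i \<in> {1..n} \<Longrightarrow> Var i \<in> P 0 \<or> Var i = x"
  shows False
proof -
  have pr: "primeideal (P 0) (mpoly_ring n)" "primeideal (P 1) (mpoly_ring n)" "primeideal (P 2) (mpoly_ring n)"
    and lt: "P 0 \<subset> P 1" "P 1 \<subset> P 2"
    using ch by (auto simp: prime_chain_def numeral_2_eq_2)
  note D0 = primeideal_mpolyD[OF pr(1)] and D1 = primeideal_mpolyD[OF pr(2)] and D2 = primeideal_mpolyD[OF pr(3)]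
  note id0 = D0(1) and id1 = D1(1) and id2 = D2(1)
  have cl: "ev Const x c \<in> carrier (mpoly_ring n)" for c
    by (intro ev_closed x mpoly_carrier_Const) simp
  note evs = Const.ev_add Const.ev_mult ring_map.h_diff[OF Const.ring_map_ev] ring_map.h_1[OF Const.ring_map_ev]
  \<comment> \<open>Modulo \<open>P 0\<close> every polynomial is one in \<open>x\<close>, so the
    higher primes are determined by their preimages in \<open>K[x]\<close>.\<close>
  have surj: "\<exists>c. s - ev Const x c \<in> P 0" if "s \<in> carrier (mpoly_ring n)" for s
    using that
  proof (induction s rule: mpoly_induct)
    case (Const a)
    have "ev Const x [:a:] = Const a" by (simp add: ev_pCons ev_0)
    then show ?case using ideal_mpoly_zero[OF id0] by (metis diff_self)
  next
    case (add p q)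
    then obtain c d where "p - ev Const x c \<in> P 0" "q - ev Const x d \<in> P 0" by blast
    then have "(p - ev Const x c) + (q - ev Const x d) \<in> P 0" by (rule ideal_mpoly_add[OF id0])
    then show ?case by (intro exI[of _ "c + d"]) (simp add: evs algebra_simps)
  next
    case (Var i p)
    then obtain c where c: "p - ev Const x c \<in> P 0" by blast
    have V: "(Var i :: 'k mpoly) \<in> carrier (mpoly_ring n)" using Var.hyps by (intro mpoly_carrier_Var)
    from vars[OF Var.hyps(1)] show ?case
    proof
      assume "Var i \<in> P 0"
      then have "p * Var i \<in> P 0" using Var.hyps by (intro ideal_mpoly_mult[OF id0])
      then show ?thesis by (intro exI[of _ 0]) (simp add: ev_0 mult.commute)
    next
      assume i: "Var i = x"
      have "Var i * (p - ev Const x c) \<in> P 0" using c V by (rule ideal_mpoly_mult[OF id0])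
      then show ?thesis by (intro exI[of _ "pCons 0 c"]) (simp add: ev_pCons i algebra_simps)
    qed
  qed
  define p q where "p = {c. ev Const x c \<in> P 1}" and "q = {c. ev Const x c \<in> P 2}"
  obtain g where g: "g \<in> P 1" "g \<notin> P 0" using lt by blast
  obtain c where c: "g - ev Const x c \<in> P 0" using surj ideal_mpoly_carrier[OF id1 g(1)] by blast
  have le: "P 0 \<subseteq> P 1" "P 1 \<subseteq> P 2" using lt by (simp_all add: psubset_imp_subset)
  have "g - (g - ev Const x c) \<in> P 1" by (rule ideal_mpoly_diff[OF id1 g(1) subsetD[OF le(1) c]])
  then have cp: "c \<in> p" by (simp add: p_def)
  \<comment> \<open>Strictness of \<open>P 0 \<subset> P 1\<close> makes the contraction
    \<open>p\<close> nonzero, hence maximal, which leaves no room for a larger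
    \<open>q\<close>.\<close>
  have c0: "c \<noteq> 0" using c g by (auto simp: ev_0)
  have "q \<subseteq> p"
  proof (rule prime_chain_univariate[OF _ _ _ _ _ _ cp c0])
    show "b * a \<in> p" if "a \<in> p" for a b
      using that ideal_mpoly_mult[OF id1 _ cl] by (simp add: p_def evs)
    show "a \<in> p \<or> b \<in> p" if "a * b \<in> p" for a b
      using that D1(3)[OF cl cl] by (simp add: p_def evs)
    show "a - b \<in> q" if "a \<in> q" "b \<in> q" for a b
      using that ideal_mpoly_diff[OF id2] by (simp add: q_def evs)
    show "b * a \<in> q" if "a \<in> q" for a b
      using that ideal_mpoly_mult[OF id2 _ cl] by (simp add: q_def evs)
    show "1 \<notin> q" using D2(2) by (simp add: q_def evs)
    show "p \<subseteq> q" unfolding p_def q_def using le(2) by (intro Collect_mono impI) (rule subsetD)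
  qed
  obtain y where y: "y \<in> P 2" "y \<notin> P 1" using lt by blast
  obtain d where d: "y - ev Const x d \<in> P 0" using surj ideal_mpoly_carrier[OF id2 y(1)] by blast
  have "y - (y - ev Const x d) \<in> P 2"
    by (rule ideal_mpoly_diff[OF id2 y(1) subsetD[OF le(2) subsetD[OF le(1) d]]])
  then have "d \<in> q" by (simp add: q_def)
  then have "ev Const x d \<in> P 1" using \<open>q \<subseteq> p\<close> by (auto simp: p_def)
  then have "(y - ev Const x d) + ev Const x d \<in> P 1"
    by (rule ideal_mpoly_add[OF id1 subsetD[OF le(1) d]])
  then show False using y by simp
qed

text \<open>A polynomial outside has a nonzero constant term, a unit that differs from the
  polynomial by a member of the ideal.\<close>

lemma maximalideal_irrelevant: "maximalideal (irrelevant_ideal n :: 'k::field mpoly set) (mpoly_ring n)"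
proof (rule maximalidealI)
  note pr = primeideal_mpolyD[OF primeideal_var_prime[of n "{}", where 'k = 'k]]
  show "ideal (irrelevant_ideal n :: 'k mpoly set) (mpoly_ring n)" unfolding irrelevant_ideal_eq by (rule pr)
  show "carrier (mpoly_ring n) \<noteq> (irrelevant_ideal n :: 'k mpoly set)"
    unfolding irrelevant_ideal_eq using pr(2) mpoly_carrier_one by blast
  fix J :: "'k mpoly set"
  assume J: "ideal J (mpoly_ring n)" "irrelevant_ideal n \<subseteq> J" "J \<subseteq> carrier (mpoly_ring n)"
  show "J = irrelevant_ideal n \<or> J = carrier (mpoly_ring n)"
  proof (cases "J \<subseteq> irrelevant_ideal n")
    case False
    then obtain a where a: "a \<in> J" "a \<notin> irrelevant_ideal n" by blast
    then have "0 \<in> keys a"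
      using subsetD[OF J(3)] by (fastforce simp: irrelevant_ideal_eq var_prime_def span_of_def mem_carrier_mpoly)
    then have c: "lookup a 0 \<noteq> 0" by (simp add: in_keys_iff)
    have "keys (a - Const (lookup a 0)) \<subseteq> keys a - {0}"
      by (auto simp: in_keys_iff lookup_minus Const_def lookup_single when_def split: if_splits)
    moreover have "keys t \<subseteq> {1..n}" if "t \<in> keys a" for t
      using that a(1) J(3) by (auto simp only: mem_carrier_mpoly subset_iff)
    ultimately have "a - Const (lookup a 0) \<in> irrelevant_ideal n"
      unfolding irrelevant_ideal_eq var_prime_def span_of_def by auto
    then have "a - (a - Const (lookup a 0)) \<in> J" by (rule ideal_mpoly_diff[OF J(1) a(1) subsetD[OF J(2)]])
    then have "Const (lookup a 0) * 1 \<in> J" by simp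
    then have "1 \<in> J" using Const_mult_mem_iff[OF J(1) c] by blast
    then have "J = carrier (mpoly_ring n)" using ideal.one_imp_carrier[OF J(1)] by simp
    then show ?thesis ..
  qed (use J in blast)
qed

locale two_dimensional =
  fixes n :: nat and U :: "(nat \<Rightarrow>\<^sub>0 nat) set" and I :: "'k::field_char_0 mpoly set"
  assumes U: "monomial_set n U" and I_eq: "I = span_of U"
    and dim: "krull_dim (mpoly_ring n Quot I) = 2"
begin

abbreviation "f1 \<equiv> lin n of_nat :: 'k mpoly"
abbreviation "f2 \<equiv> lin n (\<lambda>j. of_nat (j - 1)) :: 'k mpoly"

sublocale ideal I "mpoly_ring n" unfolding I_eq by (rule ideal_span_of[OF U])

sublocale S: cring "mpoly_ring n :: 'k mpoly ring" by (rule cring_mpoly_ring)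

lemma I_subset_var_prime:
  assumes "primeideal P (mpoly_ring n)" "I \<subseteq> P"
  shows "I \<subseteq> var_prime n {i \<in> {1..n}. Var i \<notin> P}"
  using span_of_subset_var_prime[OF U] assms unfolding I_eq by blast

lemma obtain_chain:
  obtains P where "prime_chain (mpoly_ring n) 2 P" "I \<subseteq> P 0"
proof -
  have "krull_dim (mpoly_ring n Quot I) = enat (Suc 1)" using dim by (simp add: numeral_eq_enat)
  then obtain P where "prime_chain (mpoly_ring n Quot I) 2 P"
    using krull_dim_obtain_chain by (metis Suc_1)
  from lift_prime_chain[OF cring_mpoly_ring this] show ?thesis using that by blast
qed

text \<open>Enlarge the variable prime below some prime over \<open>I\<close> to the ideal of all
  variables; the existence of a chain supplies that prime.\<close>

lemma I_subset_irrelevant: "I \<subseteq> irrelevant_ideal n"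
proof -
  obtain P where P: "prime_chain (mpoly_ring n) 2 P" "I \<subseteq> P 0" by (rule obtain_chain)
  then have "I \<subseteq> var_prime n {i \<in> {1..n}. Var i \<notin> P 0}"
    by (intro I_subset_var_prime) (auto simp: prime_chain_def)
  also have "\<dots> \<subseteq> var_prime n {}" by (auto simp: var_prime_def span_of_def)
  finally show ?thesis by (simp add: irrelevant_ideal_eq)
qed

lemma var_prime_chain:
  assumes "{i, j} \<subseteq> {1..n}" "i \<noteq> j"
  shows "prime_chain (mpoly_ring n) 2
    (\<lambda>m. if m = 0 then var_prime n {i, j} else if m = 1 then var_prime n {i} else irrelevant_ideal n :: 'k mpoly set)"
  using assms unfolding prime_chain_def irrelevant_ideal_eq
  by (auto simp: primeideal_var_prime numeral_2_eq_2 less_Suc_eq intro!: var_prime_psubset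
      dest: subsetD)

text \<open>If no power of the product were in \<open>I\<close>, then \<open>I\<close> would lie in
  \<open>var_prime n {i, j, k}\<close>, and dropping one index at a time would give a chain of
  length three.\<close>

lemma triple_product_in_radical:
  assumes "i \<in> {1..n}" "j \<in> {1..n}" "k \<in> {1..n}" "card {i, j, k} = 3"
  shows "Var i * Var j * Var k \<in> radical_ideal (mpoly_ring n) I"
proof -
  have d: "i \<noteq> j" "i \<noteq> k" "j \<noteq> k" using assms(4) by (auto simp: card_insert_if split: if_splits)
  have "\<not> I \<subseteq> var_prime n {i, j, k}"
  proof
    assume sub: "I \<subseteq> var_prime n {i, j, k}"
    let ?P = "case_nat (var_prime n {i, j, k})
      (\<lambda>m. if m = 0 then var_prime n {i, j} else if m = 1 then var_prime n {i} else irrelevant_ideal n :: 'k mpoly set)"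
    have "(var_prime n {i, j, k} :: 'k mpoly set) \<subset> var_prime n {i, j}"
      using assms d by (intro var_prime_psubset) auto
    then have "prime_chain (mpoly_ring n) 3 ?P"
      using var_prime_chain[of i j] assms d
      unfolding prime_chain_def numeral_3_eq_3 numeral_2_eq_2
      by (auto simp: primeideal_var_prime less_Suc_eq_le[symmetric] All_less_Suc2 simp del: less_Suc_eq_le)
    then have "prime_chain (mpoly_ring n Quot I) 3 (\<lambda>m. proj ` ?P m)"
      using sub by (intro image_prime_chain cring_mpoly_ring) auto
    then have "enat 3 \<le> krull_dim (mpoly_ring n Quot I)" by (rule prime_chain_le_krull_dim)
    then show False using dim by (simp add: numeral_eq_enat)
  qed
  then have "(\<Prod>i\<in>{i, j, k}. Var i) \<in> radical_ideal (mpoly_ring n) I"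
    using assms unfolding I_eq by (intro prod_Var_in_radical U) auto
  then show ?thesis using d by (simp add: mult.assoc)
qed

lemma system_of_parameters_forms: "system_of_parameters n I [f1, f2]"
  unfolding system_of_parameters_def
proof (intro conjI)
  show c: "set [f1, f2] \<subseteq> carrier (mpoly_ring n)" by (simp add: lin_carrier)
  show "\<forall>f\<in>set [f1, f2]. homogeneous f" using homogeneous_lin by auto
  show "krull_dim (mpoly_ring n Quot I) = enat (length [f1, f2])" using dim by (simp add: numeral_eq_enat)
  let ?J = "Idl\<^bsub>mpoly_ring n\<^esub> (I \<union> set [f1, f2])"
  let ?A = "radical_ideal (mpoly_ring n) ?J"
  note J = ideal_idl_insert_mpoly[OF is_ideal c]
  note A = radical_ideal_mpoly[OF J(1)]
  have IA: "radical_ideal (mpoly_ring n) I \<subseteq> ?A" using J(2) by (auto simp: radical_ideal_def)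
  have f: "f1 \<in> ?A" "f2 \<in> ?A" using J(3) A(2) by auto
  have "Var i \<in> ?A" if "i \<in> {1..n}" for i
    using that IA triple_product_in_radical
    by (intro Var_mem_of_pairs[OF A(1,3) f(1)] pairs_mem_of_triples[OF A(1,3) f]) blast+
  then have "irrelevant_ideal n \<subseteq> ?A" unfolding irrelevant_ideal_def by (intro genideal_minimal[OF A(1)]) auto
  moreover have "?A \<subseteq> irrelevant_ideal n"
  proof
    fix a assume "a \<in> ?A"
    then obtain k where k: "a \<in> carrier (mpoly_ring n)" "a ^ k \<in> ?J" by (auto simp: radical_ideal_def)
    have pr: "primeideal (irrelevant_ideal n :: 'k mpoly set) (mpoly_ring n)"
      unfolding irrelevant_ideal_eq by (rule primeideal_var_prime)
    note id = primeideal_mpolyD(1)[OF pr]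
    have V: "Var i \<in> irrelevant_ideal n" if "i \<in> {1..n}" for i
      using that by (simp add: irrelevant_ideal_eq Var_mem_var_prime)
    have "lin n c \<in> irrelevant_ideal n" for c :: "nat \<Rightarrow> 'k"
      unfolding lin_def by (intro ideal_mpoly_sum[OF id] ideal_mpoly_mult[OF id] V mpoly_carrier_Const)
    then have "?J \<subseteq> irrelevant_ideal n" using I_subset_irrelevant by (intro genideal_minimal[OF id]) auto
    then show "a \<in> irrelevant_ideal n" using primeideal_mpoly_root[OF pr k(1)] k(2) by blast
  qed
  ultimately show "?A = irrelevant_ideal n" by blast
qed

text \<open>\<open>Q\<close> contains all triple products, so at most two variables survive modulo
  \<open>Q\<close>. If none but possibly \<open>Var i\<close> survives, \<open>f1\<close> reduces to
  \<open>i\<close> times \<open>Var i\<close>; if \<open>Var i\<close> and \<open>Var j\<close>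
  survive, eliminating \<open>Var j\<close> leaves \<open>i - j\<close> times
  \<open>Var i\<close>.\<close>

lemma Var_mod_maximal:
  assumes Q: "maximalideal Q (mpoly_ring n)" "I \<subseteq> Q" and i: "i \<in> {1..n}"
  shows "\<exists>a b. Var i - (Const a * f1 + Const b * f2) \<in> Q"
proof -
  have pr: "primeideal Q (mpoly_ring n)" by (rule S.maximalideal_prime[OF Q(1)])
  note D = primeideal_mpolyD[OF pr]
  note id = D(1)
  have triples: "Var i * Var j * Var k \<in> Q"
    if "i \<in> {1..n}" "j \<in> {1..n}" "k \<in> {1..n}" "card {i, j, k} = 3" for i j k
    using triple_product_in_radical[OF that] Q(2) primeideal_mpoly_root[OF pr] by (auto simp: radical_ideal_def)
  have scale: "\<exists>a b. Var i - (Const a * f1 + Const b * f2) \<in> Q"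
    if "Const \<alpha> * f1 + Const \<beta> * f2 - Const \<gamma> * Var i \<in> Q" "\<gamma> \<noteq> 0" for \<alpha> \<beta> \<gamma>
  proof -
    have "Const (- 1 / \<gamma>) * (Const \<alpha> * f1 + Const \<beta> * f2 - Const \<gamma> * Var i) \<in> Q"
      using that(1) by (rule ideal_mpoly_mult[OF id _ mpoly_carrier_Const])
    moreover have "Const (- 1 / \<gamma>) * Const \<alpha> = - Const (\<alpha> / \<gamma>)"
      "Const (- 1 / \<gamma>) * Const \<beta> = - Const (\<beta> / \<gamma>)" "Const (- 1 / \<gamma>) * Const \<gamma> = - 1"
      using that(2) Const.h_uminus[of "1 :: 'k"] by (simp_all flip: Const_mult Const.h_uminus)
    then have "Const (- 1 / \<gamma>) * (Const \<alpha> * f1 + Const \<beta> * f2 - Const \<gamma> * Var i) =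
        Var i - (Const (\<alpha> / \<gamma>) * f1 + Const (\<beta> / \<gamma>) * f2)"
      by (simp add: distrib_left right_diff_distrib flip: mult.assoc)
    ultimately show ?thesis by auto
  qed
  show ?thesis
  proof (cases "\<exists>j\<in>{1..n}. j \<noteq> i \<and> Var j \<notin> Q")
    case False
    have "1 * f1 - Const (of_nat i) * (1 * Var i) \<in> Q"
      using False by (intro lin_mod[OF id i]) auto
    then show ?thesis using scale[of 1 0 "of_nat i"] i by simp
  next
    case True
    then obtain j where j: "j \<in> {1..n}" "j \<noteq> i" "Var j \<notin> Q" by blast
    show ?thesis
    proof (cases "Var i \<in> Q")
      case True
      then show ?thesis by (intro exI[of _ 0]) simp
    next
      case False
      have "Var k \<in> Q" if "k \<in> {1..n}" "k \<noteq> i" "k \<noteq> j" for k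
      proof -
        have "card {i, j, k} = 3" using that j by auto
        then have "(Var i * Var j) * Var k \<in> Q" using triples i j that by blast
        moreover have "(Var i :: 'k mpoly) \<in> carrier (mpoly_ring n)" "(Var j :: 'k mpoly) \<in> carrier (mpoly_ring n)"
          "(Var k :: 'k mpoly) \<in> carrier (mpoly_ring n)"
          using i j(1) that(1) by (simp_all only: mpoly_carrier_Var)
        ultimately show ?thesis
          using D(3)[of "Var i * Var j" "Var k"] D(3)[of "Var i" "Var j"] False j(3) mpoly_carrier_mult by blast
      qed
      then have "1 * lin n (\<lambda>k. of_nat k - of_nat j) - Const (of_nat i - of_nat j) * (1 * Var i) \<in> Q"
        by (intro lin_mod[OF id i]) auto
      then have "Const (- of_nat (j - 1)) * f1 + Const (of_nat j) * f2 - Const (of_nat i - of_nat j) * Var i \<in> Q"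
        by (simp add: Const.h_uminus flip: lin_eliminate[OF j(1)])
      then show ?thesis by (rule scale) (use j in simp)
    qed
  qed
qed

lemma maximalideal_contains_regular_pair:
  assumes Q: "maximalideal Q (mpoly_ring n)" "I \<subseteq> Q" and reg: "regular_sequence (mpoly_ring n) I [f1, f2]"
  obtains g1 g2 where "g1 \<in> Q" "g2 \<in> Q" "regular_sequence (mpoly_ring n) I [g1, g2]"
proof -
  have id: "ideal Q (mpoly_ring n)" using Q(1) by (simp add: maximalideal_def)
  note vars = Var_mod_maximal[OF Q]
  have "\<exists>e. s - ev2 f1 f2 e \<in> Q" if "s \<in> carrier (mpoly_ring n)" for s
    by (rule ev2_surj_mod[OF id lin_carrier lin_carrier vars that])
  then obtain p where p: "p \<noteq> 0" "ev Const f1 p \<in> Q"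
    using maximalideal_contains_univariate[OF Q(1) lin_carrier lin_carrier] by blast
  \<comment> \<open>The univariate polynomial obtained is always in the first argument of
    \<open>ev2\<close>, so the forms exchange roles.\<close>
  have "\<exists>a b. Var i - (Const a * f2 + Const b * f1) \<in> Q" if "i \<in> {1..n}" for i
    using vars[OF that] by (metis add.commute)
  then have "\<exists>e. s - ev2 f2 f1 e \<in> Q" if "s \<in> carrier (mpoly_ring n)" for s
    using ev2_surj_mod[OF id lin_carrier lin_carrier _ that] by blast
  then obtain q where q: "q \<noteq> 0" "ev Const f2 q \<in> Q"
    using maximalideal_contains_univariate[OF Q(1) lin_carrier lin_carrier] by blast
  show ?thesis using that[OF p(2) q(2)] regular_sequence_ev[OF U reg[unfolded I_eq] p(1) q(1)] I_eq by blast
qed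

lemma cohen_macaulay_if_regular:
  assumes reg: "regular_sequence (mpoly_ring n) I [f1, f2]"
  shows "cohen_macaulay_ring (mpoly_ring n Quot I)"
  unfolding cohen_macaulay_ring_def
proof (intro conjI allI impI)
  show c: "cring (mpoly_ring n Quot I)" by (rule quotient_is_cring[OF cring_mpoly_ring])
  show "noetherian_ring (mpoly_ring n Quot I)" by (rule noetherian_quotient[OF noetherian_mpoly_ring])
  fix Q assume Q: "maximalideal Q (mpoly_ring n Quot I)"
  let ?T = "mpoly_ring n Quot I"
  have idQ: "ideal Q ?T" using Q by (simp add: maximalideal_def)
  obtain g1 g2 where g: "g1 \<in> lift_ideal Q" "g2 \<in> lift_ideal Q" "regular_sequence (mpoly_ring n) I [g1, g2]"
    using maximalideal_contains_regular_pair[OF lift_maximal[OF Q] lift_ideal(2)[OF idQ] reg] by blast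
  have "regular_sequence ?T {\<zero>\<^bsub>?T\<^esub>} (map proj [g1, g2])"
    using g by (subst regular_sequence_quotient) (auto simp: lift_ideal_def)
  moreover have "set (map proj [g1, g2]) \<subseteq> Q" using g by (auto simp: lift_ideal_def)
  ultimately have "enat (length (map proj [g1, g2])) \<le> ideal_depth ?T Q"
    unfolding ideal_depth_def by (intro Sup_upper) blast
  then have "2 \<le> ideal_depth ?T Q" by (simp add: numeral_eq_enat numeral_2_eq_2)
  moreover have "ideal_depth ?T Q \<le> prime_height ?T Q"
    by (rule cring.ideal_depth_le_prime_height[OF c cring.maximalideal_prime[OF c Q]])
  moreover have "prime_height ?T Q \<le> 2" using prime_height_le_krull_dim[of ?T Q] dim by simp
  ultimately show "ideal_depth ?T Q = prime_height ?T Q" by order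
qed

text \<open>The bottom of a chain of length two over \<open>I\<close> must miss two variables, since
  otherwise its quotient would be generated by one element and have dimension at most one. These two
  variables yield a chain of variable primes over \<open>I\<close> ending at the irrelevant
  ideal.\<close>

lemma irrelevant_height: "2 \<le> prime_height (mpoly_ring n Quot I) (proj ` irrelevant_ideal n)"
proof -
  obtain P where P: "prime_chain (mpoly_ring n) 2 P" "I \<subseteq> P 0" by (rule obtain_chain)
  have pr: "primeideal (P 0) (mpoly_ring n)" using P by (auto simp: prime_chain_def)
  let ?F = "{i \<in> {1..n}. Var i \<notin> P 0}"
  have "\<exists>i\<in>?F. \<exists>j\<in>?F. i \<noteq> j"
  proof (rule ccontr)
    assume *: "\<not> ?thesis"
    show False
    proof (cases "?F = {}")
      case True
      then show False by (intro no_prime_chain_of_one_variable[OF P(1) mpoly_carrier_zero]) blast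
    next
      case False
      then obtain a where a: "a \<in> ?F" by blast
      have "Var i \<in> P 0 \<or> Var i = (Var a :: 'k mpoly)" if "i \<in> {1..n}" for i
        using * a that by (cases "i = a") auto
      then show False using a by (intro no_prime_chain_of_one_variable[OF P(1) mpoly_carrier_Var]) auto
    qed
  qed
  then obtain i j where ij: "i \<in> ?F" "j \<in> ?F" "i \<noteq> j" by blast
  let ?P = "\<lambda>m::nat. if m = 0 then var_prime n {i, j} else if m = 1 then var_prime n {i} else irrelevant_ideal n :: 'k mpoly set"
  have "I \<subseteq> var_prime n ?F" by (rule I_subset_var_prime[OF pr P(2)])
  also have "\<dots> \<subseteq> var_prime n {i, j}" using ij by (auto simp: var_prime_def span_of_def)
  finally have "prime_chain (mpoly_ring n Quot I) 2 (\<lambda>m. proj ` ?P m)"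
    using ij by (intro image_prime_chain cring_mpoly_ring var_prime_chain) auto
  then have "enat 2 \<le> prime_height (mpoly_ring n Quot I) (proj ` irrelevant_ideal n)"
    unfolding prime_height_def
    by (intro Sup_upper CollectI exI[of _ "2::nat"] exI[of _ "\<lambda>m. proj ` ?P m"] conjI) simp_all
  then show ?thesis by (simp add: numeral_eq_enat)
qed

lemma regular_if_cohen_macaulay:
  assumes "cohen_macaulay_ring (mpoly_ring n Quot I)"
  shows "regular_sequence (mpoly_ring n) I [f1, f2]"
proof -
  let ?T = "mpoly_ring n Quot I" and ?m = "irrelevant_ideal n :: 'k mpoly set"
  have "maximalideal (proj ` ?m) ?T" by (rule image_maximal[OF maximalideal_irrelevant I_subset_irrelevant])
  then have "2 \<le> ideal_depth ?T (proj ` ?m)"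
    using assms irrelevant_height unfolding cohen_macaulay_ring_def by simp
  \<comment> \<open>A supremum of at least two needs a single sequence of length at least two; its
    first two members are what is used.\<close>
  have "\<exists>xs. set xs \<subseteq> proj ` ?m \<and> regular_sequence ?T {\<zero>\<^bsub>?T\<^esub>} xs \<and> 2 \<le> length xs"
  proof (rule ccontr)
    assume "\<not> ?thesis"
    then have "ideal_depth ?T (proj ` ?m) \<le> enat 1"
      unfolding ideal_depth_def by (intro Sup_least) (auto simp: not_le)
    with \<open>2 \<le> ideal_depth ?T (proj ` ?m)\<close> have "2 \<le> enat 1" by (rule order_trans)
    then show False by (simp add: numeral_eq_enat)
  qed
  then obtain ws where ws: "set ws \<subseteq> proj ` ?m" "regular_sequence ?T {\<zero>\<^bsub>?T\<^esub>} ws" "2 \<le> length ws"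
    by blast
  then obtain x y zs where "ws = x # y # zs" by (auto simp: numeral_2_eq_2 Suc_le_length_iff)
  with ws have xs: "set (x # y # zs) \<subseteq> proj ` ?m" "regular_sequence ?T {\<zero>\<^bsub>?T\<^esub>} (x # y # zs)"
    by (simp_all only:)
  have "regular_sequence ?T {\<zero>\<^bsub>?T\<^esub>} [x, y]"
    by (rule regular_sequence_prefix[where ys = zs]) (use xs(2) in \<open>simp only: append.simps\<close>)
  moreover have "x \<in> proj ` ?m" "y \<in> proj ` ?m" using xs(1) by simp_all
  then obtain g h where gh: "g \<in> ?m" "h \<in> ?m" "x = proj g" "y = proj h" by blast
  moreover have "g \<in> carrier (mpoly_ring n)" "h \<in> carrier (mpoly_ring n)"
    using gh(1,2) ideal_mpoly_carrier[OF maximalideal.axioms(1)[OF maximalideal_irrelevant]] by blast+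
  ultimately have "regular_sequence (mpoly_ring n) I [g, h]"
    using regular_sequence_quotient[of "[g, h]"] by simp
  then show ?thesis using linear_forms_regular[OF U gh(1,2)] unfolding I_eq by blast
qed

end

theorem corollary3p7:
  fixes n :: nat and I :: "'k::field_char_0 mpoly set" and f1 f2 :: "'k mpoly"
  assumes "monomial_ideal n I"
    and "krull_dim (mpoly_ring n Quot I) = 2"
    and "f1 = (\<Sum>i=1..n. of_nat i * Var i)"
    and "f2 = (\<Sum>i=2..n. of_nat (i - 1) * Var i)"
  shows "system_of_parameters n I [f1, f2] \<and>
         (cohen_macaulay_ring (mpoly_ring n Quot I) \<longleftrightarrow>
          regular_sequence (mpoly_ring n) I [f1, f2])"
proof -
  obtain U where U: "monomial_set n U" "I = span_of U" using monomial_ideal_span_of[OF assms(1)] .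
  interpret two_dimensional n U I using U assms(2) by unfold_locales
  have f1: "f1 = lin n of_nat" by (simp add: assms(3) lin_def Const_of_nat)
  \<comment> \<open>The term of index \<open>1\<close> has coefficient \<open>0\<close>, so starting
    the sum at \<open>2\<close> changes nothing.\<close>
  have "lin n (\<lambda>j. of_nat (j - 1)) = (\<Sum>i=2..n. Const (of_nat (i - 1)) * Var i :: 'k mpoly)"
    unfolding lin_def
  proof (rule sum.mono_neutral_right)
    show "\<forall>i\<in>{1..n} - {2..n}. Const (of_nat (i - 1)) * Var i = (0 :: 'k mpoly)"
    proof
      fix i assume "i \<in> {1..n} - {2..n}"
      then have "i = 1" by auto
      then show "Const (of_nat (i - 1)) * Var i = (0 :: 'k mpoly)" by simp
    qed
  qed auto
  then have f2: "f2 = lin n (\<lambda>j. of_nat (j - 1))" by (simp only: assms(4) Const_of_nat)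
  show ?thesis
    unfolding f1 f2
    using system_of_parameters_forms cohen_macaulay_if_regular regular_if_cohen_macaulay by blast
qed

end
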